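(* Let $D$ be a connected link diagram on a closed, connected, oriented surface $\Sigma$ of genus $g$, and suppose $D$ has $n$ crossings. For any state $S$ of $D$ with dual state $S^\vee$, we have: (a) $|S|+|S^\vee|\le n+2$. (b) $k(S)+k(S^\vee)\le n+2-2g$, provided that $D$ is cellularly embedded.
   Context: A link diagram on $\Sigma$ is a regular projection of a link in $\Sigma\times[0,1]$ (a tetravalent graph, closed loops without vertices allowed) with over/under information at the double points; it is connected if the underlying subset of $\Sigma$ is connected, and cellularly embedded if $\Sigma\smallsetminus D$ is a union of open disks. At each crossing there is an $A$-smoothing and a $B$-smoothing (the two ways of replacing the crossing by two disjoint arcs: rotating the overstrand counterclockwise sweeps out two opposite regions, the $A$-smoothing joins these two regions, the $B$-smoothing joins the other two). A state $S$ is the collection of disjoint simple closed curves (cycles) in $\Sigma$ obtained by choosing a smoothing at every crossing; $|S|$ is its number of cycles and $k(S)=\dim\ker(H_1(S;\mathbb Z/2)\to H_1(\Sigma;\mathbb Z/2))$, the map being induced by inclusion. The dual state $S^\vee$ is obtained by performing the opposite smoothing at each crossing. *)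

theory Defs
  imports "HOL-Complex_Analysis.Complex_Analysis" "HOL-Homology.Homology"
begin

section \<open>Closed oriented surfaces\<close>

text \<open>A homeomorphism between open subsets of the plane preserves orientation if small
  counterclockwise circles are mapped to curves of winding number \<open>1\<close> around the image of the
  centre.\<close>

definition orientation_preserving_on :: "complex set \<Rightarrow> (complex \<Rightarrow> complex) \<Rightarrow> bool" where
  "orientation_preserving_on W f \<longleftrightarrow>
     (\<forall>z r. 0 < r \<and> cball z r \<subseteq> W \<longrightarrow> winding_number (f \<circ> circlepath z r) (f z) = 1)"

type_synonym 'a chart = "'a set \<times> ('a \<Rightarrow> complex)"

definition surface_chart :: "'a topology \<Rightarrow> 'a chart \<Rightarrow> bool" where
  "surface_chart X = (\<lambda>(U, \<phi>).
     openin X U \<and> open (\<phi> ` U) \<and>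
     homeomorphic_map (subtopology X U) (top_of_set (\<phi> ` U)) \<phi>)"

definition oriented_transition :: "'a chart \<Rightarrow> 'a chart \<Rightarrow> bool" where
  "oriented_transition = (\<lambda>(U, \<phi>) (V, \<psi>).
     orientation_preserving_on (\<phi> ` (U \<inter> V)) (\<psi> \<circ> inv_into U \<phi>))"

definition oriented_atlas :: "'a topology \<Rightarrow> 'a chart set \<Rightarrow> bool" where
  "oriented_atlas X \<A> \<longleftrightarrow>
     (\<forall>c\<in>\<A>. surface_chart X c) \<and>
     (\<Union>c\<in>\<A>. fst c) = topspace X \<and>
     (\<forall>c\<in>\<A>. \<forall>d\<in>\<A>. oriented_transition c d)"

definition closed_connected_oriented_surface :: "'a topology \<Rightarrow> 'a chart set \<Rightarrow> bool" where
  "closed_connected_oriented_surface X \<A> \<longleftrightarrow>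
     topspace X \<noteq> {} \<and> Hausdorff_space X \<and> compact_space X \<and> connected_space X \<and>
     oriented_atlas X \<A>"

definition positive_chart :: "'a topology \<Rightarrow> 'a chart set \<Rightarrow> 'a chart \<Rightarrow> bool" where
  "positive_chart X \<A> c \<longleftrightarrow> surface_chart X c \<and> (\<forall>d\<in>\<A>. oriented_transition d c)"

text \<open>A closed connected oriented surface has genus \<open>g\<close> iff its first integral homology group is
  free abelian of rank \<open>2 g\<close>.\<close>

definition has_genus :: "'a topology \<Rightarrow> nat \<Rightarrow> bool" where
  "has_genus X g \<longleftrightarrow> homology_group 1 X \<cong> free_Abelian_group {..<2 * g}"


section \<open>Singular homology with coefficients in the field with two elements\<close>

text \<open>The complex of singular chains mod 2 is the quotient of the integral singular chain complex
  by its multiples of \<open>2\<close>. Its cycles are represented by the integral chains whose boundary is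
  divisible by \<open>2\<close>, and two of these are homologous mod 2 iff they differ by a boundary plus a
  multiple of \<open>2\<close>.\<close>

definition mod2_cycle_set :: "nat \<Rightarrow> 'a topology \<Rightarrow> 'a chain set" where
  "mod2_cycle_set p X =
     {c. singular_chain p X c \<and>
         (\<exists>d. singular_chain (p - 1) X d \<and> chain_boundary p c = frag_cmul 2 d)}"

definition mod2_boundary_set :: "nat \<Rightarrow> 'a topology \<Rightarrow> 'a chain set" where
  "mod2_boundary_set p X =
     {chain_boundary (Suc p) e + frag_cmul 2 d | e d.
        singular_chain (Suc p) X e \<and> singular_chain p X d}"

definition mod2_homology_group :: "nat \<Rightarrow> 'a topology \<Rightarrow> 'a chain set monoid" where
  "mod2_homology_group p X =
     subgroup_generated (chain_group p X) (mod2_cycle_set p X) Mod mod2_boundary_set p X"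

text \<open>The class \<open>c + B(X)\<close> is sent to \<open>f c + B(Y) = f (c + B(X)) + B(Y)\<close>.\<close>

definition mod2_hom_induced ::
  "nat \<Rightarrow> ('a \<Rightarrow> 'b) \<Rightarrow> 'b topology \<Rightarrow> 'a chain set \<Rightarrow> 'b chain set" where
  "mod2_hom_induced p f Y \<alpha> = mod2_boundary_set p Y <#>\<^bsub>chain_group p Y\<^esub> (chain_map p f ` \<alpha>)"

text \<open>In an elementary abelian 2-group the subgroup generated by a set is its linear span over the
  field with two elements, so this is the dimension of the subspace \<open>V\<close> if that is finite.\<close>

definition mod2_dim :: "('g, 'm) monoid_scheme \<Rightarrow> 'g set \<Rightarrow> nat" where
  "mod2_dim G V = (LEAST d. \<exists>B. finite B \<and> card B = d \<and> B \<subseteq> V \<and> generate G B = V)"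

definition homological_nullity :: "'a topology \<Rightarrow> 'a set \<Rightarrow> nat" where
  "homological_nullity X S =
     (let H\<^sub>S = mod2_homology_group 1 (subtopology X S); H\<^sub>X = mod2_homology_group 1 X
      in mod2_dim H\<^sub>S (kernel H\<^sub>S H\<^sub>X (mod2_hom_induced 1 id X)))"


section \<open>Link diagrams\<close>

text \<open>A link in the thickened surface is a finite disjoint union of simple closed curves. The
  real coordinate is the height, so the larger one belongs to the overstrand.\<close>

definition link_in_thickening :: "'a topology \<Rightarrow> ('a \<times> real) set \<Rightarrow> bool" where
  "link_in_thickening X L \<longleftrightarrow>
     L \<subseteq> topspace X \<times> {0..1} \<and>
     (\<exists>\<K>. finite \<K> \<and> disjoint \<K> \<and> \<Union>\<K> = L \<and>
        (\<forall>K\<in>\<K>. subtopology (prod_topology X euclideanreal) K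
                  homeomorphic_space top_of_set (sphere (0::complex) 1)))"

definition projection :: "('a \<times> real) set \<Rightarrow> 'a set" where
  "projection L = fst ` L"

definition crossings :: "('a \<times> real) set \<Rightarrow> 'a set" where
  "crossings L = {x. \<exists>s t. s < t \<and> (x, s) \<in> L \<and> (x, t) \<in> L}"

text \<open>The projection to \<open>U\<close> of the branch of the link over \<open>U\<close> that passes through \<open>p\<close>.\<close>

definition strand :: "'a topology \<Rightarrow> ('a \<times> real) set \<Rightarrow> 'a set \<Rightarrow> 'a \<times> real \<Rightarrow> 'a set" where
  "strand X L U p =
     fst ` connected_component_of_set
             (subtopology (prod_topology X euclideanreal) (L \<inter> U \<times> UNIV)) p"

text \<open>Orientation-preserving local coordinates around a crossing \<open>x\<close> in which the overstrand is
  the real axis and the understrand is the imaginary axis.\<close>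

definition crossing_chart ::
  "'a topology \<Rightarrow> 'a chart set \<Rightarrow> ('a \<times> real) set \<Rightarrow> 'a \<Rightarrow> 'a chart \<Rightarrow> bool" where
  "crossing_chart X \<A> L x = (\<lambda>(U, \<phi>).
     positive_chart X \<A> (U, \<phi>) \<and> x \<in> U \<and> \<phi> x = 0 \<and> \<phi> ` U = ball 0 2 \<and>
     \<phi> ` (U \<inter> projection L) = {z \<in> ball 0 2. Im z = 0 \<or> Re z = 0} \<and>
     (\<exists>s t. s < t \<and> (x, s) \<in> L \<and> (x, t) \<in> L \<and>
        \<phi> ` strand X L U (x, t) = {z \<in> ball 0 2. Im z = 0} \<and>
        \<phi> ` strand X L U (x, s) = {z \<in> ball 0 2. Re z = 0}))"

definition flat_chart :: "'a topology \<Rightarrow> 'a set \<Rightarrow> 'a \<Rightarrow> 'a chart \<Rightarrow> bool" where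
  "flat_chart X D x = (\<lambda>(U, \<phi>).
     surface_chart X (U, \<phi>) \<and> x \<in> U \<and> \<phi> x = 0 \<and> \<phi> ` U = ball 0 1 \<and>
     \<phi> ` (U \<inter> D) = {z \<in> ball 0 1. Im z = 0})"

text \<open>A link diagram is given by a link whose projection to the surface is regular: the only
  multiple points are finitely many transverse double points, and away from these the projection
  is a locally flat curve. The diagram as a subset of the surface is \<open>projection L\<close>.\<close>

definition link_diagram :: "'a topology \<Rightarrow> 'a chart set \<Rightarrow> ('a \<times> real) set \<Rightarrow> bool" where
  "link_diagram X \<A> L \<longleftrightarrow>
     link_in_thickening X L \<and>
     finite (crossings L) \<and>
     (\<forall>x\<in>crossings L. card {t. (x, t) \<in> L} = 2 \<and> (\<exists>c. crossing_chart X \<A> L x c)) \<and>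
     (\<forall>x\<in>projection L - crossings L. \<exists>c. flat_chart X (projection L) x c)"

definition connected_diagram :: "'a topology \<Rightarrow> ('a \<times> real) set \<Rightarrow> bool" where
  "connected_diagram X L \<longleftrightarrow> connectedin X (projection L)"

text \<open>The components of the complement are open, and they are the disks whose union it has to
  be.\<close>

definition cellularly_embedded :: "'a topology \<Rightarrow> ('a \<times> real) set \<Rightarrow> bool" where
  "cellularly_embedded X L \<longleftrightarrow>
     (\<forall>C\<in>connected_components_of (subtopology X (topspace X - projection L)).
        subtopology X C homeomorphic_space top_of_set (ball (0::complex) 1))"


section \<open>States\<close>

text \<open>A choice of pairwise disjoint crossing charts; the smoothings take place in the preimages of
  the closed unit disk. Different choices give isotopic states.\<close>

definition crossing_charts ::
  "'a topology \<Rightarrow> 'a chart set \<Rightarrow> ('a \<times> real) set \<Rightarrow> ('a \<Rightarrow> 'a chart) \<Rightarrow> bool" where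
  "crossing_charts X \<A> L \<Phi> \<longleftrightarrow>
     (\<forall>x\<in>crossings L. crossing_chart X \<A> L x (\<Phi> x)) \<and>
     disjoint_family_on (\<lambda>x. fst (\<Phi> x)) (crossings L)"

datatype smoothing = A_smoothing | B_smoothing

fun opposite_smoothing :: "smoothing \<Rightarrow> smoothing" where
  "opposite_smoothing A_smoothing = B_smoothing"
| "opposite_smoothing B_smoothing = A_smoothing"

text \<open>Turning the overstrand (the real axis) counterclockwise sweeps out the first and the third
  quadrant. These are joined by the \<open>A\<close>-smoothing, so its arcs run through the other two
  quadrants.\<close>

fun smoothing_arcs :: "smoothing \<Rightarrow> complex set" where
  "smoothing_arcs A_smoothing = closed_segment 1 (- \<i>) \<union> closed_segment (- 1) \<i>"
| "smoothing_arcs B_smoothing = closed_segment 1 \<i> \<union> closed_segment (- 1) (- \<i>)"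

definition state ::
  "('a \<times> real) set \<Rightarrow> ('a \<Rightarrow> 'a chart) \<Rightarrow> ('a \<Rightarrow> smoothing) \<Rightarrow> 'a set" where
  "state L \<Phi> \<sigma> =
     (projection L - (\<Union>x\<in>crossings L. {y \<in> fst (\<Phi> x). snd (\<Phi> x) y \<in> ball 0 1})) \<union>
     (\<Union>x\<in>crossings L. {y \<in> fst (\<Phi> x). snd (\<Phi> x) y \<in> smoothing_arcs (\<sigma> x)})"

definition dual_state ::
  "('a \<times> real) set \<Rightarrow> ('a \<Rightarrow> 'a chart) \<Rightarrow> ('a \<Rightarrow> smoothing) \<Rightarrow> 'a set" where
  "dual_state L \<Phi> \<sigma> = state L \<Phi> (opposite_smoothing \<circ> \<sigma>)"

text \<open>A state is a disjoint union of simple closed curves; these are its connected components.\<close>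

definition state_cycles :: "'a topology \<Rightarrow> 'a set \<Rightarrow> 'a set set" where
  "state_cycles X S = connected_components_of (subtopology X S)"

end

theory Submission
  imports Defs "HOL-Library.Z2" "HOL-Library.Function_Algebras"
begin

text \<open>All homological information is extracted from cocycles mod 2 through their potentials: a cocycle
  kills the cycles of a space iff it is locally the coboundary of one function. Remove the open disks
  around the crossings from the diagram; what remains are \<open>2 n\<close> arcs. Fix cocycles \<open>c\<^sub>i\<close>, \<open>i < m\<close>, on
  the surface, and label a diagram by a combination \<open>c = \<Sum> B\<^sub>i c\<^sub>i\<close> together with a potential of \<open>c\<close>
  on the arcs. Let \<open>P(S)\<close> be the group of those labels whose potential extends over the state \<open>S\<close>. A
  label in \<open>P(S) \<inter> P(S\<^sup>\<or>)\<close> extends over the connected diagram, so if the \<open>c\<^sub>i\<close> are independent on the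
  diagram there are at most two of them. Labels in \<open>P(S) + P(S\<^sup>\<or>)\<close> satisfy one linear condition at
  each crossing, and connectedness makes \<open>n - 1\<close> of these independent. Hence
  \<open>|P(S)| |P(S\<^sup>\<or>)| \<le> 2^(m + n + 2)\<close>.

  For \<open>m = 0\<close> the group \<open>P(S)\<close> contains the \<open>2^|S|\<close> functions on the cycles of \<open>S\<close>, which gives (a). If the
  diagram is cellular then a cocycle with a potential on the diagram has one on the surface, so a
  basis of the \<open>2 g\<close>-dimensional cohomology of the surface is independent on the diagram. Comparing
  the cocycles on \<open>S\<close> with their mismatches at the crossings gives \<open>2^k(S) 2^(2 g) \<le> |P(S)|\<close>, and (b)
  follows.\<close>


section \<open>Elementary abelian 2-groups\<close>

text \<open>The constants come from counting bits. A label has \<open>m + 2 n\<close> bits before it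
  has to extend over anything. The condition at a crossing says that its four half-edge values sum
  to zero; for either smoothing this is the sum of the equations of its two arcs, so
  \<open>P(S)\<close> and its dual share it. Changing the label of one edge changes the sums at its
  two ends, so on a connected graph every vector of even weight occurs: \<open>P(S) + P(S')\<close>
  has at most \<open>m + n + 1\<close> bits, and the intersection has at most one. For (b), each
  function on a family of \<open>k\<close> independent cycles of \<open>S\<close> that bound in the
  surface comes from a cocycle on \<open>S\<close>. The resulting mismatches, with one bit for each
  of the \<open>2 n\<close> arcs of the smoothings, stay distinct modulo the mismatches of labels,
  since a cocycle of the surface vanishes on these cycles. Labels thus fill at most
  \<open>2 n - k\<close> bits, and \<open>P(S)\<close> keeps at least \<open>m + k\<close>. With
  \<open>m = 2 g\<close> the exponents give \<open>k + k' + 4 g \<le> 2 g + n + 2\<close>. No curve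
  of a state is ever parametrised. The count needs edges with ends, so a diagram without crossings
  is treated apart.\<close>

definition add_subgroup :: "'a::ab_group_add set \<Rightarrow> bool" where
  "add_subgroup M \<longleftrightarrow> 0 \<in> M \<and> (\<forall>x\<in>M. \<forall>y\<in>M. x - y \<in> M)"

definition additive_map :: "('a::ab_group_add \<Rightarrow> 'b::ab_group_add) \<Rightarrow> bool" where
  "additive_map f \<longleftrightarrow> (\<forall>x y. f (x + y) = f x + f y)"

lemma add_subgroup_zero: "add_subgroup M \<Longrightarrow> 0 \<in> M"
  and add_subgroup_diff: "add_subgroup M \<Longrightarrow> x \<in> M \<Longrightarrow> y \<in> M \<Longrightarrow> x - y \<in> M"
  by (auto simp: add_subgroup_def)

lemma add_subgroup_minus: "add_subgroup M \<Longrightarrow> x \<in> M \<Longrightarrow> - x \<in> M"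
  using add_subgroup_diff[of M 0 x] add_subgroup_zero[of M] by simp

lemma add_subgroup_add: "add_subgroup M \<Longrightarrow> x \<in> M \<Longrightarrow> y \<in> M \<Longrightarrow> x + y \<in> M"
  using add_subgroup_diff[of M x "- y"] add_subgroup_minus[of M y] by simp

lemma add_subgroup_sum: "add_subgroup M \<Longrightarrow> (\<And>i. i \<in> I \<Longrightarrow> f i \<in> M) \<Longrightarrow> sum f I \<in> M"
  by (induction I rule: infinite_finite_induct) (auto intro: add_subgroup_zero add_subgroup_add)

lemma additive_map_add: "additive_map f \<Longrightarrow> f (x + y) = f x + f y"
  by (simp add: additive_map_def)

lemma additive_map_zero: "additive_map f \<Longrightarrow> f 0 = 0"
  using additive_map_add[of f 0 0] by simp

lemma additive_map_minus: "additive_map f \<Longrightarrow> f (- x) = - f x"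
  using additive_map_add[of f x "- x"] additive_map_zero[of f] by (simp add: eq_neg_iff_add_eq_0 add.commute)

lemma additive_map_diff: "additive_map f \<Longrightarrow> f (x - y) = f x - f y"
  using additive_map_add[of f x "- y"] additive_map_minus[of f y] by simp

lemma bit_add_self [simp]: "(x::bit) + x = 0"
  by (cases x) auto

lemma bit_uminus [simp]: "- (x::bit) = x"
  by (metis bit_add_self neg_eq_iff_add_eq_0)

lemma bit_add_eq_0_iff: "(x::bit) + y = 0 \<longleftrightarrow> x = y"
  by (cases x; cases y) auto

lemma sum_fun_apply: "sum f A t = (\<Sum>y\<in>A. f y t :: 'b::comm_monoid_add)"
  by (induction A rule: infinite_finite_induct) auto

text \<open>Modulo \<open>M\<close> the group is a vector space over the field with two elements. A
  subgroup that is maximal among those containing \<open>M\<close> and avoiding \<open>w\<close> has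
  index 2, and \<open>F\<close> is the indicator of its complement.\<close>

lemma separating_functional:
  fixes M :: "'a::ab_group_add set"
  assumes M: "add_subgroup M" and dbl: "\<And>x. x + x \<in> M" and w: "w \<notin> M"
  obtains F :: "'a \<Rightarrow> bit" where "additive_map F" "\<And>x. x \<in> M \<Longrightarrow> F x = 0" "F w = 1"
proof -
  define \<S> where "\<S> = {N. add_subgroup N \<and> M \<subseteq> N \<and> w \<notin> N}"
  have "\<exists>N\<in>\<S>. \<forall>K\<in>\<S>. N \<subseteq> K \<longrightarrow> K = N"
  proof (rule subset_Zorn_nonempty)
    show "\<S> \<noteq> {}" using M w by (auto simp: \<S>_def)
    fix \<C> assume ne: "\<C> \<noteq> {}" and ch: "subset.chain \<S> \<C>"
    have sub: "\<C> \<subseteq> \<S>" and tot: "\<And>A B. A \<in> \<C> \<Longrightarrow> B \<in> \<C> \<Longrightarrow> A \<subseteq> B \<or> B \<subseteq> A"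
      using ch by (auto simp: subset.chain_def)
    have "x - y \<in> \<Union>\<C>" if xy: "x \<in> \<Union>\<C>" "y \<in> \<Union>\<C>" for x y
    proof -
      obtain A B where "A \<in> \<C>" "x \<in> A" "B \<in> \<C>" "y \<in> B" using xy by blast
      then obtain K where "K \<in> \<C>" "x \<in> K" "y \<in> K" using tot[of A B] by blast
      then show ?thesis using sub by (auto simp: \<S>_def dest: add_subgroup_diff)
    qed
    moreover have "0 \<in> \<Union>\<C>" using ne sub by (auto simp: \<S>_def dest: add_subgroup_zero)
    ultimately have "add_subgroup (\<Union>\<C>)" by (simp add: add_subgroup_def)
    then show "\<Union>\<C> \<in> \<S>" using ne sub by (auto simp: \<S>_def)
  qed
  then obtain N where N: "add_subgroup N" "M \<subseteq> N" "w \<notin> N"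
    and max: "\<And>K. add_subgroup K \<Longrightarrow> N \<subseteq> K \<Longrightarrow> w \<notin> K \<Longrightarrow> K = N"
    by (force simp: \<S>_def)
  have dblN: "x + x \<in> N" for x using dbl N(2) by blast
  \<comment> \<open>Adding the coset of \<open>y\<close> to \<open>N\<close> gives a strictly larger
    subgroup, which by maximality contains \<open>w\<close>; hence all elements outside
    \<open>N\<close> lie in the coset of \<open>w\<close>.\<close>
  have key: "y + w \<in> N" if y: "y \<notin> N" for y
  proof -
    define K where "K = N \<union> {x. x + y \<in> N}"
    have "x - z \<in> K" if xz: "x \<in> K" "z \<in> K" for x z
    proof -
      have "x - z \<in> N" if "x + y \<in> N" "z + y \<in> N"
        using add_subgroup_diff[OF N(1) that] by simp
      moreover have "x - z + y \<in> N" if "x \<in> N" "z + y \<in> N"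
        using add_subgroup_add[OF N(1) add_subgroup_diff[OF N(1) that] dblN[of y]]
        by (simp add: algebra_simps)
      moreover have "x - z + y \<in> N" if "x + y \<in> N" "z \<in> N"
        using add_subgroup_diff[OF N(1) that] by (simp add: algebra_simps)
      ultimately show ?thesis
        using xz add_subgroup_diff[OF N(1), of x z] by (auto simp: K_def)
    qed
    then have "add_subgroup K" using N(1) by (auto simp: add_subgroup_def K_def)
    moreover have "y \<in> K" using dblN by (auto simp: K_def)
    ultimately have "w \<in> K" using max[of K] y by (auto simp: K_def)
    then show ?thesis using N(3) by (simp add: K_def add.commute)
  qed
  define F where "F x = (if x \<in> N then 0 else 1 :: bit)" for x
  have "F (x + y) = F x + F y" for x y
  proof -
    have a: "x + y \<in> N" if "x \<notin> N" "y \<notin> N"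
    proof -
      have "(x + w) + (y + w) - (w + w) \<in> N"
        by (intro add_subgroup_diff[OF N(1)] add_subgroup_add[OF N(1)] key that dblN)
      then show ?thesis by (simp add: algebra_simps)
    qed
    have b: "x + y \<notin> N" if "x \<in> N" "y \<notin> N" for x y
      using add_subgroup_diff[OF N(1) _ that(1), of "x + y"] that(2) by auto
    show ?thesis
      using a b[of x y] b[of y x] add_subgroup_add[OF N(1), of x y]
      by (auto simp: F_def add.commute)
  qed
  moreover have "F x = 0" if "x \<in> M" for x using that N(2) by (auto simp: F_def)
  moreover have "F w = 1" using N(3) by (simp add: F_def)
  ultimately show ?thesis using that by (auto simp: additive_map_def)
qed

text \<open>With coefficients mod 2 subset sums take the place of linear combinations: up to a
  double they are closed under subtraction.\<close>

lemma sum_symdiff: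
  fixes z :: "'i \<Rightarrow> 'a::ab_group_add"
  assumes "finite I" "finite J"
  shows "sum z I - sum z J = sum z (sym_diff I J) - (sum z (J - I) + sum z (J - I))"
proof -
  have 1: "sum z I = sum z (I - J) + sum z (I \<inter> J)" and 2: "sum z J = sum z (J - I) + sum z (I \<inter> J)"
    using sum.Int_Diff[OF assms(1), of z J] sum.Int_Diff[OF assms(2), of z I]
    by (simp_all add: add.commute Int_commute)
  have 3: "sum z (sym_diff I J) = sum z (I - J) + sum z (J - I)"
    by (rule sum.union_disjoint) (use assms in auto)
  show ?thesis by (simp add: 1 2 3)
qed

text \<open>Independence modulo \<open>M\<close> allows arbitrary values to be prescribed on the
  \<open>z i\<close>. This is the source of the cocycles below, both those dual to cycles of the
  surface and those dual to cycles of a state.\<close>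

lemma dual_functionals:
  fixes M :: "'a::ab_group_add set" and z :: "'i \<Rightarrow> 'a" and f :: "'i \<Rightarrow> bit"
  assumes M: "add_subgroup M" and dbl: "\<And>x. x + x \<in> M" and fin: "finite I"
    and ind: "\<And>J. J \<subseteq> I \<Longrightarrow> J \<noteq> {} \<Longrightarrow> sum z J \<notin> M"
  shows "\<exists>F. additive_map F \<and> (\<forall>x\<in>M. F x = 0) \<and> (\<forall>i\<in>I. F (z i) = f i)"
  using fin ind
proof (induction I)
  case empty
  then show ?case by (intro exI[of _ "\<lambda>_. 0"]) (simp add: additive_map_def)
next
  case (insert i I)
  obtain F where F: "additive_map F" "\<forall>x\<in>M. F x = 0" "\<forall>i\<in>I. F (z i) = f i"
    using insert.IH insert.prems by (metis subset_insertI2)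
  define N where "N = {m + sum z J | m J. m \<in> M \<and> J \<subseteq> I}"
  have MN: "M \<subseteq> N" by (force simp: N_def)
  have "x - y \<in> N" if xy: "x \<in> N" "y \<in> N" for x y
  proof -
    obtain m J m' J' where *: "x = m + sum z J" "y = m' + sum z J'" "m \<in> M" "m' \<in> M" "J \<subseteq> I" "J' \<subseteq> I"
      using xy by (auto simp: N_def)
    define d where "d = sum z (J' - J)"
    have "x - y = ((m - m') - (d + d)) + sum z (sym_diff J J')"
      using sum_symdiff[OF finite_subset[OF *(5) insert.hyps(1)] finite_subset[OF *(6) insert.hyps(1)], of z] *(1,2)
      by (simp add: d_def algebra_simps)
    moreover have "(m - m') - (d + d) \<in> M"
      by (intro add_subgroup_diff[OF M] dbl *)
    ultimately show ?thesis using * unfolding N_def by blast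
  qed
  moreover have "0 \<in> N" using MN M add_subgroup_zero by blast
  ultimately have N: "add_subgroup N" by (simp add: add_subgroup_def)
  have "z i \<notin> N"
  proof
    assume "z i \<in> N"
    then obtain m J where *: "z i = m + sum z J" "m \<in> M" "J \<subseteq> I" by (auto simp: N_def)
    have "sum z (insert i J) = m + (sum z J + sum z J)"
      using * insert.hyps finite_subset by (subst sum.insert) (auto simp: algebra_simps)
    then have "sum z (insert i J) \<in> M" using *(2) dbl add_subgroup_add[OF M] by simp
    then show False using insert.prems[of "insert i J"] *(3) by blast
  qed
  then obtain H :: "'a \<Rightarrow> bit" where H: "additive_map H" "\<And>x. x \<in> N \<Longrightarrow> H x = 0" "H (z i) = 1"
    using separating_functional[OF N] dbl MN by blast
  have zN: "z j \<in> N" if "j \<in> I" for j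
    unfolding N_def using that add_subgroup_zero[OF M]
    by (intro CollectI exI[of _ 0] exI[of _ "{j}"]) auto
  \<comment> \<open>\<open>H\<close> vanishes on the span of \<open>M\<close> and the earlier
    elements and is 1 at \<open>z i\<close>, so adding a multiple of it corrects the value at
    \<open>z i\<close> and keeps the others.\<close>
  define F' where "F' x = F x + (F (z i) + f i) * H x" for x
  have "additive_map F'" using F(1) H(1) by (auto simp: additive_map_def F'_def algebra_simps)
  moreover have "F' x = 0" if "x \<in> M" for x
    using F(2) H(2) that MN by (auto simp: F'_def)
  moreover have "F' (z j) = f j" if "j \<in> I" for j using F(3) H(2)[OF zN[OF that]] that by (auto simp: F'_def)
  moreover have "F' (z i) = f i" using H(3)
    by (simp add: F'_def) (metis add.assoc add.left_neutral bit_add_self)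
  ultimately show ?case by (intro exI[of _ F']) auto
qed

section \<open>Counting in finite subgroups\<close>

lemma card_additive_image:
  fixes f :: "'a::ab_group_add \<Rightarrow> 'b::ab_group_add"
  assumes G: "add_subgroup G" "finite G" and f: "\<And>x y. x \<in> G \<Longrightarrow> y \<in> G \<Longrightarrow> f (x - y) = f x - f y"
  shows "card (f ` G) * card {x\<in>G. f x = 0} = card G"
proof -
  have "card {x\<in>G. f x = y} = card {x\<in>G. f x = 0}" if y: "y \<in> f ` G" for y
  proof -
    obtain x0 where x0: "x0 \<in> G" "y = f x0" using y by blast
    \<comment> \<open>Each non-empty fibre is a translate of the kernel.\<close>
    have "bij_betw (\<lambda>x. x - x0) {x\<in>G. f x = y} {x\<in>G. f x = 0}"
    proof (rule bij_betwI')
      fix x assume "x \<in> {x\<in>G. f x = 0}"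
      then have x: "x \<in> G" "f x = 0" by auto
      have m: "- x0 \<in> G" using add_subgroup_minus[OF G(1) x0(1)] .
      have "f (0 - x0) = f 0 - f x0" "f (x0 - x0) = f x0 - f x0"
        using f add_subgroup_zero[OF G(1)] x0 by blast+
      then have "f (x - - x0) = y" using f[OF x(1) m] x x0 by simp
      moreover have "x - - x0 \<in> G" using add_subgroup_diff[OF G(1) x(1) m] .
      ultimately show "\<exists>x'\<in>{x \<in> G. f x = y}. x = x' - x0" by (intro bexI[of _ "x - - x0"]) auto
    qed (use x0 f add_subgroup_diff[OF G(1)] in auto)
    then show ?thesis by (rule bij_betw_same_card)
  qed
  then have "(\<Sum>y\<in>f ` G. card {x\<in>G. f x = y}) = card (f ` G) * card {x\<in>G. f x = 0}" by simp
  moreover have "card G = (\<Sum>y\<in>f ` G. card {x\<in>G. f x = y})"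
    using sum.image_gen[OF G(2), of "\<lambda>_. 1::nat" f] by simp
  ultimately show ?thesis by simp
qed

text \<open>The count for the difference map on \<open>P \<times> Q\<close>, whose kernel is the
  diagonal copy of \<open>P \<inter> Q\<close>.\<close>

lemma card_mult_add_subgroups:
  assumes P: "add_subgroup P" "finite P" and Q: "add_subgroup Q" "finite Q"
  shows "card P * card Q = card {p - q | p q. p \<in> P \<and> q \<in> Q} * card (P \<inter> Q)"
proof -
  define f where "f = (\<lambda>(p, q). p - q :: 'a)"
  have "add_subgroup (P \<times> Q)"
    using P Q by (auto simp: add_subgroup_def zero_prod_def)
  then have "card (f ` (P \<times> Q)) * card {x\<in>P \<times> Q. f x = 0} = card (P \<times> Q)"
    by (rule card_additive_image) (use P Q in \<open>auto simp: f_def\<close>)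
  moreover have "f ` (P \<times> Q) = {p - q | p q. p \<in> P \<and> q \<in> Q}" by (force simp: f_def)
  moreover have "{x\<in>P \<times> Q. f x = 0} = (\<lambda>p. (p, p)) ` (P \<inter> Q)" by (auto simp: f_def)
  then have "card {x\<in>P \<times> Q. f x = 0} = card (P \<inter> Q)" by (simp add: card_image inj_on_def)
  ultimately show ?thesis by (simp add: card_cartesian_product)
qed

text \<open>The space of functions from \<open>E\<close> to the field with two elements, extended by
  zero so that equality is that of total functions.\<close>

definition bit_funs :: "'e set \<Rightarrow> ('e \<Rightarrow> bit) set" where
  "bit_funs E = {a. \<forall>e. e \<notin> E \<longrightarrow> a e = 0}"

lemma bit_funs_bij: "bij_betw (\<lambda>T e. if e \<in> T then 1 else 0) (Pow E) (bit_funs E)"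
proof (rule bij_betwI')
  fix a assume a: "a \<in> bit_funs E"
  show "\<exists>T\<in>Pow E. a = (\<lambda>e. if e \<in> T then 1 else 0)"
    by (rule bexI[of _ "{e. a e = 1}"]) (use a in \<open>auto simp: bit_funs_def\<close>)
qed (auto simp: bit_funs_def fun_eq_iff split: if_splits)

lemma finite_bit_funs: "finite E \<Longrightarrow> finite (bit_funs E)"
  using bij_betw_finite[OF bit_funs_bij[of E]] by simp

lemma card_bit_funs: "finite E \<Longrightarrow> card (bit_funs E) = 2 ^ card E"
  using bij_betw_same_card[OF bit_funs_bij[of E]] by (simp add: card_Pow)

lemma add_subgroup_bit_funs: "add_subgroup (bit_funs E)"
  by (auto simp: add_subgroup_def bit_funs_def)


section \<open>Counting labellings of a four-valent graph\<close>

definition unit_dirs :: "complex set" where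
  "unit_dirs = {1, -1, \<i>, - \<i>}"

text \<open>A smoothing \<open>s\<close> joins the half-edge of direction \<open>z\<close> to the one of direction \<open>partner s z\<close>.\<close>

definition partner :: "smoothing \<Rightarrow> complex \<Rightarrow> complex" where
  "partner s z = (if (s = A_smoothing) = (z = 1 \<or> z = -1) then - \<i> * z else \<i> * z)"

definition invariant_along :: "'x set \<Rightarrow> ('x \<Rightarrow> smoothing) \<Rightarrow> ('x \<times> complex \<Rightarrow> bit) \<Rightarrow> bool" where
  "invariant_along C s f \<longleftrightarrow> (\<forall>x\<in>C. \<forall>z\<in>unit_dirs. f (x, z) = f (x, partner (s x) z))"

lemma i_neq: "\<i> \<noteq> 1" "\<i> \<noteq> -1" "-\<i> \<noteq> 1" "-\<i> \<noteq> -1" "1 \<noteq> \<i>" "-1 \<noteq> \<i>" "1 \<noteq> -\<i>" "-1 \<noteq> -\<i>"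
    "-\<i> \<noteq> \<i>" "\<i> \<noteq> -\<i>" "(1::complex) \<noteq> -1" "(-1::complex) \<noteq> 1"
  by (auto simp: complex_eq_iff)

lemma partner_simps [simp]:
  "partner A_smoothing 1 = -\<i>" "partner A_smoothing (-1) = \<i>"
  "partner A_smoothing \<i> = -1" "partner A_smoothing (-\<i>) = 1"
  "partner B_smoothing 1 = \<i>" "partner B_smoothing (-1) = -\<i>"
  "partner B_smoothing \<i> = 1" "partner B_smoothing (-\<i>) = -1"
  using i_neq by (auto simp: partner_def)

lemma card_unit_dirs: "card unit_dirs = 4" and finite_unit_dirs [simp]: "finite unit_dirs"
  using i_neq by (auto simp: unit_dirs_def)

lemma sum_unit_dirs: "sum f unit_dirs = f 1 + f (-1) + f \<i> + (f (-\<i>) :: 'a::comm_monoid_add)"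
  using i_neq by (simp add: unit_dirs_def add.assoc)

lemma partner_in_unit_dirs: "z \<in> unit_dirs \<Longrightarrow> partner s z \<in> unit_dirs"
  by (cases s) (auto simp: unit_dirs_def)

text \<open>One equation for each of the two arcs of the smoothing: \<open>partner\<close> is an
  involution that exchanges the real and the imaginary directions, so the arcs can be indexed by
  their real ends.\<close>

lemma invariant_along_iff:
  "invariant_along C s f \<longleftrightarrow> (\<forall>x\<in>C. \<forall>z\<in>{1, -1}. f (x, z) + f (x, partner (s x) z) = 0)"
proof -
  have "(\<forall>z\<in>unit_dirs. f (x, z) = f (x, partner (s x) z)) \<longleftrightarrow>
      (\<forall>z\<in>{1, -1}. f (x, z) + f (x, partner (s x) z) = 0)" for x
    by (cases "s x") (auto simp: unit_dirs_def bit_add_eq_0_iff)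
  then show ?thesis by (simp add: invariant_along_def)
qed

text \<open>The arcs of both smoothings together form a closed circuit through the four
  half-edges.\<close>

lemma invariant_along_opposite:
  assumes f: "invariant_along C s f" "invariant_along C (opposite_smoothing \<circ> s) f" and x: "x \<in> C" and z: "z \<in> unit_dirs"
  shows "f (x, z) = f (x, 1)"
proof -
  have "f (x, w) = f (x, partner (s x) w)" "f (x, w) = f (x, partner (opposite_smoothing (s x)) w)"
    if "w \<in> unit_dirs" for w
    using f x that by (simp_all add: invariant_along_def)
  from this[of 1] this[of "-1"] have "f (x, \<i>) = f (x, 1)" "f (x, -\<i>) = f (x, 1)" "f (x, -1) = f (x, 1)"
    by (cases "s x"; simp add: unit_dirs_def)+
  then show ?thesis using z unfolding unit_dirs_def by blast
qed

text \<open>The equations of the two arcs add up to a sum over all four half-edges that no longer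
  depends on the smoothing. This is the condition shared by a state and its dual.\<close>

lemma invariant_along_sum:
  assumes f: "invariant_along C s f" and x: "x \<in> C"
  shows "(\<Sum>z\<in>unit_dirs. f (x, z)) = 0"
proof -
  have "f (x, 1) + f (x, partner (s x) 1) = 0" "f (x, -1) + f (x, partner (s x) (-1)) = 0"
    using f x by (simp_all add: invariant_along_iff)
  then have "(f (x, 1) + f (x, partner (s x) 1)) + (f (x, -1) + f (x, partner (s x) (-1))) = 0" by simp
  then show ?thesis
    unfolding sum_unit_dirs by (cases "s x"; simp only: partner_simps ac_simps)
qed

text \<open>Half-edges are pairs of a crossing and a direction, and \<open>ed\<close> sends them to their edges. Relative to
  reference potentials of the cocycle given by \<open>B\<close> on the edges and on the disks around the crossings,
  which differ by \<open>\<mu> B p\<close> at the half-edge \<open>p\<close>, the potentials on the edges are given by a constant \<open>a e\<close>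
  for each edge \<open>e\<close>. Invariance along \<open>s\<close> says that the potential extends over the arcs of the state.\<close>

definition labellings ::
  "'x set \<Rightarrow> ('x \<times> complex \<Rightarrow> 'e) \<Rightarrow> 'b set \<Rightarrow> ('b \<Rightarrow> 'x \<times> complex \<Rightarrow> bit) \<Rightarrow> ('x \<Rightarrow> smoothing) \<Rightarrow> ('b \<times> ('e \<Rightarrow> bit)) set" where
  "labellings C ed Bs \<mu> s =
     {(B, a). B \<in> Bs \<and> a \<in> bit_funs (ed ` (C \<times> unit_dirs)) \<and> invariant_along C s (\<lambda>p. \<mu> B p + a (ed p))}"

text \<open>A four-valent multigraph: \<open>two_ends\<close> counts half-edges, so an edge may
  return to its crossing. Connectedness enters only through the assumption \<open>const\<close> of
  \<open>labellings_product\<close>.\<close>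

locale labelled_graph =
  fixes C :: "'x set" and ed :: "'x \<times> complex \<Rightarrow> 'e" and Bs :: "'b::ab_group_add set"
    and \<mu> :: "'b \<Rightarrow> 'x \<times> complex \<Rightarrow> bit"
  assumes finC: "finite C" and C_ne: "C \<noteq> {}"
    and two_ends: "\<And>e. e \<in> ed ` (C \<times> unit_dirs) \<Longrightarrow> card {p \<in> C \<times> unit_dirs. ed p = e} = 2"
    and Bs: "finite Bs" "add_subgroup Bs"
    and \<mu>: "\<And>B B' p. \<mu> (B - B') p = \<mu> B p + \<mu> B' p"
begin

definition "E = ed ` (C \<times> unit_dirs)"
definition "G = Bs \<times> bit_funs E"

lemma finE: "finite E" using finC by (simp add: E_def)

lemma card_E: "card E = 2 * card C"
proof -
  have "card (C \<times> unit_dirs) = (\<Sum>e\<in>E. card {p \<in> C \<times> unit_dirs. ed p = e})"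
    using sum.image_gen[of "C \<times> unit_dirs" "\<lambda>_. 1::nat" ed] finC by (simp add: E_def)
  also have "\<dots> = 2 * card E" using two_ends by (simp add: E_def)
  finally show ?thesis by (simp add: card_cartesian_product card_unit_dirs)
qed

lemma finG: "finite G" and subG: "add_subgroup G" and card_G: "card G = card Bs * 2 ^ (2 * card C)"
  using Bs add_subgroup_bit_funs[of E] finite_bit_funs[OF finE] card_bit_funs[OF finE]
  by (auto simp: G_def card_cartesian_product card_E add_subgroup_def zero_prod_def)

lemma \<mu>_zero: "\<mu> 0 p = 0" using \<mu>[of 0 0 p] by simp

text \<open>The jumps of a label across the arcs of \<open>s\<close>, one coordinate for each arc,
  indexed by its real end; the kernel consists of the labels that extend over the state. Zero
  elsewhere keeps the values in a space of \<open>2 * card C\<close> bits.\<close>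

definition "mismatch s v = (\<lambda>(x, z). if x \<in> C \<and> z \<in> {1, -1}
   then (\<mu> (fst v) (x, z) + snd v (ed (x, z))) + (\<mu> (fst v) (x, partner (s x) z) + snd v (ed (x, partner (s x) z))) else 0)"

lemma mismatch_diff: "mismatch s (v - w) = mismatch s v - mismatch s w"
proof
  fix p :: "'x \<times> complex"
  obtain x z where p: "p = (x, z)" by fastforce
  show "mismatch s (v - w) p = (mismatch s v - mismatch s w) p"
  proof (cases "x \<in> C \<and> z \<in> {1, -1}")
    case True
    then show ?thesis
      unfolding p by (simp only: mismatch_def case_prod_conv fst_diff snd_diff minus_apply \<mu> minus_bit_def if_True simp_thms ac_simps)
  next
    case False
    then show ?thesis
      unfolding p by (simp only: mismatch_def case_prod_conv minus_apply if_False diff_self)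
  qed
qed

lemma labellings_eq: "labellings C ed Bs \<mu> s = {v \<in> G. mismatch s v = 0}"
proof -
  have "(\<lambda>(x, z). if x \<in> C \<and> z \<in> Z then q x z else 0) = 0 \<longleftrightarrow> (\<forall>x\<in>C. \<forall>z\<in>Z. q x z = 0)"
    for q :: "'x \<Rightarrow> complex \<Rightarrow> bit" and Z
    unfolding fun_eq_iff by auto
  then have "mismatch s (B, a) = 0 \<longleftrightarrow> invariant_along C s (\<lambda>p. \<mu> B p + a (ed p))" for B a
    unfolding mismatch_def fst_conv snd_conv invariant_along_iff .
  then show ?thesis by (auto simp only: labellings_def G_def E_def)
qed

lemma labellings_subgroup: "add_subgroup (labellings C ed Bs \<mu> s)" "finite (labellings C ed Bs \<mu> s)"
proof -
  have "mismatch s 0 = 0" using mismatch_diff[of s 0 0] by simp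
  then show "add_subgroup (labellings C ed Bs \<mu> s)"
    unfolding labellings_eq add_subgroup_def using subG by (auto simp: add_subgroup_def mismatch_diff)
qed (simp add: labellings_eq finG)

text \<open>All mismatches live in a space of \<open>2 * card C\<close> bits, while \<open>G\<close>
  has \<open>card Bs * 2 ^ (2 * card C)\<close> elements. If \<open>2 ^ card V\<close> vectors
  remain distinct modulo the image of \<open>G\<close>, that image is at most the fraction
  \<open>1 / 2 ^ card V\<close> of the space, and the kernel is correspondingly large. The map
  \<open>m\<close> may fail to be additive, so it can come from unrelated choices for each
  function.\<close>

lemma independent_count:
  assumes V: "finite V" and m: "\<And>f. f \<in> bit_funs V \<Longrightarrow> m f \<in> bit_funs (C \<times> {1, -1})"
    and inj: "\<And>f f' v. f \<in> bit_funs V \<Longrightarrow> f' \<in> bit_funs V \<Longrightarrow> v \<in> G \<Longrightarrow> m f + m f' = mismatch s v \<Longrightarrow> f = f'"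
  shows "2 ^ card V * card Bs \<le> card (labellings C ed Bs \<mu> s)"
proof -
  let ?I = "mismatch s ` G" and ?M = "bit_funs (C \<times> {1, -1 :: complex})"
  have mm: "mismatch s v \<in> ?M" for v by (auto simp: mismatch_def bit_funs_def)
  have self: "h + h = 0" for h :: "'x \<times> complex \<Rightarrow> bit" by (simp add: fun_eq_iff)
  have "card (bit_funs V \<times> ?I) \<le> card ?M"
  proof (rule card_inj_on_le[where f="\<lambda>(f, t). m f + t"])
    show "inj_on (\<lambda>(f, t). m f + t) (bit_funs V \<times> ?I)"
    proof (rule inj_onI, clarify)
      fix f f' v v' assume *: "f \<in> bit_funs V" "f' \<in> bit_funs V" "v \<in> G" "v' \<in> G"
        "m f + mismatch s v = m f' + mismatch s v'"
      have "m f + m f' = mismatch s (v' - v)"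
      proof (rule ext)
        fix p
        have "m f p + mismatch s v p = m f' p + mismatch s v' p"
          using *(5) by (metis plus_fun_apply)
        then show "(m f + m f') p = mismatch s (v' - v) p"
          by (cases "m f p"; cases "m f' p"; cases "mismatch s v p"; cases "mismatch s v' p")
            (auto simp: mismatch_diff)
      qed
      then have "f = f'" using inj[OF *(1,2)] add_subgroup_diff[OF subG *(4,3)] by blast
      then show "f = f' \<and> mismatch s v = mismatch s v'" using *(5) by auto
    qed
    show "(\<lambda>(f, t). m f + t) ` (bit_funs V \<times> ?I) \<subseteq> ?M"
      using m mm by (auto simp: bit_funs_def)
    show "finite ?M" using finC by (simp add: finite_bit_funs)
  qed
  then have le: "2 ^ card V * card ?I \<le> 2 ^ (2 * card C)"
    using V finC by (simp add: card_cartesian_product card_bit_funs mult.commute flip: mult_2_right)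
  have "card ?I * card (labellings C ed Bs \<mu> s) = card Bs * 2 ^ (2 * card C)"
    using card_additive_image[OF subG finG, of "mismatch s"] by (simp add: mismatch_diff labellings_eq card_G)
  then have eq: "card ?I * card (labellings C ed Bs \<mu> s) = card Bs * 2 ^ (2 * card C)" .
  have I0: "card ?I > 0" using finG subG add_subgroup_zero by (fastforce simp: card_gt_0_iff)
  have "card ?I * (2 ^ card V * card Bs) = (2 ^ card V * card ?I) * card Bs" by simp
  also have "\<dots> \<le> 2 ^ (2 * card C) * card Bs" using le mult_le_mono1 by blast
  also have "\<dots> = card ?I * card (labellings C ed Bs \<mu> s)" using eq by simp
  finally show ?thesis using I0 by simp
qed

text \<open>Let \<open>F\<close> record the sums of the four half-edge values at the crossings. It
  vanishes on both groups, so their difference set \<open>W\<close> lies in its kernel, while its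
  image \<open>R\<close> has at least \<open>2 ^ (card C - 1)\<close> elements. Of the exponent
  \<open>card C + 2\<close>, the part \<open>card C + 1\<close> comes from this kernel and 1 from
  the common labels, which by \<open>const\<close> are determined by one bit.\<close>

lemma labellings_product:
  assumes const: "\<And>B a. (B, a) \<in> labellings C ed Bs \<mu> s \<Longrightarrow> (B, a) \<in> labellings C ed Bs \<mu> (opposite_smoothing \<circ> s)
      \<Longrightarrow> B = 0 \<and> (\<exists>t. \<forall>e\<in>E. a e = t)"
  shows "card (labellings C ed Bs \<mu> s) * card (labellings C ed Bs \<mu> (opposite_smoothing \<circ> s))
    \<le> card Bs * 2 ^ (card C + 2)"
proof -
  let ?P = "labellings C ed Bs \<mu> s" and ?P' = "labellings C ed Bs \<mu> (opposite_smoothing \<circ> s)"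
  define F where "F v = (\<lambda>x. if x \<in> C then \<Sum>z\<in>unit_dirs. \<mu> (fst v) (x, z) + snd v (ed (x, z)) else 0)" for v
  define W where "W = {p - q | p q. p \<in> ?P \<and> q \<in> ?P'}"
  have F_diff: "F (v - w) = F v - F w" for v w
  proof
    fix x
    have "(\<Sum>z\<in>unit_dirs. \<mu> (fst (v - w)) (x, z) + snd (v - w) (ed (x, z))) =
        (\<Sum>z\<in>unit_dirs. \<mu> (fst v) (x, z) + snd v (ed (x, z))) + (\<Sum>z\<in>unit_dirs. \<mu> (fst w) (x, z) + snd w (ed (x, z)))"
      unfolding sum.distrib[symmetric]
      by (rule sum.cong) (simp_all only: fst_diff snd_diff minus_apply \<mu> minus_bit_def ac_simps)
    then show "F (v - w) x = (F v - F w) x" by (simp only: F_def minus_apply minus_bit_def) simp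
  qed
  have F0: "F v = 0" if "v \<in> labellings C ed Bs \<mu> s'" for v s'
  proof
    fix x
    have "invariant_along C s' (\<lambda>p. \<mu> (fst v) p + snd v (ed p))"
      using that by (simp add: labellings_def split_beta)
    from invariant_along_sum[OF this] show "F v x = 0 x" by (simp only: F_def zero_fun_apply) simp
  qed
  have PG: "labellings C ed Bs \<mu> s' \<subseteq> G" for s' by (auto simp: labellings_eq)
  have "W \<subseteq> {v\<in>G. F v = 0}"
  proof
    fix w assume "w \<in> W"
    then obtain p q where pq: "p \<in> ?P" "q \<in> ?P'" "w = p - q" unfolding W_def by blast
    then have "F w = 0" by (simp only: F_diff F0 diff_zero)
    moreover have "w \<in> G" using pq PG add_subgroup_diff[OF subG] by blast
    ultimately show "w \<in> {v\<in>G. F v = 0}" by simp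
  qed
  then have cW: "card W \<le> card {v\<in>G. F v = 0}" using finG by (auto intro: card_mono)
  have "?P \<inter> ?P' \<subseteq> (\<lambda>t. (0, \<lambda>e. if e \<in> E then t else 0)) ` UNIV"
  proof
    fix v assume "v \<in> ?P \<inter> ?P'"
    moreover obtain B a where v: "v = (B, a)" by fastforce
    ultimately obtain t where "B = 0" "\<forall>e\<in>E. a e = t" "a \<in> bit_funs E"
      using const[of B a] by (auto simp: labellings_eq G_def)
    then have "v = (0, \<lambda>e. if e \<in> E then t else 0)" by (auto simp: v bit_funs_def fun_eq_iff)
    then show "v \<in> (\<lambda>t. (0, \<lambda>e. if e \<in> E then t else 0)) ` UNIV" by blast
  qed
  also have "(UNIV :: bit set) = {0, 1}" by (auto intro: bit.exhaust)
  finally have sub: "?P \<inter> ?P' \<subseteq> (\<lambda>t. (0, \<lambda>e. if e \<in> E then t else 0)) ` {0, 1}" .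
  have "card (?P \<inter> ?P') \<le> card ((\<lambda>t. (0::'b, \<lambda>e. if e \<in> E then t else 0)) ` {0, 1::bit})"
    by (rule card_mono[OF _ sub]) simp
  also have "\<dots> \<le> 2" using card_image_le[of "{0, 1::bit}" "\<lambda>t. (0::'b, \<lambda>e. if e \<in> E then t else 0)"] by simp
  finally have c2: "card (?P \<inter> ?P') \<le> 2" .
  define R where "R = F ` G"
  have R: "add_subgroup R"
    unfolding add_subgroup_def
  proof (intro conjI ballI)
    show "0 \<in> R" using F_diff[of 0 0] add_subgroup_zero[OF subG] by (force simp: R_def)
    fix x y assume "x \<in> R" "y \<in> R"
    then show "x - y \<in> R" using add_subgroup_diff[OF subG] unfolding R_def by (auto simp flip: F_diff)
  qed
  define \<delta> where "\<delta> x = (\<lambda>y. if y = x then 1 else 0 :: bit)" for x :: 'x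
  obtain x0 where x0: "x0 \<in> C" using C_ne by blast
  \<comment> \<open>The image of \<open>F\<close> contains \<open>\<delta> x + \<delta> y\<close>
    for the ends \<open>x\<close>, \<open>y\<close> of every edge, so \<open>T\<close> cannot be
    left along an edge.\<close>
  define T where "T = {x\<in>C. \<delta> x0 + \<delta> x \<in> R}"
  have ddz: "\<delta> x + \<delta> x = 0" for x by (simp add: fun_eq_iff)
  have x0T: "x0 \<in> T" using x0 add_subgroup_zero[OF R] by (simp add: T_def ddz)
  have edge: "y \<in> T" if x: "x \<in> T" "z \<in> unit_dirs" and y: "y \<in> C" "w \<in> unit_dirs" and e: "ed (x, z) = ed (y, w)" for x y z w
  proof (cases "x = y")
    case False
    have xC: "x \<in> C" using x by (simp add: T_def)
    define e0 where "e0 = ed (x, z)"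
    have e0E: "e0 \<in> E" using x xC by (auto simp: e0_def E_def)
    have fib: "{p \<in> C \<times> unit_dirs. ed p = e0} = {(x, z), (y, w)}"
    proof (rule sym, rule card_subset_eq)
      show "finite {p \<in> C \<times> unit_dirs. ed p = e0}" using finC by (simp add: finite_subset)
      show "{(x, z), (y, w)} \<subseteq> {p \<in> C \<times> unit_dirs. ed p = e0}"
        using x y xC e by (auto simp: e0_def)
      show "card {(x, z), (y, w)} = card {p \<in> C \<times> unit_dirs. ed p = e0}"
        using two_ends[of e0] e0E False by (simp add: E_def)
    qed
    \<comment> \<open>Changing one edge alters the sums exactly at its two ends, which are distinct
      in this case.\<close>
    have "F (0, \<lambda>e. if e = e0 then 1 else 0) = \<delta> x + \<delta> y"
    proof
      fix t
      show "F (0, \<lambda>e. if e = e0 then 1 else 0) t = (\<delta> x + \<delta> y) t"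
      proof (cases "t \<in> C")
        case True
        have "F (0, \<lambda>e. if e = e0 then 1 else 0) t = (\<Sum>u\<in>unit_dirs. if ed (t, u) = e0 then 1 else 0)"
          unfolding F_def using True by (simp only: if_True fst_conv snd_conv \<mu>_zero add_0_left)
        also have "\<dots> = (\<Sum>u\<in>unit_dirs. (if u = z then \<delta> x t else 0) + (if u = w then \<delta> y t else 0))"
        proof (rule sum.cong[OF refl])
          fix u assume u: "u \<in> unit_dirs"
          have "(t, u) \<in> {p \<in> C \<times> unit_dirs. ed p = e0} \<longleftrightarrow> (t, u) \<in> {(x, z), (y, w)}" by (simp only: fib)
          then have iff: "ed (t, u) = e0 \<longleftrightarrow> t = x \<and> u = z \<or> t = y \<and> u = w" using u True by simp
          show "(if ed (t, u) = e0 then 1 else 0) = (if u = z then \<delta> x t else 0) + (if u = w then \<delta> y t else 0)"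
            unfolding iff \<delta>_def using False by (cases "t = x"; cases "t = y"; simp)
        qed
        also have "\<dots> = \<delta> x t + \<delta> y t"
          unfolding sum.distrib using x y by (simp only: sum.delta finite_unit_dirs if_True)
        finally show ?thesis by simp
      qed (use xC y in \<open>auto simp: F_def \<delta>_def\<close>)
    qed
    moreover have "(0, \<lambda>e. if e = e0 then 1 else 0) \<in> G"
      using e0E Bs(2) by (auto simp: G_def bit_funs_def add_subgroup_zero)
    ultimately have "\<delta> x + \<delta> y \<in> R" unfolding R_def by (metis image_eqI)
    then have "(\<delta> x0 + \<delta> x) + (\<delta> x + \<delta> y) \<in> R"
      by (rule add_subgroup_add[OF R, rotated]) (use x in \<open>simp add: T_def\<close>)
    moreover have "(\<delta> x0 + \<delta> x) + (\<delta> x + \<delta> y) = \<delta> x0 + \<delta> y"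
      using ddz[of x] by (metis add.assoc add.right_neutral)
    ultimately show ?thesis using y by (simp add: T_def)
  qed (use x in simp)
  \<comment> \<open>The indicator of the edges that meet \<open>T\<close>. No edge leaves
    \<open>T\<close>, so the four values at a crossing are equal and the label extends over every
    state; by \<open>const\<close> it is constant, which forces \<open>T\<close> to be
    \<open>C\<close>.\<close>
  define a where "a e = (if \<exists>x\<in>T. \<exists>z\<in>unit_dirs. ed (x, z) = e then 1 else 0 :: bit)" for e
  have a: "a (ed (x, z)) = (if x \<in> T then 1 else 0)" if "x \<in> C" "z \<in> unit_dirs" for x z
    using edge that by (auto simp: a_def)
  have "(0, a) \<in> labellings C ed Bs \<mu> s'" for s'
  proof -
    have "a e = 0" if "e \<notin> ed ` (C \<times> unit_dirs)" for e
      using that unfolding a_def T_def by auto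
    moreover have "a (ed (x, z)) = a (ed (x, partner (s' x) z))" if "x \<in> C" "z \<in> unit_dirs" for x z
      using a[OF that] a[OF that(1) partner_in_unit_dirs[OF that(2)]] by simp
    ultimately show ?thesis
      using Bs(2) by (simp add: labellings_def add_subgroup_zero \<mu>_zero invariant_along_def bit_funs_def)
  qed
  then obtain t where t: "\<forall>e\<in>E. a e = t" using const by blast
  have TC: "x \<in> T" if "x \<in> C" for x
  proof -
    have "a (ed (x, 1)) = a (ed (x0, 1))" using t that x0 by (auto simp: E_def unit_dirs_def)
    then show ?thesis using a[of x 1] a[of x0 1] x0 x0T that by (auto simp: unit_dirs_def split: if_splits)
  qed
  \<comment> \<open>The value of such a sum at \<open>y \<noteq> x0\<close> tells whether
    \<open>y\<close> was summed, so the subsets of \<open>C - {x0}\<close> give distinct elements of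
    \<open>R\<close>.\<close>
  have "card (Pow (C - {x0})) \<le> card R"
  proof (rule card_inj_on_le[where f="\<lambda>U. \<Sum>y\<in>U. \<delta> x0 + \<delta> y"])
    have val: "(\<Sum>y\<in>U. \<delta> x0 + \<delta> y) t = (if t \<in> U then 1 else 0)" if "U \<subseteq> C - {x0}" "t \<in> C - {x0}" for U t
    proof -
      have fU: "finite U" using that finC finite_subset by blast
      have s: "(\<Sum>y\<in>U. \<delta> x0 + \<delta> y) t = (\<Sum>y\<in>U. (\<delta> x0 + \<delta> y) t)"
        by (rule sum_fun_apply)
      also have "\<dots> = (\<Sum>y\<in>U. if t = y then 1 else 0)"
        by (rule sum.cong) (use that in \<open>auto simp: \<delta>_def\<close>)
      also have "\<dots> = (if t \<in> U then 1 else 0)" by (simp only: sum.delta'[OF fU])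
      finally show ?thesis .
    qed
    show "inj_on (\<lambda>U. \<Sum>y\<in>U. \<delta> x0 + \<delta> y) (Pow (C - {x0}))"
    proof (rule inj_onI)
      fix U U' assume *: "U \<in> Pow (C - {x0})" "U' \<in> Pow (C - {x0})" "(\<Sum>y\<in>U. \<delta> x0 + \<delta> y) = (\<Sum>y\<in>U'. \<delta> x0 + \<delta> y)"
      have "t \<in> U \<longleftrightarrow> t \<in> U'" if "t \<in> C - {x0}" for t
        using val[of U t] val[of U' t] * that by (auto split: if_splits)
      then show "U = U'" using * by blast
    qed
    show "(\<lambda>U. \<Sum>y\<in>U. \<delta> x0 + \<delta> y) ` Pow (C - {x0}) \<subseteq> R"
      using TC by (auto intro!: add_subgroup_sum[OF R] simp: T_def)
    show "finite R" using finG by (simp add: R_def)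
  qed
  then have cR: "2 ^ (card C - 1) \<le> card R" using x0 finC by (simp add: card_Pow)
  have RK: "card R * card {v\<in>G. F v = 0} = card Bs * 2 ^ (2 * card C)"
    using card_additive_image[OF subG finG, of F] F_diff by (simp add: R_def card_G)
  obtain k where k: "card C = Suc k" using x0 finC by (metis card_gt_0_iff empty_iff gr0_implies_Suc)
  have "2 ^ (card C - 1) * card {v\<in>G. F v = 0} \<le> card Bs * 2 ^ (2 * card C)"
    using mult_le_mono1[OF cR, of "card {v\<in>G. F v = 0}"] RK by (simp only:)
  also have "2 ^ (2 * card C) = 2 ^ (card C - 1) * (2 ^ (card C + 1) :: nat)"
    unfolding power_add[symmetric] k by (rule arg_cong[of _ _ "power 2"]) simp
  also have "card Bs * \<dots> = 2 ^ (card C - 1) * (card Bs * 2 ^ (card C + 1))"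
    by (rule mult.left_commute)
  finally have K: "card {v\<in>G. F v = 0} \<le> card Bs * 2 ^ (card C + 1)"
    by (rule mult_left_le_imp_le) simp
  have "card ?P * card ?P' = card W * card (?P \<inter> ?P')"
    unfolding W_def using labellings_subgroup by (intro card_mult_add_subgroups)
  also have "\<dots> \<le> (card Bs * 2 ^ (card C + 1)) * 2"
    by (intro mult_le_mono c2 order_trans[OF cW K])
  finally show ?thesis by simp
qed

end


section \<open>Cocycles and potentials mod 2\<close>

text \<open>These rules turn sums of bits into propositions, which hides the group structure.\<close>

declare add_bit_eq_xor [simp del] mult_bit_eq_and [simp del]

lemma bit_add_shift: "((a::bit) + k) + (b + k) = a + b"
  by (cases a; cases b; cases k) auto

definition vert0 :: "nat \<Rightarrow> real" where "vert0 = (\<lambda>j. if j = 0 then 1 else 0)"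
definition vert1 :: "nat \<Rightarrow> real" where "vert1 = (\<lambda>j. if j = 1 then 1 else 0)"

definition point_simplex :: "'a \<Rightarrow> (nat \<Rightarrow> real) \<Rightarrow> 'a" where
  "point_simplex y = restrict (\<lambda>_. y) (standard_simplex 0)"

lemma verts_in_standard_simplex: "vert0 \<in> standard_simplex 0" "vert0 \<in> standard_simplex 1" "vert1 \<in> standard_simplex 1"
  by (auto simp: vert0_def vert1_def basis_in_standard_simplex)

lemma chain_boundary_1_of:
  "chain_boundary 1 (frag_of f) = frag_of (point_simplex (f vert1)) - frag_of (point_simplex (f vert0))"
proof -
  have 1: "simplical_face 0 vert0 = vert1" "simplical_face 1 vert0 = vert0"
    by (auto simp: simplical_face_def vert0_def vert1_def fun_eq_iff)
  have s0: "standard_simplex 0 = {vert0}" by (simp add: standard_simplex_0 vert0_def)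
  have "singular_face 1 0 f = point_simplex (f vert1)" "singular_face 1 1 f = point_simplex (f vert0)"
    by (simp_all add: singular_face_def point_simplex_def s0 restrict_def 1[simplified] cong: if_cong)
  then show ?thesis by (simp add: chain_boundary_of)
qed

text \<open>\<open>F\<close> is a functional on all chains and only the cocycle condition refers to
  \<open>T\<close>. Restriction to a smaller set thus leaves \<open>F\<close> unchanged, and one
  \<open>F\<close> can be compared on overlapping pieces.\<close>

definition cocycle_on :: "'a topology \<Rightarrow> 'a set \<Rightarrow> ('a chain \<Rightarrow> bit) \<Rightarrow> bool" where
  "cocycle_on X T F \<longleftrightarrow> additive_map F \<and> (\<forall>e. singular_chain 2 (subtopology X T) e \<longrightarrow> F (chain_boundary 2 e) = 0)"

definition potential_on :: "'a topology \<Rightarrow> 'a set \<Rightarrow> ('a chain \<Rightarrow> bit) \<Rightarrow> ('a \<Rightarrow> bit) \<Rightarrow> bool" where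
  "potential_on X T F u \<longleftrightarrow>
     (\<forall>f. singular_simplex 1 (subtopology X T) f \<longrightarrow> F (frag_of f) = u (f vert0) + u (f vert1))"

text \<open>For a cocycle on \<open>T\<close> this says that its class in the first cohomology mod 2
  of \<open>T\<close> vanishes.\<close>

definition kills_cycles :: "'a topology \<Rightarrow> 'a set \<Rightarrow> ('a chain \<Rightarrow> bit) \<Rightarrow> bool" where
  "kills_cycles X T F \<longleftrightarrow> (\<forall>z\<in>mod2_cycle_set 1 (subtopology X T). F z = 0)"

lemma cocycle_on_additive: "cocycle_on X T F \<Longrightarrow> additive_map F"
  by (simp add: cocycle_on_def)

lemma cocycle_on_mono: "cocycle_on X T F \<Longrightarrow> T' \<subseteq> T \<Longrightarrow> cocycle_on X T' F"
  unfolding cocycle_on_def using singular_chain_mono by blast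

lemma cocycle_on_add: "cocycle_on X T F \<Longrightarrow> cocycle_on X T F' \<Longrightarrow> cocycle_on X T (\<lambda>z. F z + F' z)"
  by (auto simp: cocycle_on_def additive_map_def algebra_simps)

lemma potential_on_mono: "potential_on X T F u \<Longrightarrow> T' \<subseteq> T \<Longrightarrow> potential_on X T' F u"
  unfolding potential_on_def using singular_simplex_mono by blast

lemma potential_on_add:
  "potential_on X T F u \<Longrightarrow> potential_on X T F' u' \<Longrightarrow> potential_on X T (\<lambda>z. F z + F' z) (\<lambda>y. u y + u' y)"
  by (auto simp: potential_on_def algebra_simps)

lemma potential_on_add_const: "potential_on X T F u \<Longrightarrow> potential_on X T F (\<lambda>y. u y + k)"
  by (simp only: potential_on_def bit_add_shift)

lemma singular_simplex_verts_in:
  assumes "singular_simplex 1 (subtopology X T) f"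
  shows "f vert0 \<in> T" "f vert1 \<in> T"
  using assms verts_in_standard_simplex by (auto simp: singular_simplex_subtopology)

lemma potential_on_cong:
  assumes "potential_on X T F u" "\<And>y. y \<in> T \<Longrightarrow> u y = u' y"
  shows "potential_on X T F u'"
  using assms singular_simplex_verts_in[of X T] by (fastforce simp: potential_on_def)

text \<open>Doubling does not change the support of an integral chain. This recovers the half of a
  double as a chain of the same subspace.\<close>

lemma singular_chain_double:
  "singular_chain p X (d + d) \<longleftrightarrow> singular_chain p X d"
proof -
  have "Poly_Mapping.keys (d + d) = Poly_Mapping.keys d"
    by (auto simp: in_keys_iff lookup_add)
  then show ?thesis by (simp add: singular_chain_def)
qed

lemma frag_cmul_2: "frag_cmul 2 d = d + (d :: 'b \<Rightarrow>\<^sub>0 int)"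
  by (rule poly_mapping_eqI) (simp add: lookup_add)

text \<open>The linear extension of \<open>u\<close> to 0-chains mod 2. The free abelian group on
  one element plays the part of the integers, and its coefficient is reduced mod 2.\<close>

definition eval0 :: "('a \<Rightarrow> bit) \<Rightarrow> 'a chain \<Rightarrow> bit" where
  "eval0 u c = of_int (Poly_Mapping.lookup
      (frag_extend (\<lambda>s. if u (s vert0) = 1 then frag_of () else 0) c) ())"

lemma additive_map_eval0: "additive_map (eval0 u)"
  by (simp add: additive_map_def eval0_def frag_extend_add lookup_add)

lemma eval0_point: "eval0 u (frag_of (point_simplex y)) = u y"
  using verts_in_standard_simplex by (auto simp: eval0_def point_simplex_def)

text \<open>Stokes' formula. The hypothesis concerns only the simplices of \<open>z\<close>, because
  after a subdivision just these are known to be small enough for a local potential.\<close>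

lemma eval_via_potential:
  assumes F: "additive_map F"
    and z: "\<And>f. f \<in> Poly_Mapping.keys z \<Longrightarrow> F (frag_of f) = u (f vert0) + u (f vert1)"
  shows "F z = eval0 u (chain_boundary 1 z)"
proof -
  have "Poly_Mapping.keys z \<subseteq> {f. F (frag_of f) = u (f vert0) + u (f vert1)}" using z by auto
  then show ?thesis
  proof (induction z rule: frag_induction)
    case zero
    then show ?case using additive_map_zero[OF F] additive_map_zero[OF additive_map_eval0] by simp
  next
    case (one x)
    then show ?case
      by (simp add: chain_boundary_1_of[simplified] additive_map_diff[OF additive_map_eval0] eval0_point add.commute)
  next
    case (diff a b)
    then show ?case by (simp add: chain_boundary_diff additive_map_diff[OF F] additive_map_diff[OF additive_map_eval0])
  qed
qed

text \<open>Subdivision is the identity on 0-chains, so it keeps the boundary.\<close>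

lemma chain_boundary_iterated_subdivision:
  assumes "singular_chain 1 Y c"
  shows "singular_chain 1 Y ((singular_subdivision 1 ^^ n) c) \<and>
    chain_boundary 1 ((singular_subdivision 1 ^^ n) c) = chain_boundary 1 c"
proof (induction n)
  case 0
  then show ?case using assms by simp
next
  case (Suc n)
  let ?c = "(singular_subdivision 1 ^^ n) c"
  have "chain_boundary 1 (singular_subdivision 1 ?c) = singular_subdivision 0 (chain_boundary 1 ?c)"
    using chain_boundary_singular_subdivision[of 1 Y ?c] Suc by simp
  also have "\<dots> = chain_boundary 1 ?c"
    using singular_subdivision_zero[of Y "chain_boundary 1 ?c"] Suc singular_chain_boundary_alt[of 0 Y ?c] by simp
  finally show ?case using Suc singular_chain_singular_subdivision[of 1 Y ?c] by simp
qed

text \<open>Subdivide a cycle until every simplex lies in a member of the cover: its value is then the value of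
  the potential on its boundary, which vanishes mod 2.\<close>

lemma kills_cycles_if_local_potential:
  assumes F: "cocycle_on X T F"
    and loc: "\<And>y. y \<in> T \<Longrightarrow> y \<in> topspace X \<Longrightarrow> \<exists>W. openin X W \<and> y \<in> W \<and> potential_on X (T \<inter> W) F u"
  shows "kills_cycles X T F"
  unfolding kills_cycles_def
proof
  define Y where "Y = subtopology X T"
  fix z assume "z \<in> mod2_cycle_set 1 (subtopology X T)"
  then obtain d where z: "singular_chain 1 Y z" and d: "singular_chain 0 Y d" and zd: "chain_boundary 1 z = d + d"
    by (auto simp: mod2_cycle_set_def Y_def frag_cmul_2)
  have F_add: "additive_map F" using F by (simp add: cocycle_on_def)
  define \<C> where "\<C> = {T \<inter> W | W. openin X W \<and> potential_on X (T \<inter> W) F u}"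
  have o: "openin Y V" if "V \<in> \<C>" for V
    using that by (auto simp: \<C>_def Y_def openin_subtopology Int_commute)
  have cov: "topspace Y \<subseteq> \<Union>\<C>"
  proof
    fix y assume "y \<in> topspace Y"
    then have y: "y \<in> T" "y \<in> topspace X" by (auto simp: Y_def)
    then obtain W where "openin X W" "y \<in> W" "potential_on X (T \<inter> W) F u" using loc by blast
    then show "y \<in> \<Union>\<C>" using y unfolding \<C>_def by blast
  qed
  obtain n where n: "\<And>m f. \<lbrakk>n \<le> m; f \<in> Poly_Mapping.keys ((singular_subdivision 1 ^^ m) z)\<rbrakk>
      \<Longrightarrow> \<exists>V \<in> \<C>. f \<in> (standard_simplex 1) \<rightarrow> V"
    using sufficient_iterated_singular_subdivision_exists[OF o cov z] by metis
  obtain h where h: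
     "\<And>p c1 c2. h p (c1 - c2) = h p c1 - (h p c2 :: 'a chain)"
     "\<And>p X c. singular_chain p X c \<Longrightarrow> singular_chain (Suc p) X (h p c)"
     "\<And>p X c. singular_chain p X c \<Longrightarrow> chain_boundary (Suc p) (h p c) + h (p - Suc 0) (chain_boundary p c)
                   = (singular_subdivision p ^^ n) c - c"
    using chain_homotopic_iterated_singular_subdivision[of n] by metis
  define z' where "z' = (singular_subdivision 1 ^^ n) z"
  have z': "singular_chain 1 Y z'" "chain_boundary 1 z' = d + d"
    using chain_boundary_iterated_subdivision[OF z, of n] zd by (auto simp: z'_def)
  have h0: "h 0 0 = 0" using h(1)[of 0 0 0] by simp
  have "h 0 (d + d) = h 0 d + h 0 d"
    using h(1)[of 0 d "- d"] h(1)[of 0 0 d] h0 by simp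
  \<comment> \<open>The boundary of \<open>z\<close> is a double, so the homotopy maps it to a
    double; \<open>F\<close> vanishes on it as on the boundary term.\<close>
  then have "z' - z = chain_boundary 2 (h 1 z) + (h 0 d + h 0 d)"
    using h(3)[OF z] zd by (simp add: z'_def numeral_2_eq_2)
  moreover have "F (chain_boundary 2 (h 1 z)) = 0"
    using F h(2)[OF z] by (simp add: cocycle_on_def Y_def numeral_2_eq_2)
  ultimately have "F (z' - z) = 0" by (simp add: additive_map_add[OF F_add])
  then have "F z = F z'" using additive_map_diff[OF F_add, of z' z] by (simp add: bit_add_eq_0_iff)
  also have "F z' = eval0 u (chain_boundary 1 z')"
  proof (rule eval_via_potential[OF F_add])
    fix f assume f: "f \<in> Poly_Mapping.keys z'"
    then obtain W where W: "f \<in> standard_simplex 1 \<rightarrow> T \<inter> W" "potential_on X (T \<inter> W) F u"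
      using n[of n f] by (auto simp: z'_def \<C>_def)
    have "singular_simplex 1 X f" using f z'(1) by (auto simp: singular_chain_def Y_def singular_simplex_subtopology)
    then have "singular_simplex 1 (subtopology X (T \<inter> W)) f"
      using W(1) by (auto simp: singular_simplex_subtopology)
    then show "F (frag_of f) = u (f vert0) + u (f vert1)" using W(2) by (simp add: potential_on_def)
  qed
  also have "\<dots> = 0" unfolding z'(2) additive_map_add[OF additive_map_eval0] by (rule bit_add_self)
  finally show "F z = 0" .
qed

section \<open>Existence and uniqueness of potentials\<close>

lemma path_component_of_iff_simplex:
  "path_component_of Y a b \<longleftrightarrow> (\<exists>f. singular_simplex 1 Y f \<and> f vert0 = a \<and> f vert1 = b)"
proof
  assume "path_component_of Y a b"
  then obtain g where g: "continuous_map (top_of_set {0..1::real}) Y g" "g 0 = a" "g 1 = b"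
    by (auto simp: path_component_of_def pathin_def)
  define f where "f = restrict (\<lambda>x. g (x 1)) (standard_simplex 1)"
  have "continuous_map (subtopology (powertop_real UNIV) (standard_simplex 1)) (top_of_set {0..1}) (\<lambda>x. x 1)"
    unfolding continuous_map_in_subtopology
    by (auto intro: continuous_map_from_subtopology continuous_map_product_projection simp: standard_simplex_def)
  then have "continuous_map (subtopology (powertop_real UNIV) (standard_simplex 1)) Y (g \<circ> (\<lambda>x. x 1))"
    using g(1) by (rule continuous_map_compose)
  then have "singular_simplex 1 Y f"
    unfolding singular_simplex_def f_def
    by (auto intro: continuous_map_eq simp: topspace_standard_simplex)
  moreover have "f vert0 = a" "f vert1 = b"
    using g verts_in_standard_simplex by (auto simp: f_def vert0_def vert1_def)
  ultimately show "\<exists>f. singular_simplex 1 Y f \<and> f vert0 = a \<and> f vert1 = b" by blast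
next
  assume "\<exists>f. singular_simplex 1 Y f \<and> f vert0 = a \<and> f vert1 = b"
  then obtain f where f: "singular_simplex 1 Y f" "f vert0 = a" "f vert1 = b" by blast
  have "path_connectedin (subtopology (powertop_real UNIV) (standard_simplex 1)) (standard_simplex 1)"
    using path_connectedin_standard_simplex[of 1] by (simp add: path_connectedin_subtopology)
  then have "path_connectedin Y (f ` standard_simplex 1)"
    by (rule path_connectedin_continuous_map_image[rotated]) (use f(1) in \<open>simp add: singular_simplex_def\<close>)
  moreover have "a \<in> f ` standard_simplex 1" "b \<in> f ` standard_simplex 1"
    using f verts_in_standard_simplex by auto
  ultimately show "path_component_of Y a b"
    by (meson path_component_of_maximal path_component_of path_connectedin in_mono mem_Collect_eq)
qed

text \<open>Integrate \<open>F\<close> along a chosen simplex from a base point of each path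
  component. The required identity holds since \<open>F\<close> vanishes on the triangle formed by
  two chosen simplices and the given one.\<close>

lemma potential_exists:
  assumes F: "additive_map F"
    and kill: "\<And>z. singular_relcycle 1 (subtopology X T) {} z \<Longrightarrow> F z = 0"
  shows "\<exists>u. potential_on X T F u"
proof -
  define Y where "Y = subtopology X T"
  \<comment> \<open>The predicate from which \<open>r y\<close> is chosen is the same for all
    \<open>y\<close> of one path component, which makes \<open>r\<close> constant on path
    components.\<close>
  define r where "r y = (SOME x. path_component_of Y x y)" for y
  have r: "path_component_of Y (r y) y" if "y \<in> topspace Y" for y
    unfolding r_def by (rule someI[of _ y]) (use that in \<open>simp add: path_component_of_refl\<close>)
  have r_eq: "r y = r y'" if "path_component_of Y y y'" for y y'
  proof -
    have "path_component_of Y x y \<longleftrightarrow> path_component_of Y x y'" for x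
      using that path_component_of_trans path_component_of_sym by metis
    then show ?thesis by (simp add: r_def)
  qed
  define p where "p y = (SOME f. singular_simplex 1 Y f \<and> f vert0 = r y \<and> f vert1 = y)" for y
  have p: "singular_simplex 1 Y (p y)" "p y vert0 = r y" "p y vert1 = y" if "y \<in> topspace Y" for y
    using someI_ex[OF r[OF that, unfolded path_component_of_iff_simplex]] by (auto simp: p_def)
  define u where "u y = F (frag_of (p y))" for y
  have "F (frag_of f) = u (f vert0) + u (f vert1)" if f: "singular_simplex 1 Y f" for f
  proof -
    have pc: "path_component_of Y (f vert0) (f vert1)" unfolding path_component_of_iff_simplex using f by auto
    then have in_Y: "f vert0 \<in> topspace Y" "f vert1 \<in> topspace Y"
      by (simp_all add: path_component_of_equiv)
    define z where "z = frag_of (p (f vert0)) + frag_of f - frag_of (p (f vert1))"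
    have "chain_boundary 1 z = 0"
      using p[OF in_Y(1)] p[OF in_Y(2)] r_eq[OF pc]
      unfolding z_def chain_boundary_diff chain_boundary_add chain_boundary_1_of by simp
    moreover have "singular_chain 1 Y z"
      using p[OF in_Y(1)] p[OF in_Y(2)] f
      by (auto simp: z_def singular_chain_of intro!: singular_chain_diff singular_chain_add)
    ultimately have "F z = 0" using kill by (simp add: singular_cycle Y_def)
    then show ?thesis
      by (simp add: z_def u_def additive_map_add[OF F] additive_map_diff[OF F])
        (metis add.commute add.left_commute bit_add_eq_0_iff)
  qed
  then show ?thesis by (auto simp: potential_on_def Y_def)
qed

lemma potential_exists_kills_cycles:
  assumes "additive_map F" "kills_cycles X T F"
  shows "\<exists>u. potential_on X T F u"
proof (rule potential_exists[OF assms(1)])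
  fix z assume "singular_relcycle 1 (subtopology X T) {} z"
  then have "z \<in> mod2_cycle_set 1 (subtopology X T)"
    by (auto simp: mod2_cycle_set_def singular_cycle intro!: exI[of _ 0])
  then show "F z = 0" using assms(2) by (simp add: kills_cycles_def)
qed

text \<open>Vanishing on integral cycles suffices for a potential, and in a contractible space these
  are boundaries. Hence integral homology is enough here although \<open>F\<close> has values mod
  2.\<close>

lemma potential_exists_contractible:
  assumes F: "cocycle_on X T F" and c: "contractible_space (subtopology X T)"
  shows "\<exists>u. potential_on X T F u"
proof (rule potential_exists)
  define Y where "Y = subtopology X T"
  show "additive_map F" using F by (simp add: cocycle_on_def)
  fix z assume z: "singular_relcycle 1 (subtopology X T) {} z"
  then have z: "singular_relcycle 1 Y {} z" by (simp add: Y_def)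
  have "trivial_group (homology_group 1 Y)"
  proof (cases "topspace Y = {}")
    case True
    then show ?thesis by (simp add: trivial_homology_group_empty)
  next
    case False
    then obtain a where a: "a \<in> topspace Y" "Y homotopy_equivalent_space (subtopology Y {a})"
      using c[folded Y_def] contractible_eq_homotopy_equivalent_singleton_subtopology[of Y] by auto
    have "trivial_group (homology_group 1 (subtopology Y {a}))"
      by (rule homology_dimension_axiom[of _ a]) (use a in auto)
    then show ?thesis
      using homotopy_equivalent_space_imp_isomorphic_homology_groups[OF a(2), of 1]
        isomorphic_group_triviality by (metis group_relative_homology_group)
  qed
  then have "carrier (relative_homology_group (int 1) Y {}) = {singular_relboundary_set 1 Y {}}"
    using one_relative_homology_group[of 1 Y "{}"] by (simp add: trivial_group_def)
  moreover have "homologous_rel_set 1 Y {} z \<in> carrier (relative_homology_group (int 1) Y {})"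
    unfolding carrier_relative_homology_group using z by (intro imageI) simp
  ultimately have "homologous_rel_set 1 Y {} z = singular_relboundary_set 1 Y {}" by (simp only: singleton_iff)
  then have "singular_relboundary 1 Y {} z" by (simp add: homologous_rel_set_eq_relboundary)
  then obtain e where "singular_chain 2 Y e" "chain_boundary 2 e = z"
    by (auto simp: singular_boundary numeral_2_eq_2)
  then show "F z = 0" using F by (auto simp: cocycle_on_def Y_def)
qed

lemma potentials_differ_by_const:
  assumes "potential_on X N F u" "potential_on X N F v" "path_connectedin X N" "a \<in> N" "b \<in> N"
  shows "u a + v a = u b + v b"
proof -
  have "path_component_of (subtopology X N) a b"
    using assms(3-5) by (metis path_connectedin_def path_connected_space_iff_path_component topspace_subtopology_subset)
  then obtain f where f: "singular_simplex 1 (subtopology X N) f" "f vert0 = a" "f vert1 = b"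
    using path_component_of_iff_simplex[of "subtopology X N" a b] by auto
  then have "u a + u b = v a + v b" using assms(1,2) by (auto simp: potential_on_def)
  then show ?thesis by (cases "u a"; cases "u b"; cases "v a"; cases "v b") auto
qed

lemma locally_constant_on_connected:
  assumes A: "connectedin X A" and loc: "\<And>y. y \<in> A \<Longrightarrow> \<exists>W. openin X W \<and> y \<in> W \<and> (\<forall>z\<in>A \<inter> W. d z = (d y :: bit))"
    and ab: "a \<in> A" "b \<in> A"
  shows "d a = d b"
proof (rule ccontr)
  assume ne: "d a \<noteq> d b"
  define U where "U t = \<Union>{W. openin X W \<and> (\<forall>z\<in>A \<inter> W. d z = t)}" for t
  have "openin X (U t)" for t by (auto simp: U_def)
  moreover have "A \<subseteq> U (d a) \<union> U (d b)"
  proof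
    fix y assume y: "y \<in> A"
    then obtain W where "openin X W" "y \<in> W" "\<forall>z\<in>A \<inter> W. d z = d y" using loc by blast
    then have "y \<in> U (d y)" by (auto simp: U_def)
    moreover have "d y = d a \<or> d y = d b" using ne by (cases "d y"; cases "d a"; cases "d b") auto
    ultimately show "y \<in> U (d a) \<union> U (d b)" by auto
  qed
  moreover have dU: "d y = t" if "y \<in> U t" "y \<in> A" for y t using that by (auto simp: U_def)
  have "y \<notin> U (d b)" if "y \<in> U (d a)" "y \<in> A" for y using dU[OF that] dU[of y "d b"] that ne by auto
  then have "U (d a) \<inter> U (d b) \<inter> A = {}" by blast
  moreover have "U (d y) \<inter> A \<noteq> {}" if "y \<in> A" for y
    using loc[OF that] that unfolding U_def by blast
  then have "U (d a) \<inter> A \<noteq> {}" "U (d b) \<inter> A \<noteq> {}" using ab by blast+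
  ultimately show False using A unfolding connectedin by blast
qed


section \<open>Nullity and genus\<close>

text \<open>In contrast to the boundaries mod 2 of a space, the element \<open>d\<close> here is an arbitrary chain, so
  that the sum of any chain with itself belongs to the set.\<close>

definition boundaries2 :: "'a topology \<Rightarrow> 'a chain set" where
  "boundaries2 Y = {chain_boundary 2 e + (d + d) | e d. singular_chain 2 Y e}"

lemma add_subgroup_boundaries2: "add_subgroup (boundaries2 Y)"
  unfolding add_subgroup_def
proof (intro conjI ballI)
  show "0 \<in> boundaries2 Y" unfolding boundaries2_def by (intro CollectI exI[of _ 0]) simp
  fix x y assume "x \<in> boundaries2 Y" "y \<in> boundaries2 Y"
  then obtain e d e' d' where *: "x = chain_boundary 2 e + (d + d)" "y = chain_boundary 2 e' + (d' + d')"
    "singular_chain 2 Y e" "singular_chain 2 Y e'" by (auto simp: boundaries2_def)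
  then show "x - y \<in> boundaries2 Y"
    unfolding boundaries2_def
    by (intro CollectI exI[of _ "e - e'"] exI[of _ "d - d'"])
      (auto simp: chain_boundary_diff algebra_simps intro: singular_chain_diff)
qed

lemma double_in_boundaries2: "x + x \<in> boundaries2 Y"
  unfolding boundaries2_def by (intro CollectI exI[of _ 0] exI[of _ x]) simp

text \<open>If \<open>z\<close> and the boundary of \<open>e\<close> lie in \<open>Y\<close>, then
  so does \<open>d + d\<close>, and by \<open>singular_chain_double\<close> so does
  \<open>d\<close>. Thus the larger group \<open>boundaries2\<close>, modulo which functionals on
  all chains can be constructed, gives the same relation on chains of \<open>Y\<close>.\<close>

lemma mod2_boundary_set_eq: "mod2_boundary_set 1 Y = {z \<in> boundaries2 Y. singular_chain 1 Y z}"
proof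
  show "mod2_boundary_set 1 Y \<subseteq> {z \<in> boundaries2 Y. singular_chain 1 Y z}"
    using singular_chain_boundary_alt[of 1 Y]
    by (auto simp: mod2_boundary_set_def boundaries2_def frag_cmul_2 numeral_2_eq_2 intro!: singular_chain_add)
  show "{z \<in> boundaries2 Y. singular_chain 1 Y z} \<subseteq> mod2_boundary_set 1 Y"
  proof clarify
    fix z assume "z \<in> boundaries2 Y" and z: "singular_chain 1 Y z"
    then obtain e d where *: "z = chain_boundary 2 e + (d + d)" "singular_chain 2 Y e" by (auto simp: boundaries2_def)
    have "singular_chain 1 Y (z - chain_boundary 2 e)"
      by (rule singular_chain_diff[OF z]) (use *(2) singular_chain_boundary_alt[of 1 Y e] in \<open>simp add: numeral_2_eq_2\<close>)
    then have "singular_chain 1 Y d" using * by (simp add: singular_chain_double)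
    then show "z \<in> mod2_boundary_set 1 Y"
      using * by (auto simp: mod2_boundary_set_def frag_cmul_2 numeral_2_eq_2)
  qed
qed

lemma mod2_cycle_set_subgroup:
  assumes "x \<in> mod2_cycle_set 1 Y" "y \<in> mod2_cycle_set 1 Y"
  shows "x - y \<in> mod2_cycle_set 1 Y"
proof -
  obtain d d' where *: "singular_chain 1 Y x" "singular_chain 1 Y y" "singular_chain 0 Y d" "singular_chain 0 Y d'"
    "chain_boundary 1 x = d + d" "chain_boundary 1 y = d' + d'"
    using assms by (auto simp: mod2_cycle_set_def frag_cmul_2)
  then have "chain_boundary 1 (x - y) = (d - d') + (d - d')" by (simp add: chain_boundary_diff)
  moreover have "singular_chain 0 Y (d - d')" "singular_chain 1 Y (x - y)"
    using * by (auto intro: singular_chain_diff)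
  ultimately show ?thesis unfolding mod2_cycle_set_def frag_cmul_2 by auto
qed

lemma add_subgroup_mod2_cycle_set: "add_subgroup (mod2_cycle_set 1 Y)"
proof -
  have "0 \<in> mod2_cycle_set 1 Y" by (auto simp: mod2_cycle_set_def intro!: exI[of _ 0])
  then show ?thesis unfolding add_subgroup_def using mod2_cycle_set_subgroup by blast
qed

lemma add_subgroup_mod2_boundary_set: "add_subgroup (mod2_boundary_set 1 Y)"
  unfolding mod2_boundary_set_eq using add_subgroup_boundaries2[of Y]
  by (auto simp: add_subgroup_def intro: singular_chain_diff)

lemma mod2_boundary_subset_cycle: "mod2_boundary_set 1 Y \<subseteq> mod2_cycle_set 1 Y"
proof
  fix z assume "z \<in> mod2_boundary_set 1 Y"
  then obtain e d where *: "z = chain_boundary 2 e + (d + d)" "singular_chain 2 Y e" "singular_chain 1 Y d"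
    by (auto simp: mod2_boundary_set_def frag_cmul_2 numeral_2_eq_2)
  have "chain_boundary 1 (chain_boundary 2 e) = 0"
    using chain_boundary_boundary[OF *(2)] by simp
  then have "chain_boundary 1 z = frag_cmul 2 (chain_boundary 1 d)"
    unfolding frag_cmul_2 by (simp add: * chain_boundary_add)
  moreover have "singular_chain 0 Y (chain_boundary 1 d)" "singular_chain 1 Y z"
    using * singular_chain_boundary_alt[of 0 Y d] singular_chain_boundary_alt[of 1 Y e]
    by (auto simp: numeral_2_eq_2 intro!: singular_chain_add)
  ultimately show "z \<in> mod2_cycle_set 1 Y" by (auto simp: mod2_cycle_set_def)
qed

lemma kills_boundaries2:
  assumes "additive_map F" "\<forall>x\<in>boundaries2 (subtopology X T). F x = 0"
  shows "cocycle_on X T F"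
  unfolding cocycle_on_def
proof (intro conjI allI impI assms(1))
  fix e assume "singular_chain 2 (subtopology X T) e"
  then have "chain_boundary 2 e + (0 + 0) \<in> boundaries2 (subtopology X T)" unfolding boundaries2_def by blast
  then show "F (chain_boundary 2 e) = 0" using assms by simp
qed

lemma cocycle_on_boundaries2: "cocycle_on X T F \<Longrightarrow> x \<in> boundaries2 (subtopology X T) \<Longrightarrow> F x = 0"
  by (auto simp: cocycle_on_def boundaries2_def additive_map_def)
text \<open>Passes from the quotient group in the definition of the nullity to independent families
  of chains. A maximal independent family of cycles of \<open>S\<close> that bound in
  \<open>X\<close> generates the kernel, and as \<open>mod2_dim\<close> is the least size of a
  generating set, an upper bound follows. The hypothesis itself keeps these families bounded in
  size, so a maximal one exists.\<close>

lemma nullity_bound: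
  fixes X :: "'a topology" and S :: "'a set" and N :: nat
  assumes bound: "\<And>V. finite V \<Longrightarrow> V \<subseteq> mod2_cycle_set 1 (subtopology X S) \<inter> mod2_boundary_set 1 X \<Longrightarrow>
      (\<And>J. J \<subseteq> V \<Longrightarrow> J \<noteq> {} \<Longrightarrow> \<Sum>J \<notin> mod2_boundary_set 1 (subtopology X S)) \<Longrightarrow> 2 ^ card V \<le> N"
  shows "2 ^ homological_nullity X S \<le> N"
proof -
  define Y where "Y = subtopology X S"
  define Z where "Z = mod2_cycle_set 1 Y"
  define B where "B = mod2_boundary_set 1 Y"
  define BX where "BX = mod2_boundary_set 1 X"
  define G0 where "G0 = subgroup_generated (chain_group 1 Y) Z"
  define H where "H = mod2_homology_group 1 Y"
  have Bg: "add_subgroup B" and Zg: "add_subgroup Z" and BXg: "add_subgroup BX"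
    unfolding B_def Z_def BX_def by (rule add_subgroup_mod2_boundary_set add_subgroup_mod2_cycle_set)+
  have BZ: "B \<subseteq> Z" unfolding B_def Z_def by (rule mod2_boundary_subset_cycle)
  have BBX: "B \<subseteq> BX"
  proof
    fix b assume "b \<in> B"
    then obtain e d where "b = chain_boundary (Suc 1) e + frag_cmul 2 d" "singular_chain (Suc 1) Y e" "singular_chain 1 Y d"
      unfolding B_def mod2_boundary_set_def by blast
    moreover from this have "singular_chain (Suc 1) X e" "singular_chain 1 X d"
      by (simp_all add: Y_def singular_chain_subtopology)
    ultimately show "b \<in> BX" unfolding BX_def mod2_boundary_set_def by blast
  qed
  have Zch: "singular_chain 1 Y z" if "z \<in> Z" for z using that by (simp add: Z_def mod2_cycle_set_def)
  have H_eq: "H = G0 Mod B" by (simp add: H_def mod2_homology_group_def G0_def Z_def B_def)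
  have subZ: "subgroup Z (chain_group 1 Y)"
  proof (rule group.subgroupI)
    show "Z \<subseteq> carrier (chain_group 1 Y)" using Zch by auto
    show "Z \<noteq> {}" using Zg add_subgroup_zero by blast
    show "inv\<^bsub>chain_group 1 Y\<^esub> a \<in> Z" if "a \<in> Z" for a
      using that Zch[OF that] add_subgroup_minus[OF Zg] by (simp add: singular_chain_def)
    show "a \<otimes>\<^bsub>chain_group 1 Y\<^esub> b \<in> Z" if "a \<in> Z" "b \<in> Z" for a b
      using that add_subgroup_add[OF Zg] by simp
  qed simp
  have cG0: "carrier G0 = Z"
    unfolding G0_def by (rule subgroup.carrier_subgroup_generated_subgroup[OF subZ])
  have mG0: "(\<otimes>\<^bsub>G0\<^esub>) = (+)" by (simp add: G0_def)
  have G0: "comm_group G0"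
    unfolding G0_def by (rule group.abelian_subgroup_generated[OF group_chain_group abelian_chain_group])
  have invG0: "inv\<^bsub>G0\<^esub> a = - a" if "a \<in> Z" for a
  proof -
    have "inv\<^bsub>G0\<^esub> a = inv\<^bsub>chain_group 1 Y\<^esub> a"
      unfolding G0_def
      by (rule group.inv_subgroup_generated[OF group_chain_group])
        (use that subgroup.carrier_subgroup_generated_subgroup[OF subZ] in simp)
    then show ?thesis using Zch[OF that] by (simp add: singular_chain_def)
  qed
  have "subgroup B G0"
  proof (rule group.subgroupI)
    show "Group.group G0" using G0 by (simp add: comm_group_def)
    show "B \<subseteq> carrier G0" using BZ by (simp add: cG0)
    show "B \<noteq> {}" using Bg add_subgroup_zero by blast
    show "inv\<^bsub>G0\<^esub> a \<in> B" if "a \<in> B" for a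
      using that BZ invG0[of a] add_subgroup_minus[OF Bg] by auto
    show "a \<otimes>\<^bsub>G0\<^esub> b \<in> B" if "a \<in> B" "b \<in> B" for a b
      using that add_subgroup_add[OF Bg] by (simp add: mG0)
  qed
  then have norm: "B \<lhd> G0" using G0 comm_group.normal_iff_subgroup by blast
  interpret H: group H unfolding H_eq by (rule normal.factorgroup_is_group[OF norm])
  define cl where "cl z = (\<lambda>b. b + z) ` B" for z
  have cl_coset: "B #>\<^bsub>G0\<^esub> z = cl z" for z by (auto simp: r_coset_def mG0 cl_def)
  have carrH: "carrier H = cl ` Z"
    unfolding H_eq by (auto simp: FactGroup_def RCOSETS_def cG0 cl_coset)
  have oneH: "\<one>\<^bsub>H\<^esub> = B" by (simp add: H_eq FactGroup_def)
  have cl_mult: "cl a \<otimes>\<^bsub>H\<^esub> cl b = cl (a + b)" for a b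
  proof -
    have "cl a \<otimes>\<^bsub>H\<^esub> cl b = {x + y | x y. x \<in> cl a \<and> y \<in> cl b}"
      by (auto simp: H_eq FactGroup_def set_mult_def mG0)
    also have "\<dots> = cl (a + b)"
    proof (intro equalityI subsetI)
      fix t assume "t \<in> {x + y | x y. x \<in> cl a \<and> y \<in> cl b}"
      then obtain x y where "x \<in> B" "y \<in> B" "t = (x + a) + (y + b)" by (auto simp: cl_def)
      then have "t = (x + y) + (a + b)" "x + y \<in> B" using add_subgroup_add[OF Bg] by auto
      then show "t \<in> cl (a + b)" by (simp add: cl_def)
    next
      fix t assume "t \<in> cl (a + b)"
      then obtain x where "x \<in> B" "t = (x + a) + (0 + b)" by (auto simp: cl_def add.assoc)
      then show "t \<in> {x + y | x y. x \<in> cl a \<and> y \<in> cl b}"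
        using add_subgroup_zero[OF Bg] unfolding cl_def by blast
    qed
    finally show ?thesis .
  qed
  have cl_B: "cl z = B" if "z \<in> B" for z
  proof (intro equalityI subsetI)
    fix t assume "t \<in> B"
    then have "t - z \<in> B" "t = (t - z) + z" using that add_subgroup_diff[OF Bg] by auto
    then show "t \<in> cl z" unfolding cl_def by blast
  qed (use that add_subgroup_add[OF Bg] in \<open>auto simp: cl_def\<close>)
  define K where "K = kernel H (mod2_homology_group 1 X) (mod2_hom_induced 1 id X)"
  have hom_cl: "mod2_hom_induced 1 id X (cl z) = {b + x | b x. b \<in> BX \<and> x \<in> cl z}" if z: "z \<in> Z" for z
  proof -
    have "chain_map 1 id x = x" if "x \<in> cl z" for x
    proof -
      obtain b where b: "b \<in> B" "x = b + z" using \<open>x \<in> cl z\<close> by (auto simp: cl_def)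
      then have "x \<in> Z" using z BZ add_subgroup_add[OF Zg] by auto
      from chain_map_id_gen[OF Zch[OF this]] show ?thesis by simp
    qed
    then have "chain_map 1 id ` cl z = cl z" by force
    then show ?thesis by (auto simp: mod2_hom_induced_def set_mult_def BX_def)
  qed
  have K_eq: "K = cl ` (Z \<inter> BX)"
  proof -
    have "mod2_hom_induced 1 id X (cl z) = BX \<longleftrightarrow> z \<in> BX" if z: "z \<in> Z" for z
    proof
      assume *: "mod2_hom_induced 1 id X (cl z) = BX"
      have "0 + z \<in> cl z" "0 \<in> BX" using add_subgroup_zero Bg BXg unfolding cl_def by blast+
      then have "0 + (0 + z) \<in> BX" using * unfolding hom_cl[OF z] by blast
      then show "z \<in> BX" by simp
    next
      assume zB: "z \<in> BX"
      show "mod2_hom_induced 1 id X (cl z) = BX"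
        unfolding hom_cl[OF z]
      proof (intro equalityI subsetI)
        fix t assume "t \<in> {b + x | b x. b \<in> BX \<and> x \<in> cl z}"
        then show "t \<in> BX" using zB BBX add_subgroup_add[OF BXg] by (auto simp: cl_def)
      next
        fix t assume "t \<in> BX"
        then have "t - z \<in> BX" "0 + z \<in> cl z" "t = (t - z) + (0 + z)"
          using zB add_subgroup_diff[OF BXg] add_subgroup_zero[OF Bg] by (auto simp: cl_def)
        then show "t \<in> {b + x | b x. b \<in> BX \<and> x \<in> cl z}" by blast
      qed
    qed
    moreover have "\<one>\<^bsub>mod2_homology_group 1 X\<^esub> = BX"
      by (simp add: mod2_homology_group_def FactGroup_def BX_def)
    ultimately show ?thesis by (auto simp: K_def kernel_def carrH)
  qed
  define indep where "indep V \<longleftrightarrow> finite V \<and> V \<subseteq> Z \<inter> BX \<and> (\<forall>J. J \<subseteq> V \<longrightarrow> J \<noteq> {} \<longrightarrow> \<Sum>J \<notin> B)" for V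
  have le: "2 ^ card V \<le> N" if "indep V" for V
    using bound[of V] that by (simp add: indep_def Z_def BX_def B_def Y_def)
  have leN: "card V \<le> N" if "indep V" for V
    using le[OF that] less_exp[of "card V"] by linarith
  have indep0: "indep {}" by (simp add: indep_def)
  have "\<exists>V. indep V \<and> (\<forall>W. indep W \<longrightarrow> card W \<le> card V)"
    by (rule ex_has_greatest_nat[of indep "{}" card "Suc N"]) (simp_all add: indep0 leN less_Suc_eq_le)
  then obtain V where V: "indep V" and max: "\<And>W. indep W \<Longrightarrow> card W \<le> card V"
    by (elim exE conjE) simp
  have finV: "finite V" and VZ: "V \<subseteq> Z \<inter> BX" using V by (auto simp: indep_def)
  \<comment> \<open>By maximality some subset sum that uses \<open>z\<close> is a boundary mod 2;
    solving for \<open>z\<close> changes the sum of the other elements by a double, which is a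
    boundary mod 2 as well.\<close>
  have span: "\<exists>J\<subseteq>V. \<exists>b\<in>B. z = b + \<Sum>J" if z: "z \<in> Z" "z \<in> BX" for z
  proof (cases "z \<in> V")
    case True
    then show ?thesis using add_subgroup_zero[OF Bg] by (intro exI[of _ "{z}"]) auto
  next
    case False
    have "\<not> indep (insert z V)" using max[of "insert z V"] False finV by fastforce
    have "\<exists>J. J \<subseteq> insert z V \<and> J \<noteq> {} \<and> \<Sum>J \<in> B"
    proof (rule ccontr)
      assume none: "\<nexists>J. J \<subseteq> insert z V \<and> J \<noteq> {} \<and> \<Sum>J \<in> B"
      have "indep (insert z V)"
        unfolding indep_def
      proof (intro conjI allI impI notI)
        fix J assume "J \<subseteq> insert z V" "J \<noteq> {}" "\<Sum>J \<in> B"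
        then have "\<exists>J. J \<subseteq> insert z V \<and> J \<noteq> {} \<and> \<Sum>J \<in> B" by (intro exI[of _ J] conjI)
        with none show False by (rule notE)
      qed (use finV VZ z in auto)
      with \<open>\<not> indep (insert z V)\<close> show False by (rule notE)
    qed
    then obtain J where J: "J \<subseteq> insert z V" "J \<noteq> {}" "\<Sum>J \<in> B"
      by (elim exE conjE) (rule that)
    have zJ: "z \<in> J"
    proof (rule ccontr)
      assume "z \<notin> J"
      then have "J \<subseteq> V" using J(1) by blast
      moreover have "\<forall>J. J \<subseteq> V \<longrightarrow> J \<noteq> {} \<longrightarrow> \<Sum>J \<notin> B" using V unfolding indep_def by (elim conjE)
      ultimately show False using J(2,3) by simp
    qed
    define s where "s = \<Sum>(J - {z})"
    have finJ: "finite J" using J(1) finV finite_subset by blast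
    have sJ: "\<Sum>J = z + s" unfolding s_def by (rule sum.remove[OF finJ zJ])
    have "s + s \<in> B"
    proof -
      have "s \<in> Z" unfolding s_def using J(1) VZ by (intro add_subgroup_sum[OF Zg]) auto
      then have "singular_chain 1 Y (s + s)" using Zch by (simp add: singular_chain_double)
      then show ?thesis unfolding B_def mod2_boundary_set_eq using double_in_boundaries2 by blast
    qed
    then have "(z + s) - (s + s) \<in> B" by (rule add_subgroup_diff[OF Bg J(3)[unfolded sJ]])
    moreover have "z = ((z + s) - (s + s)) + s" by simp
    ultimately have "z = ((z + s) - (s + s)) + s" "(z + s) - (s + s) \<in> B" by blast+
    then show ?thesis unfolding s_def using J(1) by (intro exI[of _ "J - {z}"]) blast
  qed
  have gen_sum: "cl (\<Sum>J) \<in> generate H (cl ` V)" if "J \<subseteq> V" for J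
    using finite_subset[OF that finV] that
  proof (induction J)
    case empty
    have "cl 0 = B" by (rule cl_B[OF add_subgroup_zero[OF Bg]])
    then show ?case using generate.one[of H] oneH by simp
  next
    case (insert v J)
    then have "cl (v + \<Sum>J) = cl v \<otimes>\<^bsub>H\<^esub> cl (\<Sum>J)" by (simp add: cl_mult)
    moreover have "cl v \<in> generate H (cl ` V)" using insert by (intro generate.incl) auto
    ultimately show ?case using insert by (auto intro: generate.eng)
  qed
  have "generate H (cl ` V) = K"
  proof
    show "K \<subseteq> generate H (cl ` V)"
    proof
      fix \<alpha> assume "\<alpha> \<in> K"
      then obtain z where z: "z \<in> Z" "z \<in> BX" "\<alpha> = cl z" by (auto simp: K_eq)
      then obtain J b where Jb: "J \<subseteq> V" "b \<in> B" "z = b + \<Sum>J" using span by blast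
      have "cl z = \<one>\<^bsub>H\<^esub> \<otimes>\<^bsub>H\<^esub> cl (\<Sum>J)" using Jb cl_mult[of b "\<Sum>J"] cl_B[of b] by (simp add: oneH)
      then show "\<alpha> \<in> generate H (cl ` V)"
        using z gen_sum[OF Jb(1)] generate.one generate.eng by metis
    qed
    have ZBX: "add_subgroup (Z \<inter> BX)" using Zg BXg by (auto simp: add_subgroup_def)
    have inv_cl: "inv\<^bsub>H\<^esub> (cl v) = cl (- v)" if "v \<in> Z" for v
    proof (rule H.inv_equality)
      show "cl (- v) \<otimes>\<^bsub>H\<^esub> cl v = \<one>\<^bsub>H\<^esub>"
        using cl_B[OF add_subgroup_zero[OF Bg]] by (simp add: cl_mult oneH)
    qed (use that add_subgroup_minus[OF Zg] in \<open>auto simp: carrH\<close>)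
    show "generate H (cl ` V) \<subseteq> K"
    proof
      fix \<alpha> assume "\<alpha> \<in> generate H (cl ` V)"
      then show "\<alpha> \<in> K"
      proof induction
        case one
        then show ?case using cl_B[OF add_subgroup_zero[OF Bg]] add_subgroup_zero[OF ZBX] by (auto simp: oneH K_eq)
      next
        case (incl h)
        then show ?case using VZ by (auto simp: K_eq)
      next
        case (inv h)
        then obtain v where "v \<in> V" "h = cl v" by blast
        then show ?case using VZ inv_cl[of v] add_subgroup_minus[OF ZBX, of v] by (auto simp: K_eq)
      next
        case (eng h h')
        then obtain a b where "a \<in> Z \<inter> BX" "b \<in> Z \<inter> BX" "h = cl a" "h' = cl b" by (auto simp: K_eq)
        then show ?case using add_subgroup_add[OF ZBX] by (simp add: cl_mult K_eq)
      qed
    qed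
  qed
  moreover have "cl ` V \<subseteq> K" using VZ by (auto simp: K_eq)
  ultimately have "\<exists>A. finite A \<and> card A = card (cl ` V) \<and> A \<subseteq> K \<and> generate H A = K"
    using finV by blast
  then have "mod2_dim H K \<le> card (cl ` V)" unfolding mod2_dim_def by (rule Least_le)
  also have "\<dots> \<le> card V" using finV by (rule card_image_le)
  finally have "2 ^ mod2_dim H K \<le> (2::nat) ^ card V" by (rule power_increasing) simp
  then have "2 ^ mod2_dim H K \<le> N" using le[OF V] by (rule order_trans)
  then show ?thesis
    by (simp add: homological_nullity_def K_def H_def Y_def Let_def)
qed

text \<open>Lifts of a basis of the integral homology stay linearly independent mod 2, because an integral
  chain \<open>d\<close> for which \<open>2 d\<close> is a cycle is itself a cycle.\<close>

lemma genus_cycles: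
  assumes "has_genus X g"
  obtains z where "\<And>i. i < 2 * g \<Longrightarrow> singular_relcycle 1 X {} (z i)"
    "\<And>J. J \<subseteq> {..<2 * g} \<Longrightarrow> J \<noteq> {} \<Longrightarrow> sum z J \<notin> boundaries2 X"
proof -
  obtain h where h: "h \<in> iso (homology_group 1 X) (free_Abelian_group {..<2 * g})"
    using assms by (auto simp: has_genus_def is_iso_def)
  have carr: "carrier (homology_group 1 X) = homologous_rel_set 1 X {} ` singular_relcycle_set 1 X {}"
    using carrier_relative_homology_group[of 1 X "{}"] by simp
  define q where "q z = h (homologous_rel_set 1 X {} z)" for z
  have cls_add: "homologous_rel_set 1 X {} a \<otimes>\<^bsub>homology_group 1 X\<^esub> homologous_rel_set 1 X {} b
      = homologous_rel_set 1 X {} (a + b)" (is "?l = ?r") for a b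
  proof
    have m: "(\<otimes>\<^bsub>homology_group 1 X\<^esub>) = (\<lambda>R S. \<Union>r\<in>R. \<Union>s\<in>S. {r + s})"
      using mult_relative_homology_group[of 1 X "{}"] by simp
    show "?l \<subseteq> ?r" by (auto simp: m intro: homologous_rel_add)
    show "?r \<subseteq> ?l"
    proof
      fix t assume "t \<in> ?r"
      then have "homologous_rel 1 X {} (a + b) t" by simp
      then have "homologous_rel 1 X {} (a + b - b) (t - b)" by (rule homologous_rel_diff) simp
      then show "t \<in> ?l" unfolding m by (intro UN_I[of "t - b"] UN_I[of b]) auto
    qed
  qed
  have q_add: "q (a + b) = q a + q b"
    if "singular_relcycle 1 X {} a" "singular_relcycle 1 X {} b" for a b
  proof -
    have "h (homologous_rel_set 1 X {} a \<otimes>\<^bsub>homology_group 1 X\<^esub> homologous_rel_set 1 X {} b) = q a + q b"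
      using iso_imp_homomorphism[OF h] that by (simp add: hom_mult carr q_def)
    then show ?thesis unfolding cls_add q_def .
  qed
  have q0: "q 0 = 0" using q_add[of 0 0] by simp
  have qb: "q b = 0" if "singular_relboundary 1 X {} b" for b
  proof -
    have "homologous_rel_set 1 X {} b = homologous_rel_set 1 X {} 0"
      using that homologous_rel_set_eq_relboundary[of 1 X "{}"] singular_relboundary_0 by metis
    then show ?thesis using q0 by (simp add: q_def)
  qed
  have "\<exists>z. singular_relcycle 1 X {} z \<and> q z = frag_of i" if "i < 2 * g" for i
  proof -
    have "frag_of i \<in> h ` carrier (homology_group 1 X)"
      using h that by (simp add: iso_iff)
    then show ?thesis by (auto simp: carr q_def)
  qed
  then obtain z where z: "\<And>i. i < 2 * g \<Longrightarrow> singular_relcycle 1 X {} (z i)" "\<And>i. i < 2 * g \<Longrightarrow> q (z i) = frag_of i"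
    by metis
  have "sum z J \<notin> boundaries2 X" if J: "J \<subseteq> {..<2 * g}" "J \<noteq> {}" for J
  proof
    assume "sum z J \<in> boundaries2 X"
    then obtain e d where ed: "sum z J = chain_boundary 2 e + (d + d)" "singular_chain 2 X e"
      by (auto simp: boundaries2_def)
    have finJ: "finite J" using J finite_subset by blast
    have sumJ: "singular_relcycle 1 X {} (sum z J) \<and> q (sum z J) = (\<Sum>i\<in>J. frag_of i)"
      using finJ J(1)
    proof (induction J)
      case (insert i J)
      then show ?case using z[of i] q_add[of "z i" "sum z J"] by (auto intro: singular_relcycle_add)
    qed (simp add: q0)
    have e: "singular_relboundary 1 X {} (chain_boundary 2 e)"
      using ed(2) by (auto simp: singular_boundary numeral_2_eq_2)
    have ec: "singular_relcycle 1 X {} (chain_boundary 2 e)"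
      by (rule singular_relboundary_imp_relcycle[OF e])
    have dd: "singular_relcycle 1 X {} (d + d)"
      using singular_relcycle_diff[OF conjunct1[OF sumJ] ec] ed(1) by simp
    then have "chain_boundary 1 d + chain_boundary 1 d = 0" by (simp add: singular_cycle chain_boundary_add)
    then have "chain_boundary 1 d = 0"
      by (metis (no_types, lifting) frag_cmul_2 frag_cmul_eq_0_iff zero_neq_numeral)
    then have d: "singular_relcycle 1 X {} d" using dd by (simp add: singular_cycle singular_chain_double)
    have "q (sum z J) = q d + q d"
      using q_add[OF ec dd] q_add[OF d d] qb[OF e] ed(1) by simp
    moreover obtain j where j: "j \<in> J" using J by blast
    have "Poly_Mapping.lookup (\<Sum>i\<in>J. frag_of i) j = 1"
      using finJ j by (simp add: lookup_sum lookup_single when_def)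
    moreover have "Poly_Mapping.lookup (q d + q d) j = Poly_Mapping.lookup (q d) j + Poly_Mapping.lookup (q d) j"
      by (rule lookup_add)
    ultimately have "1 = 2 * Poly_Mapping.lookup (q d) j" using sumJ by (simp only: mult_2)
    then show False by presburger
  qed
  then show ?thesis using that z by blast
qed

text \<open>The half of universal coefficients that enters: functionals dual to the
  \<open>z j\<close> that vanish on boundaries and on doubles are cocycles mod 2, although the
  \<open>z j\<close> come from integral homology.\<close>

lemma genus_cocycles:
  fixes X :: "'a topology"
  assumes "has_genus X g"
  obtains c :: "nat \<Rightarrow> 'a chain \<Rightarrow> bit" and z where "\<And>i. i < 2 * g \<Longrightarrow> cocycle_on X UNIV (c i)" "\<And>j. j < 2 * g \<Longrightarrow> z j \<in> mod2_cycle_set 1 X"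
    "\<And>i j. i < 2 * g \<Longrightarrow> j < 2 * g \<Longrightarrow> c i (z j) = (if i = j then 1 else 0)"
proof -
  obtain z where z: "\<And>i. i < 2 * g \<Longrightarrow> singular_relcycle 1 X {} (z i)"
    "\<And>J. J \<subseteq> {..<2 * g} \<Longrightarrow> J \<noteq> {} \<Longrightarrow> sum z J \<notin> boundaries2 X"
    using genus_cycles[OF assms] by blast
  have ex: "\<exists>F. additive_map F \<and> (\<forall>x\<in>boundaries2 X. F x = 0) \<and> (\<forall>j\<in>{..<2 * g}. F (z j) = (if i = j then 1 else 0 :: bit))" for i
    by (rule dual_functionals[OF add_subgroup_boundaries2 double_in_boundaries2 finite_lessThan z(2)])
  obtain c :: "nat \<Rightarrow> 'a chain \<Rightarrow> bit" where c: "\<And>i. additive_map (c i)" "\<And>i. \<forall>x\<in>boundaries2 X. c i x = 0"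
    "\<And>i j. j < 2 * g \<Longrightarrow> c i (z j) = (if i = j then 1 else 0)"
  proof -
    from ex have "\<forall>i. \<exists>F. additive_map F \<and> (\<forall>x\<in>boundaries2 X. F x = 0) \<and>
        (\<forall>j\<in>{..<2 * g}. F (z j) = (if i = j then 1 else 0 :: bit))" by blast
    from choice[OF this] obtain c where "\<forall>i. additive_map (c i) \<and> (\<forall>x\<in>boundaries2 X. c i x = 0) \<and>
        (\<forall>j\<in>{..<2 * g}. c i (z j) = (if i = j then 1 else 0 :: bit))" ..
    then show ?thesis using that[of c] by simp
  qed
  have "cocycle_on X UNIV (c i)" for i
    by (rule kills_boundaries2) (use c in auto)
  moreover have "z j \<in> mod2_cycle_set 1 X" if "j < 2 * g" for j
    using z(1)[OF that] by (auto simp: mod2_cycle_set_def singular_cycle intro!: exI[of _ 0])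
  ultimately show ?thesis using that c by blast
qed


section \<open>Cocycles that vanish on a cellular subset\<close>

text \<open>The sum of two potentials is constant on a path-connected neighbourhood, so agreement is
  an open condition on the overlap.\<close>

lemma open_agreement_set:
  assumes lpc: "\<And>y W. openin X W \<Longrightarrow> y \<in> W \<Longrightarrow> \<exists>Q. openin X Q \<and> path_connectedin X Q \<and> y \<in> Q \<and> Q \<subseteq> W"
    and V: "openin X V" "openin X V'" and v: "potential_on X V F v" "potential_on X V' F v'"
    and y: "y \<in> V \<inter> V'"
  shows "\<exists>Q. openin X Q \<and> y \<in> Q \<and> Q \<subseteq> V \<inter> V' \<and> (\<forall>x\<in>Q. v x + v' x = v y + v' y)"
proof -
  obtain Q where Q: "openin X Q" "path_connectedin X Q" "y \<in> Q" "Q \<subseteq> V \<inter> V'"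
    using lpc[of "V \<inter> V'" y] V y by blast
  have "v x + v' x = v y + v' y" if "x \<in> Q" for x
    by (rule potentials_differ_by_const[of X Q F]) (use Q v that potential_on_mono in blast)+
  then show ?thesis using Q by blast
qed

text \<open>Near each point of \<open>D\<close> there is a local potential equal to \<open>u\<close>
  on \<open>D\<close>. Two of these may differ away from \<open>D\<close>, on a component of the
  overlap that misses \<open>D\<close>; so finitely many are kept on smaller closed sets, and the
  places of disagreement, a closed set disjoint from \<open>D\<close>, are removed.\<close>

lemma neighbourhood_potential:
  assumes X: "compact_space X" "Hausdorff_space X"
    and lpc: "\<And>y W. openin X W \<Longrightarrow> y \<in> W \<Longrightarrow> \<exists>Q. openin X Q \<and> path_connectedin X Q \<and> y \<in> Q \<and> Q \<subseteq> W"
    and D: "closedin X D"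
    and loc: "\<And>d. d \<in> D \<Longrightarrow> \<exists>V. openin X V \<and> d \<in> V \<and> contractible_space (subtopology X V) \<and> path_connectedin X (V \<inter> D)"
    and F: "cocycle_on X UNIV F" and u: "potential_on X D F u"
  obtains W w where "openin X W" "D \<subseteq> W" "\<And>y. y \<in> W \<Longrightarrow> \<exists>N. openin X N \<and> y \<in> N \<and> potential_on X N F w"
proof -
  \<comment> \<open>\<open>V \<inter> D\<close> is path-connected, so one constant makes the local
    potential agree with \<open>u\<close> on all of it.\<close>
  have "\<exists>V v. openin X V \<and> d \<in> V \<and> potential_on X V F v \<and> (\<forall>y\<in>V \<inter> D. v y = u y)" if d: "d \<in> D" for d
  proof -
    obtain V where V: "openin X V" "d \<in> V" "contractible_space (subtopology X V)" "path_connectedin X (V \<inter> D)"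
      using loc[OF d] by blast
    obtain v where v: "potential_on X V F v"
      using potential_exists_contractible[OF cocycle_on_mono[OF F] V(3)] by auto
    have "v y + u y = v d + u d" if "y \<in> V \<inter> D" for y
      by (rule potentials_differ_by_const[of X "V \<inter> D" F])
        (use V v u d that in \<open>auto intro: potential_on_mono[of X V] potential_on_mono[of X D]\<close>)
    then have "v y + (v d + u d) = u y" if "y \<in> V \<inter> D" for y
      using that by (metis add.left_commute add.commute bit_add_self add.right_neutral)
    then show ?thesis using V potential_on_add_const[OF v] by blast
  qed
  then obtain V v where V: "\<And>d. d \<in> D \<Longrightarrow> openin X (V d)" "\<And>d. d \<in> D \<Longrightarrow> d \<in> V d"
    and v: "\<And>d. d \<in> D \<Longrightarrow> potential_on X (V d) F (v d)" "\<And>d y. d \<in> D \<Longrightarrow> y \<in> V d \<inter> D \<Longrightarrow> v d y = u y"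
    by metis
  have "neighbourhood_base_of (closedin X) X"
    using compact_Hausdorff_imp_regular_space[OF X] by (simp add: neighbourhood_base_of_closedin)
  then have "\<exists>U K. openin X U \<and> closedin X K \<and> d \<in> U \<and> U \<subseteq> K \<and> K \<subseteq> V d" if "d \<in> D" for d
    using V[OF that] unfolding neighbourhood_base_of by blast
  then obtain U K where UK: "\<And>d. d \<in> D \<Longrightarrow> openin X (U d)" "\<And>d. d \<in> D \<Longrightarrow> closedin X (K d)" "\<And>d. d \<in> D \<Longrightarrow> d \<in> U d"
    "\<And>d. d \<in> D \<Longrightarrow> U d \<subseteq> K d" "\<And>d. d \<in> D \<Longrightarrow> K d \<subseteq> V d" by metis
  have "compactin X D" using X(1) D by (rule closedin_compact_space)
  moreover have "\<forall>B\<in>U ` D. openin X B" "D \<subseteq> \<Union>(U ` D)" using UK by auto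
  ultimately obtain \<F> where \<F>: "finite \<F>" "\<F> \<subseteq> U ` D" "D \<subseteq> \<Union>\<F>" by (metis compactin_def)
  then obtain I where I: "finite I" "I \<subseteq> D" "D \<subseteq> (\<Union>i\<in>I. U i)" by (metis finite_subset_image)
  define Eq where "Eq i j = {y \<in> V i \<inter> V j. v i y = v j y}" for i j
  \<comment> \<open>Taken inside the closed sets \<open>K i\<close>, where agreement is known to be
    open, disagreement is a closed condition.\<close>
  define Bad where "Bad = (\<Union>i\<in>I. \<Union>j\<in>I. K i \<inter> K j - Eq i j)"
  have oEq: "openin X (Eq i j)" if "i \<in> I" "j \<in> I" for i j
  proof (subst openin_subopen, rule ballI)
    fix y assume y: "y \<in> Eq i j"
    have ij: "i \<in> D" "j \<in> D" using I that by auto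
    obtain Q where Q: "openin X Q" "y \<in> Q" "Q \<subseteq> V i \<inter> V j" "\<forall>x\<in>Q. v i x + v j x = v i y + v j y"
      using open_agreement_set[OF lpc V(1)[OF ij(1)] V(1)[OF ij(2)] v(1)[OF ij(1)] v(1)[OF ij(2)]] y
      unfolding Eq_def by blast
    then have "Q \<subseteq> Eq i j" using y by (auto simp: Eq_def bit_add_eq_0_iff)
    then show "\<exists>T. openin X T \<and> y \<in> T \<and> T \<subseteq> Eq i j" using Q by blast
  qed
  have cK: "closedin X (K i \<inter> K j - Eq i j)" if "i \<in> I" "j \<in> I" for i j
    using I(2) UK(2) oEq[OF that] that by (intro closedin_diff closedin_Int) auto
  have "closedin X (\<Union>j\<in>I. K i \<inter> K j - Eq i j)" if "i \<in> I" for i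
    using I(1) cK[OF that] by (intro closedin_Union) auto
  then have "closedin X Bad" unfolding Bad_def
    using I(1) by (intro closedin_Union) auto
  define W where "W = (\<Union>i\<in>I. U i) - Bad"
  have oW: "openin X W" unfolding W_def
    using I UK(1) \<open>closedin X Bad\<close> by (intro openin_diff openin_Union) auto
  have DW: "D \<subseteq> W"
  proof
    fix y assume y: "y \<in> D"
    have "y \<in> Eq i j" if "i \<in> I" "j \<in> I" "y \<in> K i \<inter> K j" for i j
    proof -
      have ij: "i \<in> D" "j \<in> D" "y \<in> V i" "y \<in> V j" using I that UK(5) by blast+
      then show ?thesis using v(2)[of i y] v(2)[of j y] y by (simp add: Eq_def)
    qed
    then show "y \<in> W" using I(3) y unfolding W_def Bad_def by blast
  qed
  define w where "w y = v (SOME i. i \<in> I \<and> y \<in> U i) y" for y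
  have w: "w y = v i y" if "y \<in> W" "i \<in> I" "y \<in> U i" for y i
  proof -
    define j where "j = (SOME i. i \<in> I \<and> y \<in> U i)"
    have j: "j \<in> I \<and> y \<in> U j" unfolding j_def by (rule someI[of _ i]) (use that in simp)
    have "i \<in> D" "j \<in> D" using I that j by auto
    then have "y \<in> K i \<inter> K j" using UK(4) that j by blast
    then have "y \<in> Eq i j" using that j unfolding W_def Bad_def by blast
    then show ?thesis by (simp add: w_def Eq_def flip: j_def)
  qed
  have "\<exists>N. openin X N \<and> y \<in> N \<and> potential_on X N F w" if y: "y \<in> W" for y
  proof -
    obtain i where i: "i \<in> I" "y \<in> U i" using y by (auto simp: W_def)
    have iD: "i \<in> D" using i I by auto
    have "potential_on X (U i \<inter> W) F (v i)"
      by (rule potential_on_mono[OF v(1)[OF iD]]) (use UK(4,5)[OF iD] in blast)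
    then have "potential_on X (U i \<inter> W) F w"
      by (rule potential_on_cong) (use w i in auto)
    moreover have "openin X (U i \<inter> W)" using UK(1)[OF iD] oW by blast
    ultimately show ?thesis using i y by blast
  qed
  then show ?thesis using that oW DW by blast
qed

text \<open>In the disk model a compact set lies in a smaller closed disk, and what is left is an
  annulus, possibly with inner radius 0.\<close>

lemma disc_collar:
  assumes hom: "subtopology X C homeomorphic_space top_of_set (ball (0::complex) 1)"
    and C: "C \<subseteq> topspace X" and K: "compactin X K" "K \<subseteq> C"
  obtains Q where "compactin X Q" "Q \<subseteq> C" "K \<subseteq> Q" "path_connectedin X (C - Q)"
proof -
  obtain h k where hk: "homeomorphic_maps (subtopology X C) (top_of_set (ball (0::complex) 1)) h k"
    using hom by (auto simp: homeomorphic_space_def)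
  have top: "topspace (subtopology X C) = C" using C by auto
  have ch: "continuous_map (subtopology X C) (top_of_set (ball (0::complex) 1)) h"
    and ck: "continuous_map (top_of_set (ball (0::complex) 1)) (subtopology X C) k"
    and kh: "\<And>y. y \<in> C \<Longrightarrow> k (h y) = y" and hk': "\<And>z. z \<in> ball 0 1 \<Longrightarrow> h (k z) = z"
    using hk top by (auto simp: homeomorphic_maps_def)
  have hC: "h y \<in> ball 0 1" if "y \<in> C" for y
    using continuous_map_image_subset_topspace[OF ch] that top by auto
  have kC: "k z \<in> C" if "z \<in> ball 0 1" for z
    using continuous_map_image_subset_topspace[OF ck] that top by auto
  have "compactin (subtopology X C) K" using K by (simp add: compactin_subtopology)
  then have "compactin (top_of_set (ball (0::complex) 1)) (h ` K)" using ch by (rule image_compactin)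
  then have cK: "compact (h ` K)" "h ` K \<subseteq> ball 0 1" by (auto simp: compactin_subtopology)
  obtain r where r: "0 \<le> r" "r < 1" "h ` K \<subseteq> cball 0 r"
  proof (cases "K = {}")
    case False
    then obtain z where z: "z \<in> h ` K" "\<forall>y\<in>h ` K. norm y \<le> norm z"
      using continuous_attains_sup[OF cK(1), of norm] by (auto intro: continuous_intros)
    then show ?thesis using that[of "norm z"] cK(2) by (auto simp: subset_iff)
  qed (use that[of 0] in auto)
  define Q where "Q = k ` cball 0 r"
  have rb: "cball 0 r \<subseteq> ball (0::complex) 1" using r by auto
  have "compactin (top_of_set (ball (0::complex) 1)) (cball 0 r)" using rb by (simp add: compactin_subtopology)
  then have "compactin (subtopology X C) Q" unfolding Q_def using ck by (rule image_compactin)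
  then have cQ: "compactin X Q" by (simp add: compactin_subtopology)
  have QC: "Q \<subseteq> C" using rb kC by (auto simp: Q_def)
  have KQ: "K \<subseteq> Q"
  proof
    fix y assume "y \<in> K"
    then have "h y \<in> cball 0 r" "y = k (h y)" using r K kh by auto
    then show "y \<in> Q" unfolding Q_def by blast
  qed
  have CQ: "C - Q = k ` {z. r < norm z \<and> norm z < 1}"
  proof (intro equalityI subsetI)
    fix y assume y: "y \<in> C - Q"
    then have "h y \<notin> cball 0 r" using kh unfolding Q_def by force
    then show "y \<in> k ` {z. r < norm z \<and> norm z < 1}"
      using y kh hC by (intro image_eqI[of _ _ "h y"]) auto
  next
    fix y assume "y \<in> k ` {z. r < norm z \<and> norm z < 1}"
    then obtain z where z: "y = k z" "r < norm z" "norm z < 1" by auto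
    then have "h y = z" using hk' by auto
    moreover have "norm (h q) \<le> r" if "q \<in> Q" for q using that rb hk' by (auto simp: Q_def)
    ultimately show "y \<in> C - Q" using z kC by force
  qed
  have "path_connected {z::complex. r < norm z \<and> norm z < 1}"
    using path_connected_annulus(1)[of r "0::complex" 1] by (simp add: dist_norm)
  then have "path_connectedin (top_of_set (ball (0::complex) 1)) {z. r < norm z \<and> norm z < 1}"
    by (auto simp: path_connectedin_subtopology)
  then have "path_connectedin (subtopology X C) (C - Q)"
    unfolding CQ using ck by (intro path_connectedin_continuous_map_image)
  then have "path_connectedin X (C - Q)" by (simp add: path_connectedin_subtopology)
  then show ?thesis using that cQ QC KQ by blast
qed

text \<open>Extend a potential on \<open>D\<close> to a neighbourhood. On each face it is compared with a potential of the
  face along the collar of the boundary circle, which is connected.\<close>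

lemma kills_cycles_if_potential_on_cellular:
  assumes X: "compact_space X" "Hausdorff_space X"
    and lpc: "\<And>y W. openin X W \<Longrightarrow> y \<in> W \<Longrightarrow> \<exists>Q. openin X Q \<and> path_connectedin X Q \<and> y \<in> Q \<and> Q \<subseteq> W"
    and D: "closedin X D"
    and loc: "\<And>d. d \<in> D \<Longrightarrow> \<exists>V. openin X V \<and> d \<in> V \<and> contractible_space (subtopology X V) \<and> path_connectedin X (V \<inter> D)"
    and faces: "\<And>C. C \<in> connected_components_of (subtopology X (topspace X - D)) \<Longrightarrow>
        subtopology X C homeomorphic_space top_of_set (ball (0::complex) 1)"
    and F: "cocycle_on X UNIV F" and kD: "kills_cycles X D F"
  shows "kills_cycles X UNIV F"
proof -
  obtain u0 where u0: "potential_on X D F u0"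
    using potential_exists_kills_cycles[OF cocycle_on_additive[OF F] kD] by blast
  obtain W w where W: "openin X W" "D \<subseteq> W" and w: "\<And>y. y \<in> W \<Longrightarrow> \<exists>N. openin X N \<and> y \<in> N \<and> potential_on X N F w"
    using neighbourhood_potential[OF X lpc D loc F u0] by blast
  define \<F> where "\<F> = connected_components_of (subtopology X (topspace X - D))"
  have U\<F>: "\<Union>\<F> = topspace X - D"
    unfolding \<F>_def using Union_connected_components_of[of "subtopology X (topspace X - D)"] by auto
  have disj: "C \<inter> C' = {}" if "C \<in> \<F>" "C' \<in> \<F>" "C \<noteq> C'" for C C'
    using that connected_components_of_overlap[of C _ C'] unfolding \<F>_def by blast
  have CX: "C \<subseteq> topspace X" "C \<inter> D = {}" if "C \<in> \<F>" for C using U\<F> that by blast+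
  have oC: "openin X C" if C: "C \<in> \<F>" for C
  proof (subst openin_subopen, rule ballI)
    fix y assume y: "y \<in> C"
    have "openin X (topspace X - D)" using D by blast
    then obtain Q where Q: "openin X Q" "path_connectedin X Q" "y \<in> Q" "Q \<subseteq> topspace X - D"
      using lpc[of "topspace X - D" y] y CX[OF C] by blast
    then have "connectedin (subtopology X (topspace X - D)) Q"
      by (simp add: connectedin_subtopology path_connectedin_imp_connectedin)
    then have "Q \<subseteq> C"
      using connected_components_of_maximal[of C "subtopology X (topspace X - D)" Q] C y Q(3)
      unfolding \<F>_def disjnt_def by blast
    then show "\<exists>T. openin X T \<and> y \<in> T \<and> T \<subseteq> C" using Q by blast
  qed
  \<comment> \<open>The part of the surface that the extended potential does not reach. It is
    compact and covered by the disjoint open faces, so it meets only finitely many of them.\<close>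
  define K where "K = topspace X - W"
  have cK: "closedin X K" unfolding K_def using W by blast
  have KU: "K \<subseteq> \<Union>\<F>" using W(2) by (auto simp: K_def U\<F>)
  have "\<exists>\<G>. finite \<G> \<and> \<G> \<subseteq> \<F> \<and> K \<subseteq> \<Union>\<G>"
    by (rule compactinD[OF closedin_compact_space[OF X(1) cK] oC KU])
  then obtain \<F>0 where \<F>0: "finite \<F>0" "\<F>0 \<subseteq> \<F>" "K \<subseteq> \<Union>\<F>0"
    by (elim exE conjE) (rule that)
  have "closedin X (K \<inter> C)" if C: "C \<in> \<F>" for C
  proof -
    have "K \<inter> C = K - \<Union>(\<F> - {C})"
    proof (intro equalityI subsetI)
      fix y assume "y \<in> K \<inter> C"
      then have "y \<notin> C'" if "C' \<in> \<F> - {C}" for C' using disj[OF C, of C'] that by blast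
      then show "y \<in> K - \<Union>(\<F> - {C})" using \<open>y \<in> K \<inter> C\<close> by auto
    qed (use KU in auto)
    moreover have "openin X (\<Union>(\<F> - {C}))" using oC by (intro openin_Union) simp
    ultimately show ?thesis using cK by (simp add: closedin_diff)
  qed
  then have "\<exists>Q. compactin X Q \<and> Q \<subseteq> C \<and> K \<inter> C \<subseteq> Q \<and> path_connectedin X (C - Q)" if C: "C \<in> \<F>" for C
  proof -
    have "compactin X (K \<inter> C)" using \<open>\<And>C. C \<in> \<F> \<Longrightarrow> closedin X (K \<inter> C)\<close>[OF C] by (rule closedin_compact_space[OF X(1)])
    then obtain Q where "compactin X Q" "Q \<subseteq> C" "K \<inter> C \<subseteq> Q" "path_connectedin X (C - Q)"
      using disc_collar[OF faces[OF C[unfolded \<F>_def]] CX(1)[OF C] _ Int_lower2] by metis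
    then show ?thesis by blast
  qed
  then obtain Q0 where Q0: "\<And>C. C \<in> \<F> \<Longrightarrow> compactin X (Q0 C)" "\<And>C. C \<in> \<F> \<Longrightarrow> Q0 C \<subseteq> C"
    "\<And>C. C \<in> \<F> \<Longrightarrow> K \<inter> C \<subseteq> Q0 C" "\<And>C. C \<in> \<F> \<Longrightarrow> path_connectedin X (C - Q0 C)" by metis
  have ctr: "contractible_space (subtopology X C)" if "C \<in> \<F>" for C
    using homeomorphic_space_contractibility[OF faces[OF that[unfolded \<F>_def]]]
    by (simp add: convex_imp_contractible)
  \<comment> \<open>Faces outside \<open>\<F>0\<close> miss \<open>K\<close> and lie in
    \<open>W\<close> as a whole, so nothing is removed from them. Then \<open>W'\<close> arises from
    \<open>W\<close> by removing finitely many closed sets.\<close>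
  define Q where "Q C = (if C \<in> \<F>0 then Q0 C else {})" for C
  have QC: "Q C \<subseteq> C" if "C \<in> \<F>" for C using Q0(2)[OF that] by (simp add: Q_def)
  have pc: "path_connectedin X (C - Q C)" if C: "C \<in> \<F>" for C
  proof (cases "C \<in> \<F>0")
    case False
    have "path_connected_space (subtopology X C)" by (rule contractible_imp_path_connected_space[OF ctr[OF C]])
    then show ?thesis using CX[OF C] False by (simp add: Q_def path_connectedin_def)
  qed (use Q0(4)[OF C] in \<open>simp add: Q_def\<close>)
  have CQW: "C - Q C \<subseteq> W" if C: "C \<in> \<F>" for C
  proof
    fix y assume y: "y \<in> C - Q C"
    have "y \<notin> K"
    proof
      assume yK: "y \<in> K"
      then obtain C' where "C' \<in> \<F>0" "y \<in> C'" using \<F>0 by blast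
      then have "C \<in> \<F>0" using disj[of C C'] C \<F>0(2) y by blast
      then show False using y yK Q0(3)[OF C] by (auto simp: Q_def)
    qed
    then show "y \<in> W" using y CX[OF C] by (auto simp: K_def)
  qed
  have "\<exists>v. potential_on X C F v \<and> (\<forall>y\<in>C - Q C. v y = w y)" if C: "C \<in> \<F>" for C
  proof -
    obtain v where v: "potential_on X C F v"
      using potential_exists_contractible[OF cocycle_on_mono[OF F] ctr[OF C]] by auto
    \<comment> \<open>An arbitrary point of the collar; if the collar is empty there is nothing to
      compare.\<close>
    define a where "a = (SOME a. a \<in> C - Q C)"
    have "v y + w y = v a + w a" if y: "y \<in> C - Q C" for y
    proof (rule locally_constant_on_connected[of X "C - Q C" "\<lambda>y. v y + w y"])
      show "connectedin X (C - Q C)" by (rule path_connectedin_imp_connectedin[OF pc[OF C]])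
      show "a \<in> C - Q C" unfolding a_def by (rule someI[of _ y]) (rule y)
      fix x assume x: "x \<in> C - Q C"
      then obtain N where N: "openin X N" "x \<in> N" "potential_on X N F w" using w CQW[OF C] by blast
      obtain R where "openin X R" "x \<in> R" "R \<subseteq> C \<inter> N" "\<forall>z\<in>R. v z + w z = v x + w x"
        using open_agreement_set[OF lpc oC[OF C] N(1) v N(3), of x] x N(2) by blast
      then show "\<exists>W. openin X W \<and> x \<in> W \<and> (\<forall>z\<in>(C - Q C) \<inter> W. v z + w z = v x + w x)" by blast
    qed (rule y)
    then have "v y + (v a + w a) = w y" if "y \<in> C - Q C" for y
      using that by (metis add.left_commute add.commute bit_add_self add.right_neutral)
    then show ?thesis using potential_on_add_const[OF v] by blast
  qed
  then obtain v where v: "\<And>C. C \<in> \<F> \<Longrightarrow> potential_on X C F (v C)" "\<And>C y. C \<in> \<F> \<Longrightarrow> y \<in> C - Q C \<Longrightarrow> v C y = w y"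
    by metis
  define u where "u y = (if y \<in> \<Union>\<F> then v (THE C. C \<in> \<F> \<and> y \<in> C) y else w y)" for y
  have u_face: "u y = v C y" if "C \<in> \<F>" "y \<in> C" for C y
  proof -
    have "(THE C. C \<in> \<F> \<and> y \<in> C) = C" by (rule the_equality) (use that disj in auto)
    then show ?thesis using that unfolding u_def by auto
  qed
  define W' where "W' = W - \<Union>(Q ` \<F>0)"
  have cQ: "closedin X (Q C)" if "C \<in> \<F>0" for C
    using that \<F>0(2) compactin_imp_closedin[OF X(2) Q0(1)[of C]] by (auto simp: Q_def)
  have oW': "openin X W'" unfolding W'_def
    using W(1) \<F>0(1) cQ by (intro openin_diff closedin_Union) auto
  have u_W': "u y = w y" if y: "y \<in> W'" for y
  proof (cases "y \<in> \<Union>\<F>")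
    case True
    then obtain C where C: "C \<in> \<F>" "y \<in> C" by blast
    then have "y \<in> C - Q C" using y by (auto simp: W'_def Q_def)
    then show ?thesis using u_face[OF C] v(2)[OF C(1)] by simp
  qed (simp add: u_def)
  show ?thesis
  proof (rule kills_cycles_if_local_potential[OF F, of u])
    fix y assume y: "y \<in> topspace X"
    show "\<exists>N. openin X N \<and> y \<in> N \<and> potential_on X (UNIV \<inter> N) F u"
    proof (cases "y \<in> D")
      case True
      then have "y \<in> W'" using W(2) QC \<F>0(2) CX(2) unfolding W'_def by blast
      moreover obtain N where N: "openin X N" "y \<in> N" "potential_on X N F w" using w[of y] True W(2) by blast
      have "potential_on X (N \<inter> W') F u"
        by (rule potential_on_cong[OF potential_on_mono[OF N(3)]]) (use u_W' in auto)
      ultimately show ?thesis using N oW' by (intro exI[of _ "N \<inter> W'"]) auto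
    next
      case False
      then obtain C where C: "C \<in> \<F>" "y \<in> C" using y U\<F> by blast
      have "potential_on X C F u"
        by (rule potential_on_cong[OF v(1)[OF C(1)]]) (use u_face C in auto)
      then show ?thesis using oC C by (intro exI[of _ C]) auto
    qed
  qed
qed


section \<open>Charts and arcs\<close>

locale coordinates =
  fixes X :: "'a topology" and U :: "'a set" and B :: "complex set" and h :: "'a \<Rightarrow> complex" and k :: "complex \<Rightarrow> 'a"
  assumes maps: "homeomorphic_maps (subtopology X U) (top_of_set B) h k"
    and UX: "openin X U" and B: "open B"
begin

lemma top_U: "topspace (subtopology X U) = U"
  using openin_subset[OF UX] by auto

lemma h_cont: "continuous_map (subtopology X U) (top_of_set B) h"
  and k_cont: "continuous_map (top_of_set B) (subtopology X U) k"
  and k_h: "y \<in> U \<Longrightarrow> k (h y) = y" and h_k: "z \<in> B \<Longrightarrow> h (k z) = z"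
  using maps top_U by (auto simp: homeomorphic_maps_def)

lemma h_in: "y \<in> U \<Longrightarrow> h y \<in> B"
  using continuous_map_image_subset_topspace[OF h_cont] top_U by auto

lemma k_in: "z \<in> B \<Longrightarrow> k z \<in> U"
  using continuous_map_image_subset_topspace[OF k_cont] top_U by auto

lemma image_eq: "T \<subseteq> B \<Longrightarrow> k ` T = {y \<in> U. h y \<in> T}"
  using h_k k_h k_in by force

lemma image_homeomorphic:
  assumes T: "T \<subseteq> B"
  shows "subtopology X (k ` T) homeomorphic_space top_of_set T"
proof -
  have kTU: "k ` T \<subseteq> U" using T k_in by auto
  have "continuous_map (subtopology X U) euclidean h"
    using h_cont continuous_map_into_fulltopology by blast
  then have "continuous_map (subtopology X (k ` T)) euclidean h"
    using kTU by (rule continuous_map_from_subtopology_mono)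
  then have 1: "continuous_map (subtopology X (k ` T)) (top_of_set T) h"
    by (rule continuous_map_into_subtopology) (use h_k T in auto)
  have "continuous_map (top_of_set B) X k"
    using k_cont continuous_map_into_fulltopology by blast
  then have "continuous_map (top_of_set T) X k"
    using T by (rule continuous_map_from_subtopology_mono)
  then have 2: "continuous_map (top_of_set T) (subtopology X (k ` T)) k"
    by (rule continuous_map_into_subtopology) auto
  have "homeomorphic_maps (subtopology X (k ` T)) (top_of_set T) h k"
    unfolding homeomorphic_maps_def using 1 2 h_k T by auto
  then show ?thesis unfolding homeomorphic_space_def by blast
qed

lemma image_contractible:
  assumes "T \<subseteq> B" "contractible T"
  shows "contractible_space (subtopology X (k ` T))"
  using homeomorphic_space_contractibility[OF image_homeomorphic[OF assms(1)]] assms(2) by simp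

lemma image_path_connected:
  assumes "T \<subseteq> B" "path_connected T"
  shows "path_connectedin X (k ` T)"
proof -
  have "continuous_map (top_of_set B) X k"
    using k_cont continuous_map_into_fulltopology by blast
  moreover have "path_connectedin (top_of_set B) T" using assms by (simp add: path_connectedin_subtopology)
  ultimately show ?thesis by (rule path_connectedin_continuous_map_image)
qed

lemma image_compact:
  assumes "T \<subseteq> B" "compact T"
  shows "compactin X (k ` T)"
proof -
  have "compactin (top_of_set B) T" using assms by (simp add: compactin_subtopology)
  moreover have "continuous_map (top_of_set B) X k"
    using k_cont continuous_map_into_fulltopology by blast
  ultimately show ?thesis by (rule image_compactin)
qed

lemma image_open:
  assumes "T \<subseteq> B" "open T"
  shows "openin X (k ` T)"
proof -
  have "openin (top_of_set B) T" using assms B by (simp add: openin_open_eq)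
  then have "openin (subtopology X U) {y \<in> topspace (subtopology X U). h y \<in> T}"
    by (rule openin_continuous_map_preimage[OF h_cont])
  then show ?thesis using UX by (simp add: openin_open_subtopology image_eq[OF assms(1)] top_U del: topspace_subtopology)
qed

lemma inj_k: "inj_on k B"
  using h_k by (metis inj_onI)

end

lemma coordinates_of_chart:
  assumes "surface_chart X (U, \<phi>)"
  shows "coordinates X U (\<phi> ` U) \<phi> (inv_into U \<phi>)"
proof
  have o: "openin X U" "open (\<phi> ` U)" and hom: "homeomorphic_map (subtopology X U) (top_of_set (\<phi> ` U)) \<phi>"
    using assms by (auto simp: surface_chart_def)
  obtain g where g: "homeomorphic_maps (subtopology X U) (top_of_set (\<phi> ` U)) \<phi> g"
    using hom homeomorphic_map_maps by blast
  have U: "topspace (subtopology X U) = U" using openin_subset[OF o(1)] by auto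
  have gk: "g (\<phi> y) = y" if "y \<in> U" for y using g U that by (auto simp: homeomorphic_maps_def)
  then have "inj_on \<phi> U" by (metis inj_onI)
  then have eq: "inv_into U \<phi> z = g z" if "z \<in> \<phi> ` U" for z using that gk by force
  show "homeomorphic_maps (subtopology X U) (top_of_set (\<phi> ` U)) \<phi> (inv_into U \<phi>)"
    by (rule homeomorphic_maps_eq[OF g]) (use eq in auto)
  show "openin X U" "open (\<phi> ` U)" by (rule o)+
qed

text \<open>The components of a closed part \<open>Y\<close> of a path are subarcs. Their ends lie in \<open>P\<close> because
  \<open>Y - P\<close> is open along the path, and interior points do not because each point of \<open>P\<close> is the end of
  a ray that is open in \<open>Y\<close>.\<close>

lemma arc_component:
  fixes \<gamma> :: "real \<Rightarrow> 'a"
  assumes X: "Hausdorff_space X" and \<gamma>: "continuous_map (top_of_set {a..b}) X \<gamma>"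
    and Y: "closedin X Y" and e: "e \<in> connected_components_of (subtopology X Y)" and e\<gamma>: "e \<subseteq> \<gamma> ` {a..b}"
    and ends: "\<gamma> a \<notin> Y" "\<gamma> b \<notin> Y" and inj: "inj_on \<gamma> {t\<in>{a..b}. \<gamma> t \<in> Y}"
    and N: "openin X N" "\<gamma> ` {a..b} \<inter> N \<subseteq> Y" "Y - P \<subseteq> N"
    and rays: "\<And>p. p \<in> P \<Longrightarrow> \<exists>R N. openin X N \<and> R = Y \<inter> N \<and> p \<in> R \<and> connectedin X R \<and>
       connectedin X (R - {p}) \<and> R - {p} \<noteq> {}"
  shows "contractible_space (subtopology X e) \<and> card (e \<inter> P) = 2"
proof -
  have eY: "e \<subseteq> Y" and e_conn: "connectedin X e" and e_ne: "e \<noteq> {}"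
    using connectedin_connected_components_of[OF e] nonempty_connected_components_of[OF e]
    by (auto simp: connectedin_subtopology)
  have e_cl: "closedin X e"
    using closedin_connected_components_of[OF e] Y by (simp add: closedin_closed_subtopology)
  have e_max: "S \<subseteq> e" if "connectedin X S" "S \<subseteq> Y" "S \<inter> e \<noteq> {}" for S
    using connected_components_of_maximal[OF e, of S] that by (auto simp: connectedin_subtopology disjnt_def)
  \<comment> \<open>The parameters of \<open>e\<close>. Being compact and connected, they form an
    interval, and its ends and inner points are examined separately.\<close>
  define T where "T = {t\<in>{a..b}. \<gamma> t \<in> e}"
  have \<gamma>T: "\<gamma> ` T = e" using e\<gamma> by (auto simp: T_def)
  have "closedin (top_of_set {a..b}) {t \<in> topspace (top_of_set {a..b}). \<gamma> t \<in> e}"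
    by (rule closedin_continuous_map_preimage[OF \<gamma> e_cl])
  then have "closedin (top_of_set {a..b}) T" by (simp add: T_def)
  then have cT: "compact T" by (rule closedin_compact[OF compact_Icc])
  have eX: "e \<subseteq> topspace X" using e_cl closedin_subset by blast
  have "continuous_map (top_of_set T) X \<gamma>"
    by (rule continuous_map_from_subtopology_mono[OF \<gamma>]) (auto simp: T_def)
  then have \<gamma>c: "continuous_map (top_of_set T) (subtopology X e) \<gamma>"
    by (rule continuous_map_into_subtopology) (auto simp: T_def)
  have injT: "inj_on \<gamma> T" by (rule inj_on_subset[OF inj]) (use eY in \<open>auto simp: T_def\<close>)
  have hom: "homeomorphic_map (top_of_set T) (subtopology X e) \<gamma>"
  proof (rule continuous_imp_homeomorphic_map[OF \<gamma>c])
    show "compact_space (top_of_set T)" using cT by (simp add: compact_space_subtopology)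
    show "Hausdorff_space (subtopology X e)" using X by (rule Hausdorff_space_subtopology)
  qed (use \<gamma>T eX injT in auto)
  have conn: "connected J \<longleftrightarrow> connectedin X (\<gamma> ` J)" if "J \<subseteq> T" for J
    using homeomorphic_map_connectedness[OF hom, of J] that \<gamma>T
    by (auto simp: connectedin_subtopology)
  have "connected T" using conn[of T] \<gamma>T e_conn by simp
  then obtain c d where cd: "T = {c..d}" using cT connected_compact_interval_1[of T] by blast
  have "c \<le> d" using e_ne \<gamma>T cd by auto
  then have cT': "c \<in> T" and dT: "d \<in> T" using cd by auto
  have ctr: "contractible_space (subtopology X e)"
    using homeomorphic_space_contractibility[OF homeomorphic_map_imp_homeomorphic_space[OF hom]] cd
    by (simp add: convex_imp_contractible)
  have extend: "J \<subseteq> T" if "J \<subseteq> {a..b}" "connected J" "J \<inter> T \<noteq> {}" "\<gamma> ` J \<subseteq> N" for J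
  proof -
    have "connectedin (top_of_set {a..b}) J" using that by (simp add: connectedin_subtopology)
    then have "connectedin X (\<gamma> ` J)" by (rule connectedin_continuous_map_image[OF \<gamma>])
    moreover have "\<gamma> ` J \<subseteq> Y" using that N(2) by blast
    moreover have "\<gamma> ` J \<inter> e \<noteq> {}" using that by (auto simp: T_def)
    ultimately have "\<gamma> ` J \<subseteq> e" by (rule e_max)
    then show ?thesis using that by (auto simp: T_def)
  qed
  have nbhd: "\<exists>\<epsilon>>0. \<forall>s\<in>{a..b}. dist s t < \<epsilon> \<longrightarrow> \<gamma> s \<in> N'" if "openin X N'" "t \<in> {a..b}" "\<gamma> t \<in> N'" for N' t
  proof -
    have "openin (top_of_set {a..b}) {t \<in> topspace (top_of_set {a..b}). \<gamma> t \<in> N'}"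
      by (rule openin_continuous_map_preimage[OF \<gamma> that(1)])
    then show ?thesis using that(2,3) unfolding openin_euclidean_subtopology_iff by auto
  qed
  have cab: "c \<in> {a..b}" "d \<in> {a..b}" "\<gamma> c \<in> e" "\<gamma> d \<in> e" using cT' dT by (auto simp: T_def)
  have ca: "a < c" and db: "d < b"
    using cab eY ends by (auto simp: less_le)
  have cP: "\<gamma> c \<in> P"
  proof (rule ccontr)
    assume "\<gamma> c \<notin> P"
    then have "\<gamma> c \<in> N" using N(3) cab eY by blast
    then obtain \<epsilon> where \<epsilon>: "\<epsilon> > 0" "\<forall>s\<in>{a..b}. dist s c < \<epsilon> \<longrightarrow> \<gamma> s \<in> N" using nbhd[OF N(1) cab(1)] by blast
    define t where "t = max a (c - \<epsilon> / 2)"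
    have "t < c" using ca \<epsilon> by (simp add: t_def)
    then have "c \<in> {t..c} \<inter> T" using cT' by simp
    then have "{t..c} \<inter> T \<noteq> {}" by blast
    then have "{t..c} \<subseteq> T"
      by (intro extend) (use \<epsilon> ca cab in \<open>auto simp: t_def dist_real_def\<close>)
    moreover note \<open>t < c\<close>
    ultimately show False using cd by auto
  qed
  have dP: "\<gamma> d \<in> P"
  proof (rule ccontr)
    assume "\<gamma> d \<notin> P"
    then have "\<gamma> d \<in> N" using N(3) cab eY by blast
    then obtain \<epsilon> where \<epsilon>: "\<epsilon> > 0" "\<forall>s\<in>{a..b}. dist s d < \<epsilon> \<longrightarrow> \<gamma> s \<in> N" using nbhd[OF N(1) cab(2)] by blast
    define t where "t = min b (d + \<epsilon> / 2)"
    have "d < t" using db \<epsilon> by (simp add: t_def)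
    then have "d \<in> {d..t} \<inter> T" using dT by simp
    then have "{d..t} \<inter> T \<noteq> {}" by blast
    then have "{d..t} \<subseteq> T"
      by (intro extend) (use \<epsilon> db cab in \<open>auto simp: t_def dist_real_def\<close>)
    moreover note \<open>d < t\<close>
    ultimately show False using cd by auto
  qed
  \<comment> \<open>A component reduced to one point could not contain the ray at that
    point.\<close>
  have cd_ne: "c \<noteq> d"
  proof
    assume "c = d"
    then have "e = {\<gamma> c}" using \<gamma>T cd by auto
    obtain R N' where R: "R = Y \<inter> N'" "\<gamma> c \<in> R" "connectedin X R" "R - {\<gamma> c} \<noteq> {}"
      using rays[OF cP] by blast
    have "R \<subseteq> e" by (rule e_max) (use R cab in auto)
    then show False using R \<open>e = {\<gamma> c}\<close> by blast
  qed
  have interior: "\<gamma> s \<notin> P" if s: "c < s" "s < d" for s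
  proof
    assume sP: "\<gamma> s \<in> P"
    obtain R N' where R: "openin X N'" "R = Y \<inter> N'" "\<gamma> s \<in> R" "connectedin X R" "connectedin X (R - {\<gamma> s})"
      using rays[OF sP] by blast
    have sT: "s \<in> T" using s cd by auto
    have "\<gamma> s \<in> e" using sT by (simp add: T_def)
    then have Re: "R \<subseteq> e" using R by (intro e_max) auto
    \<comment> \<open>\<open>J\<close> parametrises the ray without its end
      \<open>\<gamma> s\<close>, so it is connected. But \<open>s\<close> is an inner parameter, and
      parameters close to it on both sides map into the ray.\<close>
    define J where "J = {t\<in>T. \<gamma> t \<in> R - {\<gamma> s}}"
    have "\<gamma> ` J = R - {\<gamma> s}"
    proof (intro equalityI subsetI)
      fix y assume y: "y \<in> R - {\<gamma> s}"
      then have "y \<in> \<gamma> ` T" using Re \<gamma>T by blast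
      then show "y \<in> \<gamma> ` J" using y by (auto simp: J_def)
    qed (auto simp: J_def)
    then have cJ: "connected J" using conn[of J] R(5) by (auto simp: J_def)
    have sab: "s \<in> {a..b}" using sT by (simp add: T_def)
    have "\<gamma> s \<in> N'" using R by blast
    then obtain \<epsilon> where \<epsilon>: "\<epsilon> > 0" "\<forall>t\<in>{a..b}. dist t s < \<epsilon> \<longrightarrow> \<gamma> t \<in> N'" using nbhd[OF R(1) sab] by blast
    have inJ: "t \<in> J" if "t \<in> T" "t \<noteq> s" "dist t s < \<epsilon>" for t
    proof -
      have "\<gamma> t \<noteq> \<gamma> s" using inj_onD[OF injT _ that(1) sT] that(2) by blast
      moreover have "\<gamma> t \<in> R" using that \<epsilon>(2) R(2) eY by (auto simp: T_def)
      ultimately show ?thesis using that by (simp add: J_def)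
    qed
    define l where "l = max c (s - \<epsilon> / 2)"
    define r where "r = min d (s + \<epsilon> / 2)"
    have "l < s" "s < r" "l \<in> J" "r \<in> J"
      using s \<epsilon>(1) cd by (auto simp: l_def r_def dist_real_def intro!: inJ)
    then have "s \<in> J" using connectedD_interval[OF cJ, of l r s] by auto
    then show False by (simp add: J_def)
  qed
  have "e \<inter> P = {\<gamma> c, \<gamma> d}"
  proof (intro equalityI subsetI)
    fix y assume y: "y \<in> e \<inter> P"
    then obtain t where t: "t \<in> T" "y = \<gamma> t" using \<gamma>T by blast
    then have "t = c \<or> t = d" using interior[of t] y cd by force
    then show "y \<in> {\<gamma> c, \<gamma> d}" using t by auto
  qed (use cP dP cab in auto)
  moreover have "\<gamma> c \<noteq> \<gamma> d" using inj_onD[OF injT _ cT' dT] cd_ne by blast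
  ultimately show ?thesis using ctr by simp
qed

text \<open>The circle is cut at \<open>z0\<close>, which will be a point outside \<open>Y\<close>.
  Injectivity between the two ends then covers all parameters of points of \<open>Y\<close>.\<close>

lemma circle_arc_param:
  fixes z0 :: complex
  assumes "norm z0 = 1"
  obtains \<theta> where "cis \<theta> = z0" "cis (\<theta> + 2 * pi) = z0" "cis ` {\<theta>..\<theta> + 2 * pi} = sphere 0 1"
    "inj_on cis {\<theta><..<\<theta> + 2 * pi}"
proof -
  define \<theta> where "\<theta> = Arg z0"
  have "z0 \<noteq> 0" using assms by auto
  then have 1: "cis \<theta> = z0" using cis_Arg[of z0] assms by (simp add: \<theta>_def sgn_eq)
  have 2: "cis (\<theta> + 2 * pi) = z0" using 1 by (simp add: cis_mult[symmetric])
  have 3: "cis ` {\<theta>..\<theta> + 2 * pi} = sphere 0 1"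
  proof (intro equalityI subsetI)
    fix w assume "w \<in> sphere (0::complex) 1"
    then have w: "norm (w / z0) = 1" using assms by (simp add: norm_divide)
    define t where "t = Arg2pi (w / z0)"
    have t: "0 \<le> t" "t < 2 * pi" using Arg2pi by (auto simp: t_def)
    have "cis t = w / z0" using Arg2pi_eq[of "w / z0"] w by (simp add: t_def cis_conv_exp)
    then have "cis (\<theta> + t) = w" using 1 assms by (auto simp: cis_mult[symmetric])
    then show "w \<in> cis ` {\<theta>..\<theta> + 2 * pi}" using t by (intro image_eqI[of _ _ "\<theta> + t"]) auto
  qed auto
  have 4: "inj_on cis {\<theta><..<\<theta> + 2 * pi}"
  proof (rule inj_onI)
    fix s t assume st: "s \<in> {\<theta><..<\<theta> + 2 * pi}" "t \<in> {\<theta><..<\<theta> + 2 * pi}" "cis s = cis t"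
    then have "sin s = sin t \<and> cos s = cos t" by (auto simp: complex_eq_iff)
    then obtain n :: int where n: "s = t + 2 * pi * n" using sin_cos_eq_iff by metis
    have "\<bar>2 * pi * n\<bar> < 2 * pi" using st n by auto
    then have "\<bar>real_of_int n\<bar> < 1" by (simp add: abs_mult)
    then have "n = 0" by linarith
    then show "s = t" using n by simp
  qed
  show ?thesis using that 1 2 3 4 by blast
qed


section \<open>The edges of a diagram\<close>

lemma path_connected_scaled_interval:
  fixes z :: complex
  assumes "is_interval I"
  shows "path_connected ((\<lambda>t. of_real t * z) ` I)"
  by (rule path_connected_continuous_image)
    (use assms is_interval_path_connected in \<open>auto intro!: continuous_intros\<close>)

definition cross :: "complex set" where
  "cross = {z \<in> ball 0 2. Im z = 0 \<or> Re z = 0}"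

text \<open>The arm of the cross outside the open unit disk. It contains its end on the unit circle,
  where the smoothing attaches, but not its outer end.\<close>

definition ray :: "complex \<Rightarrow> complex set" where
  "ray z = (\<lambda>t. of_real t * z) ` {1..<2}"

lemma norm_unit_dirs: "z \<in> unit_dirs \<Longrightarrow> norm z = 1"
  by (auto simp: unit_dirs_def)

lemma ray_bounds: "z \<in> unit_dirs \<Longrightarrow> w \<in> ray z \<Longrightarrow> 1 \<le> norm w \<and> norm w < 2 \<and> w \<in> cross"
  by (auto simp: ray_def norm_mult norm_unit_dirs cross_def) (auto simp: unit_dirs_def)

lemma cross_ray:
  assumes "w \<in> cross" "1 \<le> norm w"
  obtains z where "z \<in> unit_dirs" "w \<in> ray z"
proof -
  have n: "norm w < 2" using assms by (simp add: cross_def)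
  consider "Im w = 0" "Re w \<ge> 0" | "Im w = 0" "Re w < 0" | "Re w = 0" "Im w \<ge> 0" | "Re w = 0" "Im w < 0"
    using assms(1) unfolding cross_def by fastforce
  then show ?thesis
  proof cases
    case 1
    then have "w = of_real (norm w) * 1" by (simp add: complex_eq_iff cmod_def)
    then have "w \<in> ray 1" unfolding ray_def using n assms by (intro image_eqI[of _ _ "norm w"]) auto
    then show ?thesis using that[of 1] by (simp add: unit_dirs_def)
  next
    case 2
    then have "w = of_real (norm w) * (-1)" by (simp add: complex_eq_iff cmod_def)
    then have "w \<in> ray (-1)" unfolding ray_def using n assms by (intro image_eqI[of _ _ "norm w"]) auto
    then show ?thesis using that[of "-1"] by (simp add: unit_dirs_def)
  next
    case 3
    then have "w = of_real (norm w) * \<i>" by (simp add: complex_eq_iff cmod_def)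
    then have "w \<in> ray \<i>" unfolding ray_def using n assms by (intro image_eqI[of _ _ "norm w"]) auto
    then show ?thesis using that[of \<i>] by (simp add: unit_dirs_def)
  next
    case 4
    then have "w = of_real (norm w) * (-\<i>)" by (simp add: complex_eq_iff cmod_def)
    then have "w \<in> ray (-\<i>)" unfolding ray_def using n assms by (intro image_eqI[of _ _ "norm w"]) auto
    then show ?thesis using that[of "-\<i>"] by (simp add: unit_dirs_def)
  qed
qed

text \<open>The half-plane around the direction \<open>z\<close> meets no other arm; in a chart this
  makes a ray open in \<open>Y\<close>.\<close>

lemma ray_half_plane:
  assumes z: "z \<in> unit_dirs"
  shows "{w \<in> cross. 1 \<le> norm w \<and> 0 < Re (w * cnj z)} = ray z"
proof (intro equalityI subsetI)
  fix w assume w: "w \<in> {w \<in> cross. 1 \<le> norm w \<and> 0 < Re (w * cnj z)}"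
  then obtain z' where z': "z' \<in> unit_dirs" "w \<in> ray z'" using cross_ray by blast
  then obtain t :: real where t: "w = of_real t * z'" "1 \<le> t" unfolding ray_def by force
  then have "0 < t * Re (z' * cnj z)" using w by (simp add: algebra_simps)
  then have "0 < Re (z' * cnj z)" using t by (simp add: zero_less_mult_iff)
  then have "z' = z" using z z'(1) by (auto simp: unit_dirs_def)
  then show "w \<in> ray z" using z' by simp
next
  fix w assume w: "w \<in> ray z"
  then obtain t :: real where t: "w = of_real t * z" "1 \<le> t" unfolding ray_def by force
  have "Re (w * cnj z) = t * Re (z * cnj z)" by (simp add: t algebra_simps)
  also have "Re (z * cnj z) = 1" using z by (auto simp: unit_dirs_def)
  finally have "0 < Re (w * cnj z)" using t by simp
  then show "w \<in> {w \<in> cross. 1 \<le> norm w \<and> 0 < Re (w * cnj z)}" using ray_bounds[OF z w] by simp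
qed

section \<open>The diagram outside small disks around its crossings\<close>

locale diagram =
  fixes X :: "'a topology" and \<A> :: "'a chart set" and L :: "('a \<times> real) set" and \<Phi> :: "'a \<Rightarrow> 'a chart"
  assumes surf: "closed_connected_oriented_surface X \<A>" and link: "link_diagram X \<A> L"
    and conn: "connected_diagram X L" and charts: "crossing_charts X \<A> L \<Phi>"
begin

definition "C = crossings L"
definition "D = projection L"
definition "U x = fst (\<Phi> x)"
definition "\<phi> x = snd (\<Phi> x)"
definition "\<psi> x = inv_into (U x) (\<phi> x)"
text \<open>The part of the diagram that every state keeps. The points of \<open>P\<close>, on the
  unit circles of the charts, will be the ends of its arcs.\<close>

definition "Y = D - (\<Union>x\<in>C. \<psi> x ` ball 0 1)"
definition "pt p = \<psi> (fst p) (snd p)"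
definition "P = pt ` (C \<times> unit_dirs)"

lemma Haus: "Hausdorff_space X" and comp_X: "compact_space X"
  using surf by (auto simp: closed_connected_oriented_surface_def)

lemma finC: "finite C"
  using link by (simp add: link_diagram_def C_def)

lemma chart:
  assumes "x \<in> C"
  shows "surface_chart X (U x, \<phi> x)" "x \<in> U x" "\<phi> x x = 0" "\<phi> x ` U x = ball 0 2" "\<phi> x ` (U x \<inter> D) = cross"
proof -
  have "crossing_chart X \<A> L x (U x, \<phi> x)"
    using charts assms by (simp add: crossing_charts_def C_def U_def \<phi>_def)
  then show "surface_chart X (U x, \<phi> x)" "x \<in> U x" "\<phi> x x = 0" "\<phi> x ` U x = ball 0 2" "\<phi> x ` (U x \<inter> D) = cross"
    by (auto simp: crossing_chart_def positive_chart_def D_def cross_def)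
qed

lemma co: "x \<in> C \<Longrightarrow> coordinates X (U x) (ball 0 2) (\<phi> x) (\<psi> x)"
  using coordinates_of_chart[OF chart(1)] chart(4) by (simp add: \<psi>_def)

lemma U_disjoint: "x \<in> C \<Longrightarrow> x' \<in> C \<Longrightarrow> y \<in> U x \<Longrightarrow> y \<in> U x' \<Longrightarrow> x = x'"
  using charts unfolding crossing_charts_def disjoint_family_on_def C_def U_def by blast

lemma D_iff: assumes "x \<in> C" "y \<in> U x" shows "y \<in> D \<longleftrightarrow> \<phi> x y \<in> cross"
proof
  assume "\<phi> x y \<in> cross"
  then obtain y' where y': "y' \<in> U x" "y' \<in> D" "\<phi> x y' = \<phi> x y"
    unfolding chart(5)[OF assms(1), symmetric] by force
  then have "y' = y" using coordinates.k_h[OF co[OF assms(1)]] assms(2) by metis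
  then show "y \<in> D" using y' by simp
qed (use chart(5)[OF assms(1)] assms in blast)

lemma disc_iff: "x \<in> C \<Longrightarrow> y \<in> \<psi> x ` ball 0 1 \<longleftrightarrow> y \<in> U x \<and> norm (\<phi> x y) < 1"
  and cdisc_iff: "x \<in> C \<Longrightarrow> y \<in> \<psi> x ` cball 0 1 \<longleftrightarrow> y \<in> U x \<and> norm (\<phi> x y) \<le> 1"
proof -
  assume x: "x \<in> C"
  have "ball 0 1 \<subseteq> ball (0::complex) 2" "cball 0 1 \<subseteq> ball (0::complex) 2" by auto
  note * = this[THEN coordinates.image_eq[OF co[OF x]]]
  show "y \<in> \<psi> x ` ball 0 1 \<longleftrightarrow> y \<in> U x \<and> norm (\<phi> x y) < 1" unfolding *(1) by simp
  show "y \<in> \<psi> x ` cball 0 1 \<longleftrightarrow> y \<in> U x \<and> norm (\<phi> x y) \<le> 1" unfolding *(2) by simp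
qed

lemma Y_iff: assumes x: "x \<in> C" and y: "y \<in> U x" shows "y \<in> Y \<longleftrightarrow> \<phi> x y \<in> cross \<and> 1 \<le> norm (\<phi> x y)"
proof -
  have "y \<in> \<psi> x' ` ball 0 1 \<longleftrightarrow> x' = x \<and> norm (\<phi> x y) < 1" if x': "x' \<in> C" for x'
    unfolding disc_iff[OF x'] using U_disjoint[OF x' x _ y] y by auto
  then show ?thesis using D_iff[OF assms] x by (auto simp: Y_def)
qed

lemma CD: "x \<in> C \<Longrightarrow> x \<in> D"
  by (force simp: C_def crossings_def D_def projection_def)

lemma C_not_Y: "x \<in> C \<Longrightarrow> x \<notin> Y"
  using Y_iff[of x x] chart by simp

text \<open>All double points have been removed with the disks, so over \<open>Y\<close> the
  projection of the link is injective.\<close>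

lemma unique_lift:
  assumes "(y, s) \<in> L" "(y, t) \<in> L" "y \<in> Y"
  shows "s = t"
proof (rule ccontr)
  assume "s \<noteq> t"
  then have "min s t < max s t" "(y, min s t) \<in> L" "(y, max s t) \<in> L" using assms by (auto simp: min_def max_def)
  then have "y \<in> C" unfolding C_def crossings_def by blast
  then show False using C_not_Y assms(3) by blast
qed

lemma link_circles:
  obtains \<K> where "finite \<K>" "disjoint \<K>" "\<Union>\<K> = L"
    "\<And>K. K \<in> \<K> \<Longrightarrow> \<exists>f. continuous_map (top_of_set (sphere (0::complex) 1)) X (\<lambda>z. fst (f z)) \<and>
        f ` sphere 0 1 = K \<and> inj_on f (sphere 0 1)"
proof -
  have lt: "link_in_thickening X L" using link by (simp add: link_diagram_def)
  then have LX: "L \<subseteq> topspace X \<times> {0..1}" by (simp add: link_in_thickening_def)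
  have "\<exists>\<K>. finite \<K> \<and> disjoint \<K> \<and> \<Union>\<K> = L \<and>
        (\<forall>K\<in>\<K>. subtopology (prod_topology X euclideanreal) K homeomorphic_space top_of_set (sphere (0::complex) 1))"
    using lt unfolding link_in_thickening_def by (elim conjE)
  then obtain \<K> where \<K>: "finite \<K>" "disjoint \<K>" "\<Union>\<K> = L"
     "\<forall>K\<in>\<K>. subtopology (prod_topology X euclideanreal) K homeomorphic_space top_of_set (sphere (0::complex) 1)"
    by (elim exE conjE) (rule that)
  have "\<exists>f. continuous_map (top_of_set (sphere (0::complex) 1)) X (\<lambda>z. fst (f z)) \<and>
        f ` sphere 0 1 = K \<and> inj_on f (sphere 0 1)" if K: "K \<in> \<K>" for K
  proof -
    let ?K = "subtopology (prod_topology X euclideanreal) K"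
    obtain h f where hf: "homeomorphic_maps ?K (top_of_set (sphere (0::complex) 1)) h f"
      using bspec[OF \<K>(4) K] by (auto simp: homeomorphic_space_def)
    have top: "topspace ?K = K" using LX \<K>(3) K by auto
    have fc: "continuous_map (top_of_set (sphere 0 1)) ?K f" using hf by (simp add: homeomorphic_maps_def)
    have "homeomorphic_map (top_of_set (sphere 0 1)) ?K f"
      using hf homeomorphic_maps_map by blast
    then have "f ` sphere 0 1 = K" "inj_on f (sphere 0 1)"
      using homeomorphic_imp_surjective_map homeomorphic_imp_injective_map top by force+
    moreover have "continuous_map (top_of_set (sphere 0 1)) X (fst \<circ> f)"
      using continuous_map_compose[OF continuous_map_into_fulltopology[OF fc] continuous_map_fst] .
    ultimately show ?thesis unfolding o_def by blast
  qed
  then show ?thesis using that \<K> by blast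
qed

lemma circle_compact:
  assumes "continuous_map (top_of_set (sphere (0::complex) 1)) X (\<lambda>z. fst (f z))" "f ` sphere 0 1 = K"
  shows "closedin X (fst ` K)"
proof -
  have "compactin (top_of_set (sphere (0::complex) 1)) (sphere 0 1)" by (simp add: compactin_subtopology)
  then have "compactin X ((\<lambda>z. fst (f z)) ` sphere 0 1)" using assms(1) by (rule image_compactin)
  then show ?thesis using assms(2) compactin_imp_closedin[OF Haus] by (metis image_image)
qed

lemma D_closed: "closedin X D"
proof -
  obtain \<K> where \<K>: "finite \<K>" "\<Union>\<K> = L"
    "\<And>K. K \<in> \<K> \<Longrightarrow> \<exists>f. continuous_map (top_of_set (sphere (0::complex) 1)) X (\<lambda>z. fst (f z)) \<and>
        f ` sphere 0 1 = K \<and> inj_on f (sphere 0 1)"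
    using link_circles by metis
  have "D = \<Union>((`) fst ` \<K>)" using \<K>(2) by (auto simp: D_def projection_def)
  moreover have "closedin X (\<Union>((`) fst ` \<K>))"
    using \<K>(1,3) circle_compact by (intro closedin_Union) auto
  ultimately show ?thesis by simp
qed

lemma disc_open: "x \<in> C \<Longrightarrow> openin X (\<psi> x ` ball 0 1)"
  by (rule coordinates.image_open[OF co]) auto

lemma disc_closed: "x \<in> C \<Longrightarrow> closedin X (\<psi> x ` cball 0 1)"
  by (rule compactin_imp_closedin[OF Haus], rule coordinates.image_compact[OF co]) auto

lemma Y_closed: "closedin X Y"
  unfolding Y_def using D_closed disc_open by (intro closedin_diff openin_Union) auto

lemma YX: "Y \<subseteq> topspace X" and DX: "D \<subseteq> topspace X"
  using Y_closed D_closed closedin_subset by blast+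

lemma pt_props:
  assumes "x \<in> C" "z \<in> unit_dirs"
  shows "pt (x, z) \<in> U x" "\<phi> x (pt (x, z)) = z" "pt (x, z) \<in> Y"
proof -
  have zb: "z \<in> ball 0 2" using norm_unit_dirs[OF assms(2)] by simp
  show u: "pt (x, z) \<in> U x" "\<phi> x (pt (x, z)) = z"
    using coordinates.k_in[OF co[OF assms(1)] zb] coordinates.h_k[OF co[OF assms(1)] zb] by (auto simp: pt_def)
  have "z \<in> cross" using assms(2) by (auto simp: unit_dirs_def cross_def)
  then show "pt (x, z) \<in> Y" using Y_iff[OF assms(1) u(1)] u(2) norm_unit_dirs[OF assms(2)] by simp
qed

lemma inj_pt: "inj_on pt (C \<times> unit_dirs)"
proof (rule inj_onI)
  fix p q assume *: "p \<in> C \<times> unit_dirs" "q \<in> C \<times> unit_dirs" "pt p = pt q"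
  then have "fst p = fst q" using pt_props(1) U_disjoint by (metis mem_Times_iff prod.collapse)
  moreover have "snd p = snd q" using * calculation pt_props(2) by (metis mem_Times_iff prod.collapse)
  ultimately show "p = q" by (simp add: prod_eq_iff)
qed

lemma ray_props:
  assumes x: "x \<in> C" and z: "z \<in> unit_dirs"
  shows "path_connectedin X (\<psi> x ` ray z)" "\<psi> x ` ray z \<subseteq> Y" "\<psi> x ` ray z \<subseteq> U x" "pt (x, z) \<in> \<psi> x ` ray z"
    "\<exists>N. openin X N \<and> \<psi> x ` ray z = Y \<inter> N"
    "connectedin X (\<psi> x ` ray z - {pt (x, z)})" "\<psi> x ` ray z - {pt (x, z)} \<noteq> {}"
proof -
  have rb: "ray z \<subseteq> ball 0 2" using ray_bounds[OF z] by auto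
  show "path_connectedin X (\<psi> x ` ray z)"
    by (rule coordinates.image_path_connected[OF co[OF x] rb])
      (unfold ray_def, rule path_connected_scaled_interval, simp add: is_interval_1)
  show sU: "\<psi> x ` ray z \<subseteq> U x" using coordinates.k_in[OF co[OF x]] rb by auto
  have eqr: "\<psi> x ` ray z = {y \<in> U x. \<phi> x y \<in> ray z}" by (rule coordinates.image_eq[OF co[OF x] rb])
  show "\<psi> x ` ray z \<subseteq> Y" unfolding eqr using Y_iff[OF x] ray_bounds[OF z] by auto
  have z_ray: "z \<in> ray z" unfolding ray_def by (rule image_eqI[of _ _ 1]) auto
  then show "pt (x, z) \<in> \<psi> x ` ray z" by (auto simp: pt_def)
  let ?H = "ball 0 2 \<inter> {w. 0 < Re (w * cnj z)}"
  have "open ?H" by (intro open_Int open_ball open_Collect_less continuous_intros)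
  then have oN: "openin X (\<psi> x ` ?H)" by (intro coordinates.image_open[OF co[OF x]]) auto
  have "?H \<subseteq> ball 0 2" by blast
  note H = coordinates.image_eq[OF co[OF x] this]
  have "y \<in> \<psi> x ` ray z \<longleftrightarrow> y \<in> Y \<inter> \<psi> x ` ?H" for y
  proof (cases "y \<in> U x")
    case True
    have "\<phi> x y \<in> ray z \<longleftrightarrow> \<phi> x y \<in> cross \<and> 1 \<le> norm (\<phi> x y) \<and> 0 < Re (\<phi> x y * cnj z)"
      unfolding ray_half_plane[OF z, symmetric] by blast
    then show ?thesis
      using Y_iff[OF x True] coordinates.h_in[OF co[OF x] True] True unfolding eqr H by blast
  qed (use eqr H in blast)
  then have "\<psi> x ` ray z = Y \<inter> \<psi> x ` ?H" by blast
  then show "\<exists>N. openin X N \<and> \<psi> x ` ray z = Y \<inter> N" using oN by blast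
  define ray' where "ray' = (\<lambda>t. of_real t * z) ` {1<..<2::real}"
  have z0: "z \<noteq> 0" using z by (auto simp: unit_dirs_def)
  have r': "ray z - {z} = ray'"
  proof (intro equalityI subsetI)
    fix w assume "w \<in> ray z - {z}"
    then obtain t :: real where t: "w = of_real t * z" "1 \<le> t" "t < 2" "w \<noteq> z" unfolding ray_def by force
    then have "t \<noteq> 1" by auto
    then show "w \<in> ray'" using t by (auto simp: ray'_def)
  next
    fix w assume "w \<in> ray'"
    then obtain t :: real where t: "w = of_real t * z" "1 < t" "t < 2" unfolding ray'_def by force
    then have "w \<noteq> z" using z0 by auto
    then show "w \<in> ray z - {z}" using t by (auto simp: ray_def)
  qed
  have eq': "\<psi> x ` ray z - {pt (x, z)} = \<psi> x ` ray'"
  proof -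
    have "\<psi> x ` (ray z - {z}) = \<psi> x ` ray z - \<psi> x ` {z}"
      by (rule inj_on_image_set_diff[OF coordinates.inj_k[OF co[OF x]]]) (use rb z_ray in blast)+
    then show ?thesis by (simp add: r' pt_def)
  qed
  have "ray' \<subseteq> ball 0 2" using rb r' by blast
  then show "connectedin X (\<psi> x ` ray z - {pt (x, z)})"
    unfolding eq' ray'_def
    by (intro path_connectedin_imp_connectedin coordinates.image_path_connected[OF co[OF x]] path_connected_scaled_interval)
      (simp_all add: is_interval_1)
  have "of_real (3/2) * z \<in> ray'" unfolding ray'_def by (rule imageI) simp
  then show "\<psi> x ` ray z - {pt (x, z)} \<noteq> {}" unfolding eq' by blast
qed

text \<open>Outside the closed disks, passing from \<open>D\<close> to \<open>Y\<close> changes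
  nothing. The cross meets the unit circle only in the four directions, so a point of
  \<open>Y\<close> on the boundary of a disk belongs to \<open>P\<close>.\<close>

lemma Y_minus_P:
  defines "N \<equiv> topspace X - (\<Union>x\<in>C. \<psi> x ` cball 0 1)"
  shows "openin X N" "D \<inter> N \<subseteq> Y" "Y - P \<subseteq> N"
proof -
  have "closedin X (\<Union>x\<in>C. \<psi> x ` cball 0 1)"
    using finC disc_closed by (intro closedin_Union) auto
  then show "openin X N" unfolding N_def by blast
  have "\<psi> x ` ball 0 1 \<subseteq> \<psi> x ` cball 0 1" for x by (intro image_mono) auto
  then show "D \<inter> N \<subseteq> Y" unfolding N_def Y_def by blast
  show "Y - P \<subseteq> N"
  proof
    fix y assume y: "y \<in> Y - P"
    have "y \<notin> \<psi> x ` cball 0 1" if x: "x \<in> C" for x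
    proof
      assume "y \<in> \<psi> x ` cball 0 1"
      then have yU: "y \<in> U x" and n: "norm (\<phi> x y) \<le> 1"
        unfolding cdisc_iff[OF x] by auto
      then have c: "\<phi> x y \<in> cross" "norm (\<phi> x y) = 1" using y Y_iff[OF x yU] by auto
      then obtain z where z: "z \<in> unit_dirs" "\<phi> x y \<in> ray z" using cross_ray by force
      then obtain t :: real where t: "\<phi> x y = of_real t * z" "1 \<le> t" unfolding ray_def by force
      then have "t = 1" using c(2) norm_unit_dirs[OF z(1)] by (simp add: norm_mult)
      then have "\<phi> x y = z" using t by simp
      then have "y = pt (x, z)" using coordinates.k_h[OF co[OF x] yU] by (simp add: pt_def)
      then show False using y z x by (auto simp: P_def)
    qed
    then show "y \<in> N" using y YX unfolding N_def by blast
  qed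
qed

text \<open>By \<open>unique_lift\<close> the component lies over a single circle of the link. If
  that circle stayed in \<open>Y\<close> it would be all of the connected diagram, which would have
  no crossing; so it can be cut at a point outside \<open>Y\<close>, and
  \<open>arc_component\<close> applies.\<close>

lemma edge:
  assumes ne: "C \<noteq> {}" and e: "e \<in> connected_components_of (subtopology X Y)"
  shows "contractible_space (subtopology X e) \<and> card (e \<inter> P) = 2"
proof -
  obtain \<K> where \<K>: "finite \<K>" "disjoint \<K>" "\<Union>\<K> = L"
    "\<And>K. K \<in> \<K> \<Longrightarrow> \<exists>f. continuous_map (top_of_set (sphere (0::complex) 1)) X (\<lambda>z. fst (f z)) \<and>
        f ` sphere 0 1 = K \<and> inj_on f (sphere 0 1)"
    using link_circles by metis
  have eY: "e \<subseteq> Y" and e_conn: "connectedin X e" and e_ne: "e \<noteq> {}"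
    using connectedin_connected_components_of[OF e] nonempty_connected_components_of[OF e]
    by (auto simp: connectedin_subtopology)
  obtain y where y: "y \<in> e" using e_ne by blast
  then have "y \<in> D" using eY by (auto simp: Y_def)
  then obtain K where K: "K \<in> \<K>" "y \<in> fst ` K" using \<K>(3) by (auto simp: D_def projection_def)
  define E2 where "E2 = (\<Union>K'\<in>\<K> - {K}. fst ` K')"
  have cl: "closedin X (fst ` K')" if "K' \<in> \<K>" for K' using \<K>(4)[OF that] circle_compact by blast
  have cE2: "closedin X E2" unfolding E2_def using \<K>(1) cl by (intro closedin_Union) auto
  have D_eq: "D = fst ` K \<union> E2" using K(1) \<K>(3) by (auto simp: D_def projection_def E2_def)
  have sep: "fst ` K \<inter> E2 \<inter> Y = {}"
  proof (rule ccontr)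
    assume "fst ` K \<inter> E2 \<inter> Y \<noteq> {}"
    then obtain x q K' where q: "q \<in> K" "x = fst q" "x \<in> Y" "x \<in> fst ` K'" "K' \<in> \<K>" "K' \<noteq> K"
      unfolding E2_def by blast
    then obtain q' where q': "q' \<in> K'" "x = fst q'" by blast
    obtain s t where *: "(x, s) \<in> K" "(x, t) \<in> K'" "K' \<in> \<K>" "K' \<noteq> K" "x \<in> Y"
      using q q' by (cases q; cases q') auto
    have "(x, s) \<in> L" "(x, t) \<in> L" using * K(1) \<K>(3) by auto
    then have "s = t" using unique_lift * by blast
    then show False using * K(1) \<K>(2) by (auto simp: disjoint_def)
  qed
  have eK: "e \<subseteq> fst ` K"
  proof -
    have "e \<subseteq> fst ` K \<union> E2" using eY D_eq by (auto simp: Y_def)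
    moreover have "fst ` K \<inter> E2 \<inter> e = {}" using sep eY by blast
    moreover have "fst ` K \<inter> e \<noteq> {}" using K y by blast
    ultimately have "E2 \<inter> e = {}"
      using e_conn cl[OF K(1)] cE2 unfolding connectedin_closedin by blast
    then show ?thesis using \<open>e \<subseteq> fst ` K \<union> E2\<close> by blast
  qed
  have "\<not> fst ` K \<subseteq> Y"
  proof
    assume KY: "fst ` K \<subseteq> Y"
    have "connectedin X D" using conn by (simp add: connected_diagram_def D_def)
    moreover have "fst ` K \<inter> E2 \<inter> D = {}" using sep KY by blast
    moreover have "fst ` K \<inter> D \<noteq> {}" using K(2) D_eq by blast
    ultimately have "E2 \<inter> D = {}"
      using cl[OF K(1)] cE2 D_eq unfolding connectedin_closedin by blast
    then have "D \<subseteq> Y" using D_eq KY by blast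
    then show False using ne CD C_not_Y by blast
  qed
  then obtain q where q: "q \<in> K" "fst q \<notin> Y" by blast
  obtain f where f: "continuous_map (top_of_set (sphere (0::complex) 1)) X (\<lambda>z. fst (f z))"
    "f ` sphere 0 1 = K" "inj_on f (sphere 0 1)" using \<K>(4)[OF K(1)] by blast
  obtain z0 where z0: "norm z0 = 1" "f z0 = q" using q f(2) by force
  obtain \<theta> where \<theta>: "cis \<theta> = z0" "cis (\<theta> + 2 * pi) = z0" "cis ` {\<theta>..\<theta> + 2 * pi} = sphere 0 1"
    "inj_on cis {\<theta><..<\<theta> + 2 * pi}" using circle_arc_param[OF z0(1)] by blast
  define \<gamma> where "\<gamma> = (\<lambda>z. fst (f z)) \<circ> cis"
  have ends: "\<gamma> \<theta> \<notin> Y" "\<gamma> (\<theta> + 2 * pi) \<notin> Y" using \<theta> z0 q by (simp_all add: \<gamma>_def)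
  have im: "\<gamma> ` {\<theta>..\<theta> + 2 * pi} = fst ` K"
    unfolding \<gamma>_def image_comp[symmetric] \<theta>(3) using f(2) by (simp add: image_image[symmetric, of fst f])
  have "continuous_map (top_of_set {\<theta>..\<theta> + 2 * pi}) (top_of_set (sphere 0 1)) cis"
    by (auto intro!: continuous_intros)
  then have \<gamma>c: "continuous_map (top_of_set {\<theta>..\<theta> + 2 * pi}) X \<gamma>"
    unfolding \<gamma>_def using f(1) by (rule continuous_map_compose)
  have inj: "inj_on \<gamma> {t\<in>{\<theta>..\<theta> + 2 * pi}. \<gamma> t \<in> Y}"
  proof (rule inj_onI)
    fix s t assume st: "s \<in> {t\<in>{\<theta>..\<theta> + 2 * pi}. \<gamma> t \<in> Y}" "t \<in> {t\<in>{\<theta>..\<theta> + 2 * pi}. \<gamma> t \<in> Y}" "\<gamma> s = \<gamma> t"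
    have "f (cis s) \<in> L" "f (cis t) \<in> L" using f(2) K(1) \<K>(3) by (auto simp: norm_cis)
    moreover have "fst (f (cis s)) = fst (f (cis t))" "fst (f (cis s)) \<in> Y" using st by (auto simp: \<gamma>_def)
    ultimately have "snd (f (cis s)) = snd (f (cis t))"
      using unique_lift[of "fst (f (cis s))"] by (metis prod.collapse)
    then have "f (cis s) = f (cis t)" using \<open>fst (f (cis s)) = fst (f (cis t))\<close> by (simp add: prod_eq_iff)
    then have "cis s = cis t" using inj_onD[OF f(3)] by (simp add: norm_cis)
    moreover have "s \<noteq> \<theta>" "t \<noteq> \<theta>" "s \<noteq> \<theta> + 2 * pi" "t \<noteq> \<theta> + 2 * pi" using st ends by auto
    then have "s \<in> {\<theta><..<\<theta> + 2 * pi}" "t \<in> {\<theta><..<\<theta> + 2 * pi}" using st by auto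
    ultimately show "s = t" using inj_onD[OF \<theta>(4)] by blast
  qed
  show ?thesis
  proof (rule arc_component[OF Haus \<gamma>c Y_closed e _ ends inj Y_minus_P(1) _ Y_minus_P(3)])
    show "e \<subseteq> \<gamma> ` {\<theta>..\<theta> + 2 * pi}" using eK im by simp
    show "\<gamma> ` {\<theta>..\<theta> + 2 * pi} \<inter> (topspace X - (\<Union>x\<in>C. \<psi> x ` cball 0 1)) \<subseteq> Y"
      unfolding im using Y_minus_P(2) D_eq by blast
    fix p assume "p \<in> P"
    then obtain x z where xz: "x \<in> C" "z \<in> unit_dirs" "p = pt (x, z)" by (auto simp: P_def)
    obtain N where N: "openin X N" "\<psi> x ` ray z = Y \<inter> N" using ray_props(5)[OF xz(1,2)] by blast
    have "connectedin X (\<psi> x ` ray z)" by (rule path_connectedin_imp_connectedin[OF ray_props(1)[OF xz(1,2)]])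
    then show "\<exists>R N. openin X N \<and> R = Y \<inter> N \<and> p \<in> R \<and> connectedin X R \<and> connectedin X (R - {p}) \<and> R - {p} \<noteq> {}"
      using N ray_props(4,6,7)[OF xz(1,2)] unfolding xz(3) by (intro exI[of _ "\<psi> x ` ray z"] exI[of _ N]) simp
  qed
qed

definition "ed p = connected_component_of_set (subtopology X Y) (pt p)"

lemma ed_component:
  assumes "p \<in> C \<times> unit_dirs"
  shows "ed p \<in> connected_components_of (subtopology X Y)" "pt p \<in> ed p"
proof -
  have "pt p \<in> topspace (subtopology X Y)" using pt_props(3) YX assms by (cases p) auto
  then show "ed p \<in> connected_components_of (subtopology X Y)" "pt p \<in> ed p"
    by (auto simp: ed_def connected_components_of_def connected_component_of_refl)
qed

lemma ed_eq_iff: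
  assumes "p \<in> C \<times> unit_dirs" "e \<in> connected_components_of (subtopology X Y)"
  shows "ed p = e \<longleftrightarrow> pt p \<in> e"
  using ed_component[OF assms(1)] assms(2) connected_components_of_overlap[of "ed p" _ e] by blast

text \<open>Every component has two ends in \<open>P\<close>, so none of them is missed by the
  half-edges.\<close>

lemma components_eq:
  assumes "C \<noteq> {}"
  shows "connected_components_of (subtopology X Y) = ed ` (C \<times> unit_dirs)"
proof (intro equalityI subsetI)
  fix e assume e: "e \<in> connected_components_of (subtopology X Y)"
  have "card (e \<inter> P) = 2" using edge[OF assms e] by simp
  then have "e \<inter> P \<noteq> {}" by (metis card.empty zero_neq_numeral)
  then obtain p where "p \<in> C \<times> unit_dirs" "pt p \<in> e" by (auto simp: P_def)
  then show "e \<in> ed ` (C \<times> unit_dirs)" using ed_eq_iff e by blast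
qed (use ed_component in blast)

lemma two_ends:
  assumes "C \<noteq> {}" "e \<in> ed ` (C \<times> unit_dirs)"
  shows "card {p \<in> C \<times> unit_dirs. ed p = e} = 2"
proof -
  have e: "e \<in> connected_components_of (subtopology X Y)" using assms(2) ed_component by blast
  have "pt ` {p \<in> C \<times> unit_dirs. ed p = e} = e \<inter> P" using ed_eq_iff[OF _ e] by (auto simp: P_def)
  moreover have "card (pt ` {p \<in> C \<times> unit_dirs. ed p = e}) = card {p \<in> C \<times> unit_dirs. ed p = e}"
    by (rule card_image, rule inj_on_subset[OF inj_pt]) auto
  ultimately show ?thesis using edge[OF assms(1) e] by simp
qed

text \<open>Potentials of different components require no matching, since a simplex is connected and
  stays in one component.\<close>

lemma potential_on_Y:
  assumes ne: "C \<noteq> {}" and F: "cocycle_on X Y F"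
  obtains w where "potential_on X Y F w"
proof -
  define cc where "cc = connected_components_of (subtopology X Y)"
  have eY: "e \<subseteq> Y" if "e \<in> cc" for e
    using connected_components_of_subset[of e "subtopology X Y"] that by (auto simp: cc_def)
  have "\<exists>w. potential_on X e F w" if e: "e \<in> cc" for e
    using potential_exists_contractible[OF cocycle_on_mono[OF F eY[OF e]]] edge[OF ne] e by (simp add: cc_def)
  then obtain w where w: "\<And>e. e \<in> cc \<Longrightarrow> potential_on X e F (w e)" by metis
  define w' where "w' y = w (connected_component_of_set (subtopology X Y) y) y" for y
  have "F (frag_of f) = w' (f vert0) + w' (f vert1)" if f: "singular_simplex 1 (subtopology X Y) f" for f
  proof -
    have "continuous_map (subtopology (powertop_real UNIV) (standard_simplex 1)) (subtopology X Y) f"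
      using f by (simp add: singular_simplex_def)
    moreover have "connectedin (subtopology (powertop_real UNIV) (standard_simplex 1)) (standard_simplex 1)"
      using connectedin_standard_simplex[of 1] by (simp add: connectedin_subtopology)
    ultimately have c: "connectedin (subtopology X Y) (f ` standard_simplex 1)"
      by (rule connectedin_continuous_map_image)
    define e where "e = connected_component_of_set (subtopology X Y) (f vert0)"
    have v: "f vert0 \<in> f ` standard_simplex 1" "f vert1 \<in> f ` standard_simplex 1"
      using verts_in_standard_simplex by auto
    have fe: "f ` standard_simplex 1 \<subseteq> e" unfolding e_def by (rule connected_component_of_maximal[OF c v(1)])
    have "f vert0 \<in> topspace (subtopology X Y)" using c v connectedin_subset_topspace by blast
    then have ecc: "e \<in> cc" by (auto simp: e_def cc_def connected_components_of_def)
    have "connected_component_of (subtopology X Y) (f vert0) (f vert1)" using fe v by (auto simp: e_def)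
    then have "connected_component_of (subtopology X Y) (f vert0) = connected_component_of (subtopology X Y) (f vert1)"
      by (simp add: connected_component_of_equiv)
    then have e1: "connected_component_of_set (subtopology X Y) (f vert1) = e"
      unfolding e_def by simp
    have "singular_simplex 1 X f" using f by (simp add: singular_simplex_subtopology)
    then have "singular_simplex 1 (subtopology X e) f" using fe by (simp add: singular_simplex_subtopology)
    then have "F (frag_of f) = w e (f vert0) + w e (f vert1)" using w[OF ecc] by (simp add: potential_on_def)
    then show ?thesis by (simp add: w'_def e1 flip: e_def)
  qed
  then show ?thesis using that by (auto simp: potential_on_def)
qed

lemma path_connected_edge:
  assumes "C \<noteq> {}" "e \<in> ed ` (C \<times> unit_dirs)"
  shows "path_connectedin X e" "e \<subseteq> Y"
proof -
  have e: "e \<in> connected_components_of (subtopology X Y)" using assms(2) ed_component by blast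
  show eY: "e \<subseteq> Y" using connected_components_of_subset[OF e] by auto
  have "path_connected_space (subtopology X e)"
    by (rule contractible_imp_path_connected_space) (use edge[OF assms(1) e] in simp)
  then show "path_connectedin X e" using eY YX by (auto simp: path_connectedin_def)
qed

end


section \<open>Gluing potentials on a diagram and its states\<close>

text \<open>Used for the diagram, for a state and for a circle, with disjoint patches
  \<open>N i\<close> besides \<open>Y\<close>. A potential has to be verified only near each point,
  so it is enough that \<open>T\<close> lies locally in one piece and that the values agree where a
  patch overlaps \<open>Y\<close>.\<close>

lemma glue_potentials:
  assumes F: "cocycle_on X T F" and w: "potential_on X Y F w"
    and v: "\<And>i. i \<in> I \<Longrightarrow> potential_on X (N i) F (v i)"
    and agree: "\<And>i y. i \<in> I \<Longrightarrow> y \<in> Y \<Longrightarrow> y \<in> N i \<Longrightarrow> w y = v i y"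
    and disj: "\<And>i j y. i \<in> I \<Longrightarrow> j \<in> I \<Longrightarrow> y \<in> N i \<Longrightarrow> y \<in> N j \<Longrightarrow> i = j"
    and nb: "\<And>y. y \<in> T \<Longrightarrow> \<exists>W. openin X W \<and> y \<in> W \<and> (T \<inter> W \<subseteq> Y \<or> (\<exists>i\<in>I. T \<inter> W \<subseteq> N i))"
  obtains u where "\<And>y. y \<in> Y \<Longrightarrow> u y = w y" "\<And>i y. i \<in> I \<Longrightarrow> y \<in> N i \<Longrightarrow> u y = v i y" "kills_cycles X T F"
proof -
  define u where "u y = (if y \<in> Y then w y else v (THE i. i \<in> I \<and> y \<in> N i) y)" for y
  have u1: "u y = w y" if "y \<in> Y" for y using that by (simp add: u_def)
  have u2: "u y = v i y" if iy: "i \<in> I" "y \<in> N i" for i y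
  proof (cases "y \<in> Y")
    case False
    have "(THE i. i \<in> I \<and> y \<in> N i) = i" by (rule the_equality) (use iy disj in auto)
    then show ?thesis using False by (simp add: u_def)
  qed (use iy agree u1 in simp)
  have "kills_cycles X T F"
  proof (rule kills_cycles_if_local_potential[OF F, of u])
    fix y assume "y \<in> T"
    then obtain W where W: "openin X W" "y \<in> W" "T \<inter> W \<subseteq> Y \<or> (\<exists>i\<in>I. T \<inter> W \<subseteq> N i)" using nb by blast
    have "potential_on X (T \<inter> W) F u"
      using W(3)
    proof
      assume s: "T \<inter> W \<subseteq> Y"
      show ?thesis by (rule potential_on_cong[OF potential_on_mono[OF w s]]) (use s u1 in auto)
    next
      assume "\<exists>i\<in>I. T \<inter> W \<subseteq> N i"
      then obtain i where i: "i \<in> I" and s: "T \<inter> W \<subseteq> N i" by blast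
      show ?thesis by (rule potential_on_cong[OF potential_on_mono[OF v[OF i] s]]) (use s u2 i in auto)
    qed
    then show "\<exists>W. openin X W \<and> y \<in> W \<and> potential_on X (T \<inter> W) F u" using W by blast
  qed
  then show ?thesis using that u1 u2 by blast
qed

text \<open>The chord of the smoothing is prolonged by the two rays at its ends. This makes it open
  in the state and lets it overlap \<open>Y\<close>, as gluing requires.\<close>

definition smoothed_arc :: "smoothing \<Rightarrow> complex \<Rightarrow> complex set" where
  "smoothed_arc s z = ray z \<union> closed_segment z (partner s z) \<union> ray (partner s z)"

lemma partner_orthonormal:
  assumes "z \<in> {1, -1}"
  shows "Re (z * cnj z) = 1" "Re (partner s z * cnj (partner s z)) = 1"
    "Re (z * cnj (partner s z)) = 0" "Re (partner s z * cnj z) = 0"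
  using assms by (cases s; auto)+

text \<open>The map \<open>\<gamma>\<close> parametrises the arc by the interval \<open>(-2, 2)\<close> so that the coordinate along \<open>z\<close> minus the
  coordinate along its partner recovers the parameter.\<close>

lemma smoothed_arc_props:
  assumes z: "z \<in> {1, -1}"
  shows "smoothed_arc s z \<subseteq> ball 0 2" "contractible (smoothed_arc s z)" "path_connected (smoothed_arc s z)"
    "smoothed_arc s z \<subseteq> {w. 0 < Re (w * cnj (z + partner s z))}"
proof -
  define k where "k = partner s z"
  note on = partner_orthonormal(1)[OF z] partner_orthonormal(2-4)[OF z, of s, folded k_def]
  \<comment> \<open>The coordinate along \<open>z\<close>: 0 for \<open>r \<le> -1\<close>, then
    \<open>(1 + r) / 2\<close> on the chord, then \<open>r\<close>. As the maximum of these three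
    lines it is visibly continuous, and subtracting \<open>r\<close> gives the coordinate along the
    partner.\<close>
  define \<rho> where "\<rho> r = max 0 (max r ((1 + r) / 2))" for r :: real
  define \<gamma> where "\<gamma> r = of_real (\<rho> r) * z + of_real (\<rho> r - r) * k" for r
  define \<eta> where "\<eta> w = Re (w * cnj z) - Re (w * cnj k)" for w
  have dot: "Re (\<gamma> r * cnj z) = \<rho> r" "Re (\<gamma> r * cnj k) = \<rho> r - r" for r
  proof -
    have "Re (\<gamma> r * cnj y) = \<rho> r * Re (z * cnj y) + (\<rho> r - r) * Re (k * cnj y)" for y
      by (simp add: \<gamma>_def algebra_simps)
    then show "Re (\<gamma> r * cnj z) = \<rho> r" "Re (\<gamma> r * cnj k) = \<rho> r - r" by (simp_all only: on mult_zero_right mult_1_right add_0_left add_0_right)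
  qed
  have \<eta>\<gamma>: "\<eta> (\<gamma> r) = r" for r by (simp only: \<eta>_def dot)
  have arc: "smoothed_arc s z = \<gamma> ` {-2<..<2}"
  proof (intro equalityI subsetI)
    fix w assume "w \<in> smoothed_arc s z"
    then consider (1) t :: real where "w = of_real t * z" "1 \<le> t" "t < 2"
      | (2) t :: real where "0 \<le> t" "t \<le> 1" "w = (1 - t) *\<^sub>R z + t *\<^sub>R k"
      | (3) t :: real where "w = of_real t * k" "1 \<le> t" "t < 2"
      unfolding smoothed_arc_def ray_def closed_segment_def k_def by fastforce
    then show "w \<in> \<gamma> ` {-2<..<2}"
    proof cases
      case 1
      then have "\<rho> t = t" by (simp add: \<rho>_def max_def)
      then have "w = \<gamma> t" by (simp add: \<gamma>_def 1)
      then show ?thesis using 1 by simp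
    next
      case 2
      then have "\<rho> (1 - 2 * t) = 1 - t" by (simp add: \<rho>_def max_def)
      then have "w = \<gamma> (1 - 2 * t)" by (simp add: \<gamma>_def 2 scaleR_conv_of_real)
      then show ?thesis using 2 by simp
    next
      case 3
      then have "\<rho> (- t) = 0" by (simp add: \<rho>_def max_def)
      then have "w = \<gamma> (- t)" by (simp add: \<gamma>_def 3)
      then show ?thesis using 3 by simp
    qed
  next
    fix w assume "w \<in> \<gamma> ` {-2<..<2}"
    then obtain r where r: "w = \<gamma> r" "-2 < r" "r < 2" by auto
    consider "1 \<le> r" | "r \<le> -1" | "-1 < r" "r < 1" by linarith
    then show "w \<in> smoothed_arc s z"
    proof cases
      case 1
      then have "\<rho> r = r" by (simp add: \<rho>_def max_def)
      then have "w = of_real r * z" by (simp add: r \<gamma>_def)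
      then have "w \<in> ray z" unfolding ray_def using 1 r by (intro image_eqI[of _ _ r]) auto
      then show ?thesis by (simp add: smoothed_arc_def)
    next
      case 2
      then have "\<rho> r = 0" by (simp add: \<rho>_def max_def)
      then have "w = of_real (- r) * k" by (simp add: r \<gamma>_def)
      then have "w \<in> ray k" unfolding ray_def using 2 r by (intro image_eqI[of _ _ "- r"]) auto
      then show ?thesis by (simp add: smoothed_arc_def k_def)
    next
      case 3
      define t where "t = (1 - r) / 2"
      have "\<rho> r = 1 - t" using 3 by (simp add: \<rho>_def max_def t_def field_simps)
      moreover have "r = 1 - 2 * t" by (simp add: t_def field_simps)
      ultimately have "w = (1 - t) *\<^sub>R z + t *\<^sub>R k" by (simp add: r(1) \<gamma>_def scaleR_conv_of_real)
      moreover have "0 \<le> t" "t \<le> 1" using 3 by (auto simp: t_def)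
      ultimately have "w \<in> closed_segment z k" by (auto simp: closed_segment_def)
      then show ?thesis by (simp add: smoothed_arc_def k_def)
    qed
  qed
  have nz: "norm z = 1" "norm k = 1" using z partner_in_unit_dirs[of z s] norm_unit_dirs by (auto simp: k_def unit_dirs_def)
  show "smoothed_arc s z \<subseteq> ball 0 2"
  proof -
    have "closed_segment z k \<subseteq> cball 0 1"
      by (rule closed_segment_subset) (use nz in auto)
    moreover have "ray z \<subseteq> ball 0 2" "ray k \<subseteq> ball 0 2"
      using nz by (auto simp: ray_def norm_mult)
    ultimately show ?thesis by (force simp: smoothed_arc_def k_def)
  qed
  have c\<rho>: "continuous_on S \<rho>" for S unfolding \<rho>_def by (intro continuous_intros) auto
  have "continuous_on S \<gamma>" for S
    unfolding \<gamma>_def by (intro continuous_intros c\<rho>)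
  moreover have "continuous_on S \<eta>" for S unfolding \<eta>_def by (intro continuous_intros)
  ultimately have "{-2<..<2::real} homeomorphic smoothed_arc s z"
    unfolding arc by (intro homeomorphicI[of \<gamma> _ _ \<eta>]) (auto simp: \<eta>\<gamma> image_image)
  moreover have "contractible {-2<..<2::real}" by (simp add: convex_imp_contractible)
  ultimately show c: "contractible (smoothed_arc s z)" using homeomorphic_contractible by blast
  then show "path_connected (smoothed_arc s z)" by (rule contractible_imp_path_connected)
  \<comment> \<open>The two coordinates sum to \<open>2 * \<rho> r - r\<close>, which is at least 1
    because \<open>(1 + r) / 2 \<le> \<rho> r\<close>.\<close>
  have "0 < Re (\<gamma> r * cnj (z + k))" for r
  proof -
    have "Re (\<gamma> r * cnj (z + k)) = Re (\<gamma> r * cnj z) + Re (\<gamma> r * cnj k)" by (simp add: algebra_simps)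
    then have "Re (\<gamma> r * cnj (z + k)) = \<rho> r + (\<rho> r - r)" by (simp only: dot)
    moreover have "(1 + r) / 2 \<le> \<rho> r"
      unfolding \<rho>_def by (rule order_trans[OF max.cobounded2 max.cobounded2])
    ultimately show ?thesis by (simp add: field_simps)
  qed
  then show "smoothed_arc s z \<subseteq> {w. 0 < Re (w * cnj (z + partner s z))}" unfolding arc k_def[symmetric] by blast
qed

lemma ray_in_smoothed_arc:
  assumes z: "z \<in> {1, -1}" and z': "z' \<in> unit_dirs" "w \<in> ray z'" and w: "w \<in> smoothed_arc s z"
  shows "z' = z \<or> z' = partner s z"
proof -
  obtain t :: real where t: "w = of_real t * z'" "1 \<le> t" using z'(2) unfolding ray_def by force
  have "0 < Re (w * cnj (z + partner s z))" using smoothed_arc_props(4)[OF z] w by blast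
  then have "0 < t * Re (z' * cnj (z + partner s z))" by (simp add: t algebra_simps)
  then have "0 < Re (z' * cnj (z + partner s z))" using t(2) by (simp add: zero_less_mult_iff)
  then show ?thesis using z z'(1) by (cases s) (auto simp: unit_dirs_def)
qed

text \<open>The arc from \<open>-1\<close> is the negative of the arc from \<open>1\<close>, and
  each lies in an open half-plane bounded by a line through 0.\<close>

lemma smoothed_arcs_disjoint:
  assumes "z \<in> {1, -1}" "z' \<in> {1, -1}" "w \<in> smoothed_arc s z" "w \<in> smoothed_arc s z'"
  shows "z = z'"
proof (rule ccontr)
  assume "z \<noteq> z'"
  then have "z' = - z" using assms by auto
  moreover have "partner s (- z) = - partner s z" using assms by (cases s) auto
  moreover have "0 < Re (w * cnj (z + partner s z))" "0 < Re (w * cnj (z' + partner s z'))"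
    using smoothed_arc_props(4) assms by blast+
  moreover have "cnj (- z + - partner s z) = - cnj (z + partner s z)" by simp
  ultimately show False by (metis minus_mult_right uminus_complex.sel(1) neg_0_less_iff_less less_asym)
qed

lemma smoothing_arcs_eq: "smoothing_arcs s = closed_segment 1 (partner s 1) \<union> closed_segment (-1) (partner s (-1))"
  by (cases s) auto

context diagram
begin

definition "resolved s = Y \<union> (\<Union>(x, z)\<in>C \<times> {1, -1}. \<psi> x ` smoothed_arc (s x) z)"

lemma cross_path_connected: "path_connected cross"
proof -
  have "0 \<in> cross \<and> (\<forall>w\<in>cross. closed_segment 0 w \<subseteq> cross)"
  proof (intro conjI ballI)
    fix w assume w: "w \<in> cross"
    have "closed_segment 0 w \<subseteq> ball 0 2" by (rule closed_segment_subset) (use w in \<open>auto simp: cross_def\<close>)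
    moreover have "Im y = 0 \<or> Re y = 0" if "y \<in> closed_segment 0 w" for y
      using that w by (auto simp: cross_def in_segment)
    ultimately show "closed_segment 0 w \<subseteq> cross" unfolding cross_def by blast
  qed (simp add: cross_def)
  then have "starlike cross" unfolding starlike_def by blast
  then show ?thesis by (rule starlike_imp_path_connected)
qed

lemma cross_sub: "cross \<subseteq> ball 0 2" by (auto simp: cross_def)

lemma D_U: assumes "x \<in> C" shows "\<psi> x ` cross = D \<inter> U x"
  unfolding coordinates.image_eq[OF co[OF assms] cross_sub] using D_iff[OF assms] by blast

text \<open>\<open>state\<close> adds only the chords to \<open>Y\<close>, and the rays added in
  \<open>resolved\<close> already belong to \<open>Y\<close>.\<close>

lemma state_eq: "state L \<Phi> s = resolved s"
proof -
  have "{y \<in> fst (\<Phi> x). snd (\<Phi> x) y \<in> ball 0 1} = \<psi> x ` ball 0 1" if "x \<in> C" for x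
    unfolding U_def[symmetric] \<phi>_def[symmetric] using disc_iff[OF that] by auto
  then have 1: "projection L - (\<Union>x\<in>crossings L. {y \<in> fst (\<Phi> x). snd (\<Phi> x) y \<in> ball 0 1}) = Y"
    by (simp add: Y_def D_def C_def)
  have "{y \<in> fst (\<Phi> x). snd (\<Phi> x) y \<in> smoothing_arcs (s x)} = \<psi> x ` smoothing_arcs (s x)" if x: "x \<in> C" for x
  proof -
    have "closed_segment z (partner (s x) z) \<subseteq> ball 0 2" if "z \<in> {1, -1}" for z
      using smoothed_arc_props(1)[OF that, of "s x"] by (auto simp: smoothed_arc_def)
    then have "smoothing_arcs (s x) \<subseteq> ball 0 2" unfolding smoothing_arcs_eq by blast
    then show ?thesis unfolding U_def[symmetric] \<phi>_def[symmetric] using coordinates.image_eq[OF co[OF x]] by blast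
  qed
  then have 2: "(\<Union>x\<in>crossings L. {y \<in> fst (\<Phi> x). snd (\<Phi> x) y \<in> smoothing_arcs (s x)}) = (\<Union>x\<in>C. \<psi> x ` smoothing_arcs (s x))"
    unfolding C_def by (intro SUP_cong) (auto simp: C_def)
  have 3: "\<psi> x ` ray z \<subseteq> Y" if "x \<in> C" "z \<in> {1, -1}" for x z using ray_props(2)[OF that(1), of z] that(2) by (auto simp: unit_dirs_def)
  have 4: "\<psi> x ` ray (partner (s x) z) \<subseteq> Y" if "x \<in> C" "z \<in> {1, -1}" for x z
    using ray_props(2)[OF that(1), of "partner (s x) z"] partner_in_unit_dirs[of z "s x"] that(2) by (auto simp: unit_dirs_def)
  have "Y \<union> (\<Union>x\<in>C. \<psi> x ` smoothing_arcs (s x)) = resolved s"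
  proof (intro equalityI subsetI)
    fix y assume "y \<in> Y \<union> (\<Union>x\<in>C. \<psi> x ` smoothing_arcs (s x))"
    then consider "y \<in> Y" | x z where "x \<in> C" "z \<in> {1, -1}" "y \<in> \<psi> x ` closed_segment z (partner (s x) z)"
      unfolding smoothing_arcs_eq by blast
    then show "y \<in> resolved s"
    proof cases
      case 2
      then have "y \<in> \<psi> x ` smoothed_arc (s x) z" unfolding smoothed_arc_def by blast
      then show ?thesis unfolding resolved_def using 2 by blast
    qed (simp add: resolved_def)
  next
    fix y assume "y \<in> resolved s"
    then consider "y \<in> Y" | x z where "x \<in> C" "z \<in> {1, -1}" "y \<in> \<psi> x ` smoothed_arc (s x) z"
      unfolding resolved_def by blast
    then show "y \<in> Y \<union> (\<Union>x\<in>C. \<psi> x ` smoothing_arcs (s x))"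
    proof cases
      case 2
      then have "y \<in> Y \<or> y \<in> \<psi> x ` closed_segment z (partner (s x) z)"
        using 3 4 unfolding smoothed_arc_def by blast
      then show ?thesis using 2 unfolding smoothing_arcs_eq by blast
    qed simp
  qed
  then show ?thesis unfolding state_def 1 2 .
qed

lemma agree_on_ray:
  assumes x: "x \<in> C" and z: "z \<in> unit_dirs"
    and w: "potential_on X Y F w" and v: "potential_on X N F v" "\<psi> x ` ray z \<subseteq> N"
    and eq: "w (pt (x, z)) = v (pt (x, z))" and y: "y \<in> \<psi> x ` ray z"
  shows "w y = v y"
proof -
  have "w y + v y = w (pt (x, z)) + v (pt (x, z))"
    by (rule potentials_differ_by_const[OF potential_on_mono[OF w] potential_on_mono[OF v] _ y])
      (use ray_props[OF x z] in blast)+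
  then show ?thesis using eq by (simp add: bit_add_eq_0_iff)
qed

lemma near_Y:
  assumes y: "y \<in> Y" and not_P: "y \<notin> P" and T: "\<And>y. y \<in> T \<Longrightarrow> y \<in> D \<or> (\<exists>x\<in>C. y \<in> \<psi> x ` cball 0 1)"
  shows "\<exists>W. openin X W \<and> y \<in> W \<and> T \<inter> W \<subseteq> Y"
proof -
  let ?N = "topspace X - (\<Union>x\<in>C. \<psi> x ` cball 0 1)"
  have "T \<inter> ?N \<subseteq> Y" using T Y_minus_P(2) by blast
  moreover have "y \<in> ?N" using Y_minus_P(3) y not_P by blast
  ultimately show ?thesis using Y_minus_P(1) by blast
qed

lemma Y_ray:
  assumes "x \<in> C" "y \<in> U x" "y \<in> Y"
  obtains z where "z \<in> unit_dirs" "\<phi> x y \<in> ray z"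
  using Y_iff[OF assms(1,2)] assms(3) cross_ray by blast

lemma ray_sub_ball: "z \<in> unit_dirs \<Longrightarrow> ray z \<subseteq> ball 0 2"
  using ray_bounds by auto

text \<open>In a crossing chart \<open>Y\<close> consists of four rays, so agreement at their four
  ends gives agreement on the whole overlap.\<close>

lemma glue_diagram:
  assumes F: "cocycle_on X D F" and w: "potential_on X Y F w"
    and v: "\<And>x. x \<in> C \<Longrightarrow> potential_on X (D \<inter> U x) F (v x)"
    and eq: "\<And>x z. x \<in> C \<Longrightarrow> z \<in> unit_dirs \<Longrightarrow> w (pt (x, z)) = v x (pt (x, z))"
  obtains u where "\<And>y. y \<in> Y \<Longrightarrow> u y = w y" "\<And>x y. x \<in> C \<Longrightarrow> y \<in> D \<inter> U x \<Longrightarrow> u y = v x y" "kills_cycles X D F"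
proof (rule glue_potentials[OF F w, of C "\<lambda>x. D \<inter> U x" v])
  fix x y assume xy: "x \<in> C" "y \<in> Y" "y \<in> D \<inter> U x"
  then obtain z where z: "z \<in> unit_dirs" "\<phi> x y \<in> ray z" using Y_ray by blast
  have "y \<in> \<psi> x ` ray z"
    using coordinates.image_eq[OF co[OF xy(1)] ray_sub_ball[OF z(1)]] xy z by blast
  moreover have "\<psi> x ` ray z \<subseteq> D \<inter> U x" using ray_props(2,3)[OF xy(1) z(1)] by (auto simp: Y_def)
  ultimately show "w y = v x y" using agree_on_ray[OF xy(1) z(1) w v[OF xy(1)]] eq[OF xy(1) z(1)] by blast
next
  fix y assume y: "y \<in> D"
  show "\<exists>W. openin X W \<and> y \<in> W \<and> (D \<inter> W \<subseteq> Y \<or> (\<exists>x\<in>C. D \<inter> W \<subseteq> D \<inter> U x))"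
  proof (cases "\<exists>x\<in>C. y \<in> U x")
    case True
    then obtain x where x: "x \<in> C" "y \<in> U x" by blast
    then show ?thesis using coordinates.UX[OF co[OF x(1)]] by blast
  next
    case False
    have yY: "y \<in> Y" using False y disc_iff by (auto simp: Y_def)
    have "y \<notin> P" using False pt_props(1) by (auto simp: P_def)
    then show ?thesis using near_Y[OF yY, of D] by blast
  qed
qed (use v U_disjoint that in blast)+

lemma resolved_near: "y \<in> resolved s \<Longrightarrow> y \<in> D \<or> (\<exists>x\<in>C. y \<in> \<psi> x ` cball 0 1)"
proof -
  assume "y \<in> resolved s"
  then consider "y \<in> Y" | x z where "x \<in> C" "z \<in> {1, -1}" "y \<in> \<psi> x ` smoothed_arc (s x) z"
    unfolding resolved_def by blast
  then show ?thesis
  proof cases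
    case 2
    have zk: "z \<in> unit_dirs" "partner (s x) z \<in> unit_dirs"
      using 2 partner_in_unit_dirs[of z "s x"] by (auto simp: unit_dirs_def)
    have "closed_segment z (partner (s x) z) \<subseteq> cball 0 1"
      by (rule closed_segment_subset) (use norm_unit_dirs[OF zk(1)] norm_unit_dirs[OF zk(2)] in auto)
    then have "y \<in> Y \<or> y \<in> \<psi> x ` cball 0 1"
      using 2 ray_props(2)[OF 2(1) zk(1)] ray_props(2)[OF 2(1) zk(2)] unfolding smoothed_arc_def by blast
    then show ?thesis using 2 by (auto simp: Y_def)
  qed (simp add: Y_def)
qed

lemma arc_in_chart:
  assumes "x \<in> C" "z \<in> {1, -1}"
  shows "y \<in> \<psi> x ` smoothed_arc s z \<longleftrightarrow> y \<in> U x \<and> \<phi> x y \<in> smoothed_arc s z"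
  using coordinates.image_eq[OF co[OF assms(1)] smoothed_arc_props(1)[OF assms(2)]] by blast

text \<open>The half-plane around \<open>z + partner (s x) z\<close> contains the arc. At this
  crossing the other arc and the other two rays lie on the opposite side, and other crossings have
  disjoint charts.\<close>

lemma arc_open_in_resolved:
  assumes x: "x \<in> C" and z: "z \<in> {1, -1}"
  shows "\<exists>W. openin X W \<and> \<psi> x ` smoothed_arc (s x) z \<subseteq> W \<and> resolved s \<inter> W \<subseteq> \<psi> x ` smoothed_arc (s x) z"
proof -
  define k where "k = partner (s x) z"
  let ?H = "ball 0 2 \<inter> {w. 0 < Re (w * cnj (z + k))}"
  have Hs: "?H \<subseteq> ball 0 2" by blast
  have "open ?H" by (intro open_Int open_ball open_Collect_less continuous_intros)
  then have 1: "openin X (\<psi> x ` ?H)" by (rule coordinates.image_open[OF co[OF x] Hs])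
  have 2: "\<psi> x ` smoothed_arc (s x) z \<subseteq> \<psi> x ` ?H"
    using smoothed_arc_props(1,4)[OF z, of "s x"] unfolding k_def by (intro image_mono) blast
  have 3: "y \<in> \<psi> x ` smoothed_arc (s x) z" if y: "y \<in> resolved s" "y \<in> \<psi> x ` ?H" for y
  proof -
    have yU: "y \<in> U x" and yH: "0 < Re (\<phi> x y * cnj (z + k))"
      using y(2) unfolding coordinates.image_eq[OF co[OF x] Hs] by auto
    have flip: "z' = z" if z': "z' \<in> {1, -1}" "0 < Re (\<phi> x y * cnj (z' + partner (s x) z'))" for z'
    proof (rule ccontr)
      assume "z' \<noteq> z"
      then have "z' = - z" using z z' by auto
      moreover have "partner (s x) (- z) = - partner (s x) z" using z by (cases "s x") auto
      ultimately have "cnj (z' + partner (s x) z') = - cnj (z + k)" by (simp add: k_def)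
      then show False using z'(2) yH by (metis minus_mult_right uminus_complex.sel(1) neg_0_less_iff_less less_asym)
    qed
    consider "y \<in> Y" | x' z' where "x' \<in> C" "z' \<in> {1, -1}" "y \<in> \<psi> x' ` smoothed_arc (s x') z'"
      using y(1) unfolding resolved_def by blast
    then show ?thesis
    proof cases
      case 1
      obtain r where r: "r \<in> unit_dirs" "\<phi> x y \<in> ray r" using Y_ray[OF x yU 1] by blast
      obtain t :: real where t: "\<phi> x y = of_real t * r" "1 \<le> t" using r(2) unfolding ray_def by force
      have "0 < t * Re (r * cnj (z + k))" using yH by (simp add: t algebra_simps)
      then have "0 < Re (r * cnj (z + k))" using t(2) by (simp add: zero_less_mult_iff)
      then have "r = z \<or> r = k" using z r(1) by (cases "s x") (auto simp: unit_dirs_def k_def)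
      then have "\<phi> x y \<in> smoothed_arc (s x) z" using r(2) by (auto simp: smoothed_arc_def k_def)
      then show ?thesis using arc_in_chart[OF x z] yU by blast
    next
      case 2
      have *: "y \<in> U x'" "\<phi> x' y \<in> smoothed_arc (s x') z'" using 2 arc_in_chart by blast+
      then have "x' = x" using U_disjoint[OF 2(1) x _ yU] by blast
      moreover from this have "z' = z" using flip[OF 2(2)] smoothed_arc_props(4)[OF 2(2), of "s x"] * by blast
      ultimately show ?thesis using 2 by simp
    qed
  qed
  show ?thesis by (rule exI[of _ "\<psi> x ` ?H"]) (use 1 2 3 in blast)
qed

lemma glue_resolved:
  assumes F: "cocycle_on X (resolved s) F" and w: "potential_on X Y F w"
    and v: "\<And>x z. x \<in> C \<Longrightarrow> z \<in> {1, -1} \<Longrightarrow> potential_on X (\<psi> x ` smoothed_arc (s x) z) F (v x z)"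
    and eq: "\<And>x z. x \<in> C \<Longrightarrow> z \<in> {1, -1} \<Longrightarrow> w (pt (x, z)) = v x z (pt (x, z))"
      "\<And>x z. x \<in> C \<Longrightarrow> z \<in> {1, -1} \<Longrightarrow> w (pt (x, partner (s x) z)) = v x z (pt (x, partner (s x) z))"
  shows "kills_cycles X (resolved s) F"
proof (rule glue_potentials[OF F w, of "C \<times> {1, -1}" "\<lambda>i. \<psi> (fst i) ` smoothed_arc (s (fst i)) (snd i)" "\<lambda>i. v (fst i) (snd i)"])
  fix i y assume i: "i \<in> C \<times> {1, -1}" and y: "y \<in> Y" "y \<in> \<psi> (fst i) ` smoothed_arc (s (fst i)) (snd i)"
  obtain x z where xz: "i = (x, z)" "x \<in> C" "z \<in> {1, -1}" using i by auto
  have ya: "y \<in> U x" "\<phi> x y \<in> smoothed_arc (s x) z" using y(2) arc_in_chart[OF xz(2,3)] xz by auto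
  obtain r where r: "r \<in> unit_dirs" "\<phi> x y \<in> ray r" using Y_ray[OF xz(2) ya(1) y(1)] by blast
  have rr: "r = z \<or> r = partner (s x) z" using ray_in_smoothed_arc[OF xz(3) r ya(2)] .
  have "y \<in> \<psi> x ` ray r"
    using coordinates.image_eq[OF co[OF xz(2)] ray_sub_ball[OF r(1)]] ya r by blast
  moreover have "\<psi> x ` ray r \<subseteq> \<psi> x ` smoothed_arc (s x) z" using rr by (intro image_mono) (auto simp: smoothed_arc_def)
  moreover have "w (pt (x, r)) = v x z (pt (x, r))" using rr eq[OF xz(2,3)] by blast
  ultimately show "w y = v (fst i) (snd i) y"
    using agree_on_ray[OF xz(2) r(1) w v[OF xz(2,3)]] by (simp add: xz(1))
next
  fix i j y assume ij: "i \<in> C \<times> {1, -1}" "j \<in> C \<times> {1, -1}" and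
    y: "y \<in> \<psi> (fst i) ` smoothed_arc (s (fst i)) (snd i)" "y \<in> \<psi> (fst j) ` smoothed_arc (s (fst j)) (snd j)"
  obtain x z x' z' where xz: "i = (x, z)" "x \<in> C" "z \<in> {1, -1}" "j = (x', z')" "x' \<in> C" "z' \<in> {1, -1}"
    using ij by auto
  have *: "y \<in> U x" "\<phi> x y \<in> smoothed_arc (s x) z" "y \<in> U x'" "\<phi> x' y \<in> smoothed_arc (s x') z'"
    using y arc_in_chart[OF xz(2,3)] arc_in_chart[OF xz(5,6)] xz by auto
  then have xx: "x = x'" using U_disjoint xz by blast
  have "z = z'" by (rule smoothed_arcs_disjoint[OF xz(3,6) *(2)]) (use *(4) xx in simp)
  then show "i = j" using xz xx by simp
next
  fix y assume y: "y \<in> resolved s"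
  show "\<exists>W. openin X W \<and> y \<in> W \<and> (resolved s \<inter> W \<subseteq> Y \<or> (\<exists>i\<in>C \<times> {1, -1}. resolved s \<inter> W \<subseteq> \<psi> (fst i) ` smoothed_arc (s (fst i)) (snd i)))"
  proof (cases "\<exists>x\<in>C. \<exists>z\<in>{1, -1}. y \<in> \<psi> x ` smoothed_arc (s x) z")
    case True
    then obtain x z where xz: "x \<in> C" "z \<in> {1, -1}" "y \<in> \<psi> x ` smoothed_arc (s x) z" by blast
    obtain W where W: "openin X W" "\<psi> x ` smoothed_arc (s x) z \<subseteq> W" "resolved s \<inter> W \<subseteq> \<psi> x ` smoothed_arc (s x) z"
      using arc_open_in_resolved[OF xz(1,2), of s] by blast
    then have "y \<in> W \<and> (\<exists>i\<in>C \<times> {1, -1}. resolved s \<inter> W \<subseteq> \<psi> (fst i) ` smoothed_arc (s (fst i)) (snd i))"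
      using xz by (intro conjI bexI[of _ "(x, z)"]) auto
    then show ?thesis using W(1) by blast
  next
    case False
    then have yY: "y \<in> Y" using y unfolding resolved_def by blast
    have "y \<notin> P"
    proof
      assume "y \<in> P"
      then obtain x r where r: "x \<in> C" "r \<in> unit_dirs" "y = pt (x, r)" by (auto simp: P_def)
      have "\<exists>z\<in>{1, -1}. r = z \<or> r = partner (s x) z" using r(2) by (cases "s x") (auto simp: unit_dirs_def)
      then obtain z where z: "z \<in> {1, -1}" "r = z \<or> r = partner (s x) z" by blast
      have "y \<in> \<psi> x ` smoothed_arc (s x) z"
        using ray_props(4)[OF r(1,2)] z(2) unfolding r(3) smoothed_arc_def by blast
      then show False using False r(1) z(1) by blast
    qed
    have "\<exists>W. openin X W \<and> y \<in> W \<and> resolved s \<inter> W \<subseteq> Y"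
      by (rule near_Y[OF yY \<open>y \<notin> P\<close>]) (rule resolved_near)
    then obtain W where "openin X W" "y \<in> W" "resolved s \<inter> W \<subseteq> Y"
      by (elim exE conjE) (rule that)
    then show ?thesis by (intro exI[of _ W]) simp
  qed
qed (use v in auto)

end


section \<open>Counting cycles and homology classes of states\<close>

text \<open>The number \<open>m\<close> of cocycles will be 0 for the count of cycles and
  \<open>2 * g\<close> for the nullities. \<open>w\<close> and \<open>v\<close> are the reference
  potentials on the edges and on the crossing charts.\<close>

locale cocycle_diagram = diagram X \<A> L \<Phi>
  for X :: "'a topology" and \<A> :: "'a chart set" and L :: "('a \<times> real) set" and \<Phi> :: "'a \<Rightarrow> 'a chart" +
  fixes m :: nat and c :: "nat \<Rightarrow> 'a chain \<Rightarrow> bit" and w :: "nat \<Rightarrow> 'a \<Rightarrow> bit" and v :: "nat \<Rightarrow> 'a \<Rightarrow> 'a \<Rightarrow> bit"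
  assumes C_nonempty: "C \<noteq> {}"
    and c: "\<And>i. i < m \<Longrightarrow> cocycle_on X UNIV (c i)"
    and w: "\<And>i. i < m \<Longrightarrow> potential_on X Y (c i) (w i)"
    and v: "\<And>i x. i < m \<Longrightarrow> x \<in> C \<Longrightarrow> potential_on X (U x) (c i) (v i x)"
    and indep: "\<And>B. B \<in> bit_funs {..<m} \<Longrightarrow> kills_cycles X D (\<lambda>z. \<Sum>i<m. B i * c i z) \<Longrightarrow> B = 0"
begin

definition "cB B z = (\<Sum>i<m. B i * c i z)"
definition "wB B y = (\<Sum>i<m. B i * w i y)"
definition "vB B x y = (\<Sum>i<m. B i * v i x y)"
definition "\<mu> B p = wB B (pt p) + vB B (fst p) (pt p)"

lemma potential_cB:
  assumes "\<And>i. i < m \<Longrightarrow> potential_on X N (c i) (p i)"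
  shows "potential_on X N (cB B) (\<lambda>y. \<Sum>i<m. B i * p i y)"
  unfolding potential_on_def
proof (intro allI impI)
  fix f assume f: "singular_simplex 1 (subtopology X N) f"
  have "cB B (frag_of f) = (\<Sum>i<m. B i * p i (f vert0) + B i * p i (f vert1))"
    unfolding cB_def
  proof (rule sum.cong[OF refl])
    fix i assume "i \<in> {..<m}"
    then have "c i (frag_of f) = p i (f vert0) + p i (f vert1)" using assms f by (simp add: potential_on_def)
    then show "B i * c i (frag_of f) = B i * p i (f vert0) + B i * p i (f vert1)" by (simp only: distrib_left)
  qed
  then show "cB B (frag_of f) = (\<Sum>i<m. B i * p i (f vert0)) + (\<Sum>i<m. B i * p i (f vert1))"
    by (simp only: sum.distrib)
qed

lemma wB: "potential_on X Y (cB B) (wB B)"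
  unfolding wB_def[abs_def] by (rule potential_cB[OF w])

lemma vB: "x \<in> C \<Longrightarrow> potential_on X (U x) (cB B) (vB B x)"
  unfolding vB_def[abs_def] by (rule potential_cB[OF v])

lemma cocycle_cB: "cocycle_on X UNIV (cB B)"
proof -
  have add: "c i (a + b) = c i a + c i b" if "i < m" for i a b
    using c[OF that] by (simp add: cocycle_on_def additive_map_def)
  have "cB B (a + b) = cB B a + cB B b" for a b
    unfolding cB_def sum.distrib[symmetric] by (rule sum.cong) (simp_all add: add distrib_left)
  moreover have "cB B (chain_boundary 2 e) = 0" if "singular_chain 2 (subtopology X UNIV) e" for e
    unfolding cB_def by (rule sum.neutral) (use c that in \<open>auto simp: cocycle_on_def\<close>)
  ultimately show ?thesis by (auto simp: cocycle_on_def additive_map_def)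
qed

lemma \<mu>_minus: "\<mu> (B - B') p = \<mu> B p + \<mu> B' p"
proof -
  have "(B - B') i * q i = B i * q i + B' i * q i" for i and q :: "nat \<Rightarrow> bit"
    by (simp only: minus_apply minus_bit_def distrib_right)
  then have ss: "(\<Sum>i<m. (B - B') i * q i) = (\<Sum>i<m. B i * q i) + (\<Sum>i<m. B' i * q i)" for q :: "nat \<Rightarrow> bit"
    by (simp only: sum.distrib)
  show ?thesis unfolding \<mu>_def wB_def vB_def ss by (simp only: ac_simps)
qed

sublocale LG: labelled_graph C ed "bit_funs {..<m}" \<mu>
proof
  show "card {p \<in> C \<times> unit_dirs. ed p = e} = 2" if "e \<in> ed ` (C \<times> unit_dirs)" for e
    by (rule two_ends[OF C_nonempty that])
qed (use finC C_nonempty finite_bit_funs add_subgroup_bit_funs \<mu>_minus in auto)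

definition "component y = connected_component_of_set (subtopology X Y) y"

lemma ed_component_eq: "ed p = component (pt p)"
  by (simp add: ed_def component_def)

text \<open>A function constant on the components of \<open>Y\<close> has zero coboundary. Labels of
  edges act on potentials in this way.\<close>

lemma potential_add_component:
  assumes "potential_on X Y F u"
  shows "potential_on X Y F (\<lambda>y. u y + a (component y))"
  unfolding potential_on_def
proof (intro allI impI)
  fix f assume f: "singular_simplex 1 (subtopology X Y) f"
  then have "path_component_of (subtopology X Y) (f vert0) (f vert1)"
    unfolding path_component_of_iff_simplex by auto
  then have "connected_component_of (subtopology X Y) (f vert0) (f vert1)"
    using path_component_subset_connected_component_of by fastforce
  then have "component (f vert0) = component (f vert1)"
    unfolding component_def by (simp add: connected_component_of_equiv)
  then show "F (frag_of f) = (u (f vert0) + a (component (f vert0))) + (u (f vert1) + a (component (f vert1)))"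
    using assms f by (simp add: potential_on_def bit_add_shift)
qed

lemma component_closed:
  assumes "e \<in> ed ` (C \<times> unit_dirs)"
  shows "closedin X e"
proof -
  have "e \<in> connected_components_of (subtopology X Y)" using assms ed_component(1) by blast
  then show ?thesis using closedin_connected_components_of Y_closed closedin_closed_subtopology by blast
qed

text \<open>Invariance along both smoothings makes the jump at a crossing the same in all four
  directions, so a constant shift of \<open>vB B x\<close> lets the potential pass through the
  crossing. It then lives on all of \<open>D\<close>, which forces \<open>B = 0\<close> by
  \<open>indep\<close>; what remains is a locally constant function on a connected set.\<close>

lemma common_labelling_const:
  assumes "(B, a) \<in> labellings C ed (bit_funs {..<m}) \<mu> s"
    "(B, a) \<in> labellings C ed (bit_funs {..<m}) \<mu> (opposite_smoothing \<circ> s)"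
  shows "B = 0 \<and> (\<exists>t. \<forall>e\<in>LG.E. a e = t)"
proof -
  define f where "f p = \<mu> B p + a (ed p)" for p
  have B: "B \<in> bit_funs {..<m}" and inv: "invariant_along C s f" "invariant_along C (opposite_smoothing \<circ> s) f"
    using assms by (auto simp: labellings_def f_def[abs_def])
  have f1: "f (x, z) = f (x, 1)" if "x \<in> C" "z \<in> unit_dirs" for x z
    by (rule invariant_along_opposite[OF inv that])
  obtain u where u: "\<And>y. y \<in> Y \<Longrightarrow> u y = wB B y + a (component y)"
    "\<And>x y. x \<in> C \<Longrightarrow> y \<in> D \<inter> U x \<Longrightarrow> u y = vB B x y + f (x, 1)" "kills_cycles X D (cB B)"
  proof (rule glue_diagram[OF cocycle_on_mono[OF cocycle_cB] potential_add_component[OF wB], where v = "\<lambda>x y. vB B x y + f (x, 1)"])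
    show "potential_on X (D \<inter> U x) (cB B) (\<lambda>y. vB B x y + f (x, 1))" if "x \<in> C" for x
      by (rule potential_on_mono[OF potential_on_add_const[OF vB[OF that]]]) blast
    fix x z assume xz: "x \<in> C" "z \<in> unit_dirs"
    have bits: "p + r = q + ((p + q) + r)" for p q r :: bit by (cases p; cases q; cases r) auto
    have "f (x, 1) = f (x, z)" by (rule f1[OF xz, symmetric])
    also have "f (x, z) = (wB B (pt (x, z)) + vB B x (pt (x, z))) + a (component (pt (x, z)))"
      by (simp only: f_def \<mu>_def fst_conv ed_component_eq)
    finally have fx: "f (x, 1) = (wB B (pt (x, z)) + vB B x (pt (x, z))) + a (component (pt (x, z)))" .
    show "wB B (pt (x, z)) + a (component (pt (x, z))) = vB B x (pt (x, z)) + f (x, 1)"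
      unfolding fx by (rule bits)
  qed auto
  have B0: "B = 0" by (rule indep[OF B]) (use u(3) in \<open>simp add: cB_def[abs_def]\<close>)
  have u1: "u y = a (component y)" if "y \<in> Y" for y using u(1)[OF that] B0 by (simp add: wB_def)
  have u2: "u y = f (x, 1)" if "x \<in> C" "y \<in> D \<inter> U x" for x y using u(2)[OF that] B0 by (simp add: vB_def)
  have u_const: "u y = u y'" if "y \<in> D" "y' \<in> D" for y y'
  proof (rule locally_constant_on_connected[OF _ _ that])
    show "connectedin X D" using conn by (simp add: connected_diagram_def D_def)
    fix y assume y: "y \<in> D"
    show "\<exists>W. openin X W \<and> y \<in> W \<and> (\<forall>z\<in>D \<inter> W. u z = u y)"
    proof (cases "\<exists>x\<in>C. y \<in> U x")
      case True
      then obtain x where x: "x \<in> C" "y \<in> U x" by blast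
      then show ?thesis using coordinates.UX[OF co[OF x(1)]] u2[OF x(1)] y by (intro exI[of _ "U x"]) auto
    next
      case False
      have yY: "y \<in> Y" using False y disc_iff by (auto simp: Y_def)
      have "y \<notin> P" using False pt_props(1) by (auto simp: P_def)
      then have "\<exists>W. openin X W \<and> y \<in> W \<and> D \<inter> W \<subseteq> Y" by (intro near_Y[OF yY]) auto
      then obtain W where W: "openin X W" "y \<in> W" "D \<inter> W \<subseteq> Y" by blast
      \<comment> \<open>The other edges are finitely many closed sets; away from them only the edge
        of \<open>y\<close> is seen.\<close>
      define E' where "E' = ed ` (C \<times> unit_dirs) - {component y}"
      have comp: "component y' \<in> ed ` (C \<times> unit_dirs) \<and> y' \<in> component y'" if "y' \<in> Y" for y'
      proof -
        have "y' \<in> topspace (subtopology X Y)" using that YX by auto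
        then show ?thesis unfolding components_eq[OF C_nonempty, symmetric] component_def
          by (auto simp: connected_components_of_def connected_component_of_refl)
      qed
      have "closedin X (\<Union>E')" unfolding E'_def using finC component_closed by (intro closedin_Union) auto
      then have 1: "openin X (W - \<Union>E')" using W by blast
      have disj: "e \<inter> e' = {}" if "e \<in> ed ` (C \<times> unit_dirs)" "e' \<in> ed ` (C \<times> unit_dirs)" "e \<noteq> e'" for e e'
        using that connected_components_of_overlap[of e "subtopology X Y" e'] unfolding components_eq[OF C_nonempty] by blast
      have 2: "y \<in> W - \<Union>E'" using W(2) comp[OF yY] disj[of "component y"] unfolding E'_def by blast
      have "u z = u y" if z: "z \<in> D \<inter> (W - \<Union>E')" for z
      proof -
        have zY: "z \<in> Y" using W(3) z by blast
        then have "component z = component y" using comp[OF zY] z unfolding E'_def by blast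
        then show ?thesis using u1[OF zY] u1[OF yY] by simp
      qed
      then show ?thesis using 1 2 by blast
    qed
  qed
  have "a (ed p) = u (pt p)" if "p \<in> C \<times> unit_dirs" for p
    using u1[of "pt p"] pt_props(3) that by (cases p) (auto simp: ed_component_eq)
  moreover have "pt p \<in> D" if "p \<in> C \<times> unit_dirs" for p
    using pt_props(3) that by (cases p) (auto simp: Y_def)
  moreover obtain p0 where "p0 \<in> C \<times> unit_dirs" using C_nonempty by (auto simp: unit_dirs_def)
  ultimately have "\<forall>e\<in>LG.E. a e = u (pt p0)" unfolding LG.E_def using u_const by auto
  then show ?thesis using B0 by blast
qed

lemma labellings_product_le:
  "card (labellings C ed (bit_funs {..<m}) \<mu> s) * card (labellings C ed (bit_funs {..<m}) \<mu> (opposite_smoothing \<circ> s))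
    \<le> 2 ^ m * 2 ^ (card C + 2)"
proof -
  have "card (bit_funs {..<m}) = (2::nat) ^ m" by (simp add: card_bit_funs)
  then show ?thesis using LG.labellings_product[of s] common_labelling_const by metis
qed

lemma arc_connected:
  assumes "x \<in> C" "z \<in> {1, -1}"
  shows "connectedin X (\<psi> x ` smoothed_arc s z)"
  by (rule path_connectedin_imp_connectedin,
      rule coordinates.image_path_connected[OF co[OF assms(1)] smoothed_arc_props(1,3)[OF assms(2)]])

lemma arc_sub: "x \<in> C \<Longrightarrow> z \<in> {1, -1} \<Longrightarrow> \<psi> x ` smoothed_arc (s x) z \<subseteq> resolved s"
  unfolding resolved_def by blast

lemma resolved_sub: "resolved s \<subseteq> topspace X"
proof -
  have "\<psi> x ` smoothed_arc (s x) z \<subseteq> topspace X" if "x \<in> C" "z \<in> {1, -1}" for x z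
    using arc_connected[OF that] connectedin_subset_topspace by blast
  then show ?thesis unfolding resolved_def using YX by blast
qed

lemma pt_in_arc:
  assumes "x \<in> C" "z \<in> {1, -1}"
  shows "pt (x, z) \<in> \<psi> x ` smoothed_arc (s x) z" "pt (x, partner (s x) z) \<in> \<psi> x ` smoothed_arc (s x) z"
proof -
  have "z \<in> unit_dirs" "partner (s x) z \<in> unit_dirs"
    using assms(2) partner_in_unit_dirs[of z] by (auto simp: unit_dirs_def)
  then have "pt (x, z) \<in> \<psi> x ` ray z" "pt (x, partner (s x) z) \<in> \<psi> x ` ray (partner (s x) z)"
    using ray_props(4)[OF assms(1)] by blast+
  then show "pt (x, z) \<in> \<psi> x ` smoothed_arc (s x) z" "pt (x, partner (s x) z) \<in> \<psi> x ` smoothed_arc (s x) z"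
    unfolding smoothed_arc_def by blast+
qed

text \<open>With \<open>B = 0\<close>, a function on the cycles labels each edge by the value on the
  cycle through it. This is injective because every cycle meets \<open>Y\<close>.\<close>

lemma state_cycles_count:
  "2 ^ card (state_cycles X (resolved s)) \<le> card (labellings C ed (bit_funs {..<m}) \<mu> s)"
proof -
  let ?S = "subtopology X (resolved s)"
  let ?E = "ed ` (C \<times> unit_dirs)"
  define q where "q e = connected_component_of_set ?S (SOME y. y \<in> e)" for e
  have topS: "topspace ?S = resolved s" using resolved_sub by auto
  have cc: "connected_component_of_set ?S a = connected_component_of_set ?S b"
    if "connectedin X T" "T \<subseteq> resolved s" "a \<in> T" "b \<in> T" for a b T
  proof -
    have "connectedin ?S T" using that by (simp add: connectedin_subtopology)
    then have "T \<subseteq> connected_component_of_set ?S a" using that(3) by (rule connected_component_of_maximal)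
    then have "connected_component_of ?S a b" using that(4) by blast
    then show ?thesis by (simp add: connected_component_of_equiv)
  qed
  have YS: "Y \<subseteq> resolved s" by (auto simp: resolved_def)
  have q: "connected_component_of_set ?S y = q e" if e: "e \<in> ?E" and y: "y \<in> e" for e y
  proof -
    have "connectedin X e" "e \<subseteq> resolved s"
      using path_connected_edge[OF C_nonempty e] path_connectedin_imp_connectedin YS by blast+
    then show ?thesis unfolding q_def by (rule cc) (use y someI[of "\<lambda>y. y \<in> e"] in blast)+
  qed
  have qE: "state_cycles X (resolved s) \<subseteq> q ` ?E"
  proof
    fix K assume "K \<in> state_cycles X (resolved s)"
    then obtain y where y: "y \<in> resolved s" "K = connected_component_of_set ?S y"
      unfolding state_cycles_def connected_components_of_def topS by blast
    have Yc: "connected_component_of_set ?S y' \<in> q ` ?E" if "y' \<in> Y" for y'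
    proof -
      have "y' \<in> topspace (subtopology X Y)" using that YX by auto
      then obtain e where "e \<in> connected_components_of (subtopology X Y)" "y' \<in> e"
        using Union_connected_components_of[of "subtopology X Y"] by blast
      then show ?thesis using q unfolding components_eq[OF C_nonempty] by blast
    qed
    consider "y \<in> Y" | x z where "x \<in> C" "z \<in> {1, -1}" "y \<in> \<psi> x ` smoothed_arc (s x) z"
      using y(1) unfolding resolved_def by blast
    then show "K \<in> q ` ?E"
    proof cases
      case 1
      then show ?thesis using Yc y(2) by simp
    next
      case 2
      have "connected_component_of_set ?S y = connected_component_of_set ?S (pt (x, z))"
        by (rule cc[OF arc_connected[OF 2(1,2), of "s x"] arc_sub[OF 2(1,2), of s] 2(3) pt_in_arc(1)[OF 2(1,2), of s]])
      moreover have "pt (x, z) \<in> Y" using pt_props(3)[OF 2(1), of z] 2(2) by (auto simp: unit_dirs_def)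
      ultimately show ?thesis using Yc y(2) by simp
    qed
  qed
  have finE: "finite ?E" using finC by simp
  then have fin: "finite (state_cycles X (resolved s))" using qE finite_subset by blast
  have q_in: "q e \<in> state_cycles X (resolved s)" if e: "e \<in> ?E" for e
  proof -
    obtain p where p: "p \<in> C \<times> unit_dirs" "e = ed p" using e by blast
    have "pt p \<in> e" using ed_component(2) p by blast
    moreover have "pt p \<in> resolved s" using pt_props(3) p YS by (cases p) auto
    ultimately show ?thesis using q[OF e, of "pt p"] unfolding state_cycles_def connected_components_of_def topS by auto
  qed
  define lab where "lab f = (0 :: nat \<Rightarrow> bit, \<lambda>e. if e \<in> ?E then f (q e) else (0::bit))" for f
  have \<mu>0: "\<mu> 0 p = 0" for p by (simp add: \<mu>_def wB_def vB_def)
  have "card (bit_funs (state_cycles X (resolved s))) \<le> card (labellings C ed (bit_funs {..<m}) \<mu> s)"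
  proof (rule card_inj_on_le[where f = lab])
    show "finite (labellings C ed (bit_funs {..<m}) \<mu> s)" by (rule LG.labellings_subgroup(2))
    show "inj_on lab (bit_funs (state_cycles X (resolved s)))"
    proof (rule inj_onI, rule ext)
      fix f f' K assume f: "f \<in> bit_funs (state_cycles X (resolved s))" "f' \<in> bit_funs (state_cycles X (resolved s))"
        and eq: "lab f = lab f'"
      show "f K = f' K"
      proof (cases "K \<in> state_cycles X (resolved s)")
        case True
        then obtain e where e: "e \<in> ?E" "K = q e" using qE by blast
        have "snd (lab f) e = snd (lab f') e" using eq by simp
        then show ?thesis using e(1) unfolding lab_def e(2) by simp
      qed (use f in \<open>simp add: bit_funs_def\<close>)
    qed
    show "lab ` bit_funs (state_cycles X (resolved s)) \<subseteq> labellings C ed (bit_funs {..<m}) \<mu> s"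
    proof (rule image_subsetI)
      fix f :: "'a set \<Rightarrow> bit"
      have "(if ed (x, z) \<in> ?E then f (q (ed (x, z))) else 0) + (if ed (x, partner (s x) z) \<in> ?E then f (q (ed (x, partner (s x) z))) else 0) = 0"
        if xz: "x \<in> C" "z \<in> {1, -1}" for x z
      proof -
        have d: "(x, z) \<in> C \<times> unit_dirs" "(x, partner (s x) z) \<in> C \<times> unit_dirs"
          using xz partner_in_unit_dirs[of z] by (auto simp: unit_dirs_def)
        have "connected_component_of_set ?S (pt (x, z)) = connected_component_of_set ?S (pt (x, partner (s x) z))"
          by (rule cc[OF arc_connected[OF xz, of "s x"] arc_sub[OF xz, of s] pt_in_arc[OF xz, of s]])
        then have "q (ed (x, z)) = q (ed (x, partner (s x) z))"
          using q[OF imageI[OF d(1), of ed] ed_component(2)[OF d(1)]] q[OF imageI[OF d(2), of ed] ed_component(2)[OF d(2)]] by simp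
        then show ?thesis using d by simp
      qed
      then show "lab f \<in> labellings C ed (bit_funs {..<m}) \<mu> s"
        unfolding lab_def labellings_def mem_Collect_eq case_prod_conv invariant_along_iff \<mu>0
        by (auto simp: bit_funs_def)
    qed
  qed
  then show ?thesis using fin by (simp add: card_bit_funs)
qed

text \<open>For a family \<open>V\<close> of independent cycles of the state that bound in
  \<open>X\<close>, every function on \<open>V\<close> is realised by a cocycle of the state. If two
  such functions have the same mismatch modulo labels, the sum of their cocycles and some
  \<open>cB B\<close> kills the cycles of the state, in particular \<open>V\<close>. But
  \<open>cB B\<close> vanishes on \<open>V\<close> by itself, as \<open>V\<close> bounds in
  \<open>X\<close>, so the functions agree.\<close>

lemma nullity_count:
  "2 ^ homological_nullity X (resolved s) * 2 ^ m \<le> card (labellings C ed (bit_funs {..<m}) \<mu> s)"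
proof -
  let ?N = "card (labellings C ed (bit_funs {..<m}) \<mu> s)"
  let ?S = "subtopology X (resolved s)"
  have "2 ^ homological_nullity X (resolved s) \<le> ?N div 2 ^ m"
  proof (rule nullity_bound)
    fix V assume V: "finite V" "V \<subseteq> mod2_cycle_set 1 ?S \<inter> mod2_boundary_set 1 X"
      and ind: "\<And>J. J \<subseteq> V \<Longrightarrow> J \<noteq> {} \<Longrightarrow> \<Sum>J \<notin> mod2_boundary_set 1 ?S"
    have ind': "\<Sum>J \<notin> boundaries2 ?S" if "J \<subseteq> V" "J \<noteq> {}" for J
    proof -
      have "singular_chain 1 ?S (\<Sum>J)"
        using V(2) that(1) by (intro singular_chain_sum) (auto simp: mod2_cycle_set_def)
      then show ?thesis using ind[OF that] unfolding mod2_boundary_set_eq by blast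
    qed
    have ex: "\<exists>F w' v'. cocycle_on X (resolved s) F \<and> (\<forall>z\<in>V. F z = f z) \<and> potential_on X Y F w' \<and>
        (\<forall>x\<in>C. \<forall>z\<in>{1, -1}. potential_on X (\<psi> x ` smoothed_arc (s x) z) F (v' x z) \<and> v' x z (pt (x, z)) = w' (pt (x, z)))" for f
    proof -
      have "\<exists>F. additive_map F \<and> (\<forall>x\<in>boundaries2 ?S. F x = 0) \<and> (\<forall>z\<in>V. F z = f z)"
        using dual_functionals[OF add_subgroup_boundaries2 double_in_boundaries2 V(1), of "\<lambda>z. z"] ind' by simp
      then obtain F where F: "additive_map F" "\<forall>x\<in>boundaries2 ?S. F x = 0" "\<forall>z\<in>V. F z = f z"
        by (elim exE conjE) (rule that)
      have cF: "cocycle_on X (resolved s) F" using kills_boundaries2[OF F(1,2)] .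
      have "Y \<subseteq> resolved s" by (auto simp: resolved_def)
      then obtain w' where w': "potential_on X Y F w'"
        using potential_on_Y[OF C_nonempty cocycle_on_mono[OF cF]] by blast
      have "\<exists>v'. potential_on X (\<psi> x ` smoothed_arc (s x) z) F v' \<and> v' (pt (x, z)) = w' (pt (x, z))"
        if xz: "x \<in> C" "z \<in> {1, -1}" for x z
      proof -
        obtain v0 where v0: "potential_on X (\<psi> x ` smoothed_arc (s x) z) F v0"
          using potential_exists_contractible[OF cocycle_on_mono[OF cF arc_sub[OF xz]]
            coordinates.image_contractible[OF co[OF xz(1)] smoothed_arc_props(1,2)[OF xz(2)]]] by blast
        have "v0 (pt (x, z)) + (v0 (pt (x, z)) + w' (pt (x, z))) = w' (pt (x, z))"
          by (simp only: add.assoc[symmetric] bit_add_self add_0_left)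
        then show ?thesis using potential_on_add_const[OF v0] by blast
      qed
      then have "\<forall>p. \<exists>v'. p \<in> C \<times> {1, -1} \<longrightarrow> potential_on X (\<psi> (fst p) ` smoothed_arc (s (fst p)) (snd p)) F v' \<and>
          v' (pt (fst p, snd p)) = w' (pt (fst p, snd p))"
        by (metis mem_Times_iff)
      from choice[OF this] obtain v0 where v0: "\<forall>p. p \<in> C \<times> {1, -1} \<longrightarrow>
          potential_on X (\<psi> (fst p) ` smoothed_arc (s (fst p)) (snd p)) F (v0 p) \<and>
          v0 p (pt (fst p, snd p)) = w' (pt (fst p, snd p))" ..
      define v' where "v' x z = v0 (x, z)" for x z
      have "potential_on X (\<psi> x ` smoothed_arc (s x) z) F (v' x z) \<and> v' x z (pt (x, z)) = w' (pt (x, z))"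
        if "x \<in> C" "z \<in> {1, -1}" for x z
        using v0[rule_format, of "(x, z)"] that by (simp add: v'_def)
      then show ?thesis using cF F(3) w' by (intro exI[of _ F] exI[of _ w'] exI[of _ v']) simp
    qed
    define Q where "Q f F w' v' \<longleftrightarrow> cocycle_on X (resolved s) F \<and> (\<forall>z\<in>V. F z = f z) \<and> potential_on X Y F w' \<and>
        (\<forall>x\<in>C. \<forall>z\<in>{1, -1}. potential_on X (\<psi> x ` smoothed_arc (s x) z) F (v' x z) \<and> v' x z (pt (x, z)) = w' (pt (x, z)))"
      for f F w' v'
    have "\<forall>f. \<exists>t. Q f (fst t) (fst (snd t)) (snd (snd t))" using ex unfolding Q_def by simp
    from choice[OF this] obtain t where t: "\<And>f. Q f (fst (t f)) (fst (snd (t f))) (snd (snd (t f)))" by blast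
    define F where "F f = fst (t f)" for f
    define w' where "w' f = fst (snd (t f))" for f
    define v' where "v' f = snd (snd (t f))" for f
    have Q: "Q f (F f) (w' f) (v' f)" for f using t by (simp add: F_def w'_def v'_def)
    \<comment> \<open>The arc potential was normalised at the real end of the arc, so the mismatch
      is read off at the other end.\<close>
    define mm where "mm f = (\<lambda>(x, z). if x \<in> C \<and> z \<in> {1, -1} then
        w' f (pt (x, partner (s x) z)) + v' f x z (pt (x, partner (s x) z)) else 0)" for f
    have "2 ^ card V * card (bit_funs {..<m}) \<le> ?N"
    proof (rule LG.independent_count[OF V(1), of mm])
      show "mm f \<in> bit_funs (C \<times> {1, -1})" for f by (auto simp: mm_def bit_funs_def)
      fix f f' b assume f: "f \<in> bit_funs V" "f' \<in> bit_funs V" and b: "b \<in> LG.G" and eq: "mm f + mm f' = LG.mismatch s b"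
      obtain B a where Ba: "b = (B, a)" by fastforce
      define H where "H z = (F f z + F f' z) + cB B z" for z
      have cH: "cocycle_on X (resolved s) H"
        using Q[of f] Q[of f'] cocycle_on_mono[OF cocycle_cB[of B], of "resolved s"]
        unfolding H_def[abs_def] Q_def by (intro cocycle_on_add) auto
      have "kills_cycles X (resolved s) H"
      proof (rule glue_resolved[OF cH])
        show "potential_on X Y H (\<lambda>y. (w' f y + w' f' y) + wB B y + a (component y))"
          using Q[of f] Q[of f'] unfolding H_def[abs_def] Q_def
          by (intro potential_add_component potential_on_add wB) auto
        fix x z assume xz: "x \<in> C" "z \<in> {1::complex, -1}"
        \<comment> \<open>The shift that makes the potentials agree at the real end of the arc;
          agreement at the other end is then the equation
          \<open>mm f + mm f' = LG.mismatch s b\<close>.\<close>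
        let ?k = "\<mu> B (x, z) + a (ed (x, z))"
        let ?p = "pt (x, partner (s x) z)"
        have vU: "potential_on X (\<psi> x ` smoothed_arc (s x) z) (cB B) (vB B x)"
          by (rule potential_on_mono[OF vB[OF xz(1)]]) (use arc_in_chart[OF xz] in blast)
        have Qf: "potential_on X (\<psi> x ` smoothed_arc (s x) z) (F g) (v' g x z)" "v' g x z (pt (x, z)) = w' g (pt (x, z))" for g
          using Q[of g] xz unfolding Q_def by blast+
        show "potential_on X (\<psi> x ` smoothed_arc (s x) z) H (\<lambda>y. ((v' f x z y + v' f' x z y) + vB B x y) + ?k)"
          unfolding H_def[abs_def] by (intro potential_on_add_const potential_on_add Qf vU)
        have bits: "(p + q) + r + t = ((p + q) + u) + ((r + u) + t)" for p q r t u :: bit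
          by (cases p; cases q; cases r; cases t; cases u) auto
        show "(w' f (pt (x, z)) + w' f' (pt (x, z))) + wB B (pt (x, z)) + a (component (pt (x, z))) =
           ((v' f x z (pt (x, z)) + v' f' x z (pt (x, z))) + vB B x (pt (x, z))) + ?k"
          unfolding Qf(2) \<mu>_def fst_conv ed_component_eq by (rule bits)
        have e: "(mm f + mm f') (x, z) = LG.mismatch s b (x, z)" by (simp only: eq)
        have e': "(w' f ?p + v' f x z ?p) + (w' f' ?p + v' f' x z ?p) =
            ?k + ((wB B ?p + vB B x ?p) + a (component ?p))"
        proof -
          have "(mm f + mm f') (x, z) = (w' f ?p + v' f x z ?p) + (w' f' ?p + v' f' x z ?p)"
            using xz unfolding mm_def plus_fun_apply by simp
          moreover have "LG.mismatch s b (x, z) = ?k + ((wB B ?p + vB B x ?p) + a (component ?p))"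
            using xz unfolding LG.mismatch_def Ba fst_conv snd_conv case_prod_conv \<mu>_def[of B "(x, partner (s x) z)"] ed_component_eq[of "(x, partner (s x) z)"]
            by simp
          ultimately show ?thesis using e by simp
        qed
        have bits2: "(p1 + q1) + r + t = ((p2 + q2) + u) + k" if "(p1 + p2) + (q1 + q2) = k + ((r + u) + t)"
          for p1 q1 p2 q2 r t u k :: bit
          using that by (cases p1; cases q1; cases p2; cases q2; cases r; cases t; cases u; cases k) auto
        show "(w' f ?p + w' f' ?p) + wB B ?p + a (component ?p) = ((v' f x z ?p + v' f' x z ?p) + vB B x ?p) + ?k"
          using e' by (rule bits2)
      qed
      then have "H z = 0" if "z \<in> V" for z using that V(2) unfolding kills_cycles_def by blast
      moreover have "cB B z = 0" if "z \<in> V" for z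
      proof -
        have "z \<in> boundaries2 (subtopology X UNIV)" using that V(2) unfolding mod2_boundary_set_eq by auto
        then show ?thesis by (rule cocycle_on_boundaries2[OF cocycle_cB])
      qed
      moreover have "F g z = g z" if "z \<in> V" for g z using Q[of g] that unfolding Q_def by blast
      ultimately have "f z = f' z" if "z \<in> V" for z using that by (simp add: H_def bit_add_eq_0_iff)
      moreover have "f z = f' z" if "z \<notin> V" for z using f that by (simp add: bit_funs_def)
      ultimately show "f = f'" by (intro ext) blast
    qed
    then show "2 ^ card V \<le> ?N div 2 ^ m" by (simp add: card_bit_funs less_eq_div_iff_mult_less_eq)
  qed
  then show ?thesis by (simp add: less_eq_div_iff_mult_less_eq)
qed

end


section \<open>Cellularly embedded diagrams\<close>

lemma surface_locally_path_connected:
  assumes X: "closed_connected_oriented_surface X \<A>" and W: "openin X W" "y \<in> W"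
  shows "\<exists>Q. openin X Q \<and> path_connectedin X Q \<and> y \<in> Q \<and> Q \<subseteq> W"
proof -
  have "y \<in> topspace X" using W openin_subset by blast
  moreover have "(\<Union>c\<in>\<A>. fst c) = topspace X" "\<forall>c\<in>\<A>. surface_chart X c"
    using X by (auto simp: closed_connected_oriented_surface_def oriented_atlas_def)
  ultimately obtain c where "c \<in> \<A>" "y \<in> fst c" "surface_chart X c" by blast
  then obtain U \<phi> where U: "y \<in> U" "surface_chart X (U, \<phi>)" by (cases c) auto
  interpret coordinates X U "\<phi> ` U" \<phi> "inv_into U \<phi>" by (rule coordinates_of_chart[OF U(2)])
  have "continuous_map (top_of_set (\<phi> ` U)) X (inv_into U \<phi>)"
    using k_cont continuous_map_into_fulltopology by blast
  then have "openin (top_of_set (\<phi> ` U)) {z \<in> topspace (top_of_set (\<phi> ` U)). inv_into U \<phi> z \<in> W}"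
    using W(1) by (rule openin_continuous_map_preimage)
  then have "open {z \<in> \<phi> ` U. inv_into U \<phi> z \<in> W}" using B by (simp add: openin_open_eq)
  moreover have "\<phi> y \<in> {z \<in> \<phi> ` U. inv_into U \<phi> z \<in> W}" using U(1) W(2) k_h[OF U(1)] by simp
  ultimately obtain r where r: "0 < r" "ball (\<phi> y) r \<subseteq> {z \<in> \<phi> ` U. inv_into U \<phi> z \<in> W}"
    using open_contains_ball by blast
  then have rU: "ball (\<phi> y) r \<subseteq> \<phi> ` U" by blast
  have "y \<in> inv_into U \<phi> ` ball (\<phi> y) r"
    by (rule image_eqI[of _ _ "\<phi> y"]) (use r(1) k_h[OF U(1)] in auto)
  moreover have "path_connected (ball (\<phi> y) r)" by (simp add: convex_imp_path_connected)
  ultimately show ?thesis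
    using image_open[OF rU] image_path_connected[OF rU] r(2) by (intro exI[of _ "inv_into U \<phi> ` ball (\<phi> y) r"]) auto
qed

context diagram
begin

lemma diagram_locally_connected:
  assumes d: "d \<in> D"
  shows "\<exists>V. openin X V \<and> d \<in> V \<and> contractible_space (subtopology X V) \<and> path_connectedin X (V \<inter> D)"
proof (cases "d \<in> C")
  case True
  interpret coordinates X "U d" "ball 0 2" "\<phi> d" "\<psi> d" by (rule co[OF True])
  have "\<psi> d ` ball 0 2 = U d" unfolding image_eq[OF subset_refl] using h_in by blast
  then have "contractible_space (subtopology X (U d))"
    using image_contractible[OF subset_refl] by (simp add: convex_imp_contractible)
  moreover have "path_connectedin X (U d \<inter> D)"
    using image_path_connected[OF cross_sub cross_path_connected] unfolding D_U[OF True] by (simp add: Int_commute)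
  ultimately show ?thesis using UX chart(2)[OF True] by blast
next
  case False
  then have "\<exists>c. flat_chart X D d c"
    using link d by (simp add: link_diagram_def D_def C_def)
  then obtain V \<eta> where f: "flat_chart X D d (V, \<eta>)" by (metis prod.exhaust)
  then have V: "surface_chart X (V, \<eta>)" "d \<in> V" "\<eta> ` V = ball 0 1" "\<eta> ` (V \<inter> D) = {z \<in> ball 0 1. Im z = 0}"
    by (auto simp: flat_chart_def)
  interpret coordinates X V "ball 0 1" \<eta> "inv_into V \<eta>" using coordinates_of_chart[OF V(1)] V(3) by simp
  have "inv_into V \<eta> ` ball 0 1 = V" unfolding image_eq[OF subset_refl] using h_in by blast
  then have 1: "contractible_space (subtopology X V)"
    using image_contractible[OF subset_refl] by (simp add: convex_imp_contractible)
  have sub: "{z \<in> ball 0 1. Im z = 0} \<subseteq> ball (0::complex) 1" by blast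
  have "inv_into V \<eta> ` {z \<in> ball 0 1. Im z = 0} = V \<inter> D"
    unfolding V(4)[symmetric] image_image using k_h by force
  moreover have "convex {z \<in> ball 0 1. Im z = 0}"
  proof -
    have "{z \<in> ball (0::complex) 1. Im z = 0} = ball 0 1 \<inter> {z. Im z = 0}" by blast
    moreover have "convex {z. Im z = 0}" by (auto simp: convex_def)
    ultimately show ?thesis by (simp add: convex_Int)
  qed
  ultimately have "path_connectedin X (V \<inter> D)"
    using image_path_connected[OF sub convex_imp_path_connected] by simp
  then show ?thesis using 1 UX V(2) by blast
qed

lemma cellular_kills_cycles:
  assumes "cellularly_embedded X L" "cocycle_on X UNIV F" "kills_cycles X D F"
  shows "kills_cycles X UNIV F"
proof (rule kills_cycles_if_potential_on_cellular[OF comp_X Haus surface_locally_path_connected[OF surf] D_closed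
      diagram_locally_connected _ assms(2,3)])
  show "subtopology X K homeomorphic_space top_of_set (ball (0::complex) 1)"
    if "K \<in> connected_components_of (subtopology X (topspace X - D))" for K
    using assms(1) that by (simp add: cellularly_embedded_def D_def)
qed

text \<open>Without crossings the diagram is a circle, covered by two arcs that meet in two intervals. A
  cocycle is detected by whether potentials on the arcs that agree on one interval differ on the other.\<close>

lemma circle_diagram_cocycles:
  assumes C0: "C = {}" and F: "cocycle_on X D F" "\<not> kills_cycles X D F" and F': "cocycle_on X D F'" "\<not> kills_cycles X D F'"
  shows "kills_cycles X D (\<lambda>z. F z + F' z)"
proof (cases "D = {}")
  case True
  then show ?thesis
    using kills_cycles_if_local_potential[OF cocycle_on_add[OF F(1) F'(1)]] by blast
next
  case False
  have YD: "Y = D" by (simp add: Y_def C0)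
  obtain \<K> where \<K>: "finite \<K>" "disjoint \<K>" "\<Union>\<K> = L"
    "\<And>K. K \<in> \<K> \<Longrightarrow> \<exists>f. continuous_map (top_of_set (sphere (0::complex) 1)) X (\<lambda>z. fst (f z)) \<and>
        f ` sphere 0 1 = K \<and> inj_on f (sphere 0 1)"
    using link_circles by metis
  obtain y where y: "y \<in> D" using False by blast
  then obtain K where K: "K \<in> \<K>" "y \<in> fst ` K" using \<K>(3) by (auto simp: D_def projection_def)
  define E2 where "E2 = (\<Union>K'\<in>\<K> - {K}. fst ` K')"
  have cl: "closedin X (fst ` K')" if "K' \<in> \<K>" for K' using \<K>(4)[OF that] circle_compact by blast
  have cE2: "closedin X E2" unfolding E2_def using \<K>(1) cl by (intro closedin_Union) auto
  have D_eq: "D = fst ` K \<union> E2" using K(1) \<K>(3) by (auto simp: D_def projection_def E2_def)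
  have "fst ` K \<inter> E2 \<inter> D = {}"
  proof (rule ccontr)
    assume "fst ` K \<inter> E2 \<inter> D \<noteq> {}"
    then obtain x q K' where q: "q \<in> K" "x = fst q" "x \<in> Y" "x \<in> fst ` K'" "K' \<in> \<K>" "K' \<noteq> K"
      unfolding E2_def YD by blast
    then obtain q' where q': "q' \<in> K'" "x = fst q'" by blast
    have "(x, snd q) \<in> L" "(x, snd q') \<in> L" using q q' K(1) \<K>(3) by (metis UnionI prod.collapse)+
    then have "q = q'" using unique_lift q q' by (metis prod.collapse)
    then show False using q q' K(1) \<K>(2) by (auto simp: disjoint_def)
  qed
  moreover have "connectedin X D" using conn by (simp add: connected_diagram_def D_def)
  moreover have "fst ` K \<inter> D \<noteq> {}" using K(2) y by blast
  ultimately have "E2 \<inter> D = {}"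
    using cl[OF K(1)] cE2 D_eq unfolding connectedin_closedin by blast
  then have DK: "D = fst ` K" using D_eq by blast
  obtain f where f: "continuous_map (top_of_set (sphere (0::complex) 1)) X (\<lambda>z. fst (f z))"
    "f ` sphere 0 1 = K" "inj_on f (sphere 0 1)" using \<K>(4)[OF K(1)] by blast
  define k where "k z = fst (f z)" for z
  have k_im: "k ` sphere 0 1 = D" unfolding DK f(2)[symmetric] by (simp add: k_def image_image)
  have k_inj: "inj_on k (sphere 0 1)"
  proof (rule inj_onI)
    fix z z' assume z: "z \<in> sphere 0 1" "z' \<in> sphere 0 1" "k z = k z'"
    have "f z \<in> L" "f z' \<in> L" using z f(2) K(1) \<K>(3) by blast+
    moreover have "k z \<in> Y" using z k_im YD by blast
    ultimately have "snd (f z) = snd (f z')" using unique_lift z(3) unfolding k_def by (metis prod.collapse)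
    then have "f z = f z'" using z(3) by (simp add: k_def prod_eq_iff)
    then show "z = z'" using inj_onD[OF f(3)] z by blast
  qed
  have k_cont: "continuous_map (top_of_set (sphere 0 1)) X k" using f(1) by (simp add: k_def[abs_def])
  have hom: "homeomorphic_map (top_of_set (sphere (0::complex) 1)) (subtopology X D) k"
  proof (rule continuous_imp_homeomorphic_map)
    show "continuous_map (top_of_set (sphere (0::complex) 1)) (subtopology X D) k"
      by (rule continuous_map_into_subtopology[OF k_cont]) (use k_im in auto)
    show "Hausdorff_space (subtopology X D)" using Haus by (rule Hausdorff_space_subtopology)
  qed (use k_im k_inj DX in \<open>auto simp: compact_space_subtopology\<close>)
  have contr: "contractible_space (subtopology X (k ` A))" if A: "A \<subseteq> sphere 0 1" "contractible A" for A
  proof -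
    have "homeomorphic_map (subtopology (top_of_set (sphere 0 1)) A) (subtopology (subtopology X D) (k ` A)) k"
      by (rule homeomorphic_map_subtopologies[OF hom]) (use A k_im k_inj DX in \<open>auto dest: inj_onD\<close>)
    moreover have "sphere 0 1 \<inter> A = A" "D \<inter> k ` A = k ` A" using A k_im by auto
    ultimately have "homeomorphic_map (top_of_set A) (subtopology X (k ` A)) k"
      by (simp add: subtopology_subtopology)
    then show ?thesis
      using homeomorphic_space_contractibility[OF homeomorphic_map_imp_homeomorphic_space] A(2) by fastforce
  qed
  have pconn: "path_connectedin X (k ` A)" if "A \<subseteq> sphere 0 1" "path_connected A" for A
    by (rule path_connectedin_continuous_map_image[OF k_cont]) (use that in \<open>simp add: path_connectedin_subtopology\<close>)
  \<comment> \<open>The circle without \<open>1\<close> and the circle without \<open>-1\<close>.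
    Their overlap consists of the open upper and lower halves \<open>Q1\<close> and
    \<open>Q2\<close>.\<close>
  define A1 where "A1 = sphere 0 1 - {1::complex}"
  define A2 where "A2 = uminus ` A1"
  have A1_cis: "A1 = cis ` {0<..<2 * pi}"
  proof (intro equalityI subsetI)
    fix z assume z: "z \<in> A1"
    have "z = cis (Arg2pi z)" using Arg2pi_eq[of z] z by (simp add: A1_def cis_conv_exp)
    moreover have "Arg2pi z \<noteq> 0" using calculation z by (metis A1_def Diff_iff cis_zero singletonI)
    ultimately show "z \<in> cis ` {0<..<2 * pi}" using Arg2pi[of z] by (intro image_eqI[of _ _ "Arg2pi z"]) auto
  next
    fix z assume "z \<in> cis ` {0<..<2 * pi}"
    then obtain t where t: "z = cis t" "0 < t" "t < 2 * pi" by auto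
    have "cis t \<noteq> 1"
    proof
      assume "cis t = 1"
      then have "cos t = 1" by (simp add: complex_eq_iff)
      then obtain n :: int where "t = n * (2 * pi)" using cos_one_2pi_int by (auto simp: algebra_simps)
      then show False using t by (auto simp: zero_less_mult_iff)
    qed
    then show "z \<in> A1" using t by (simp add: A1_def)
  qed
  have cis_hom: "cis ` {0<..<2 * pi} homeomorphic {0<..<2 * pi}"
  proof (rule homeomorphicI[of Arg2pi _ _ cis])
    have inv: "Arg2pi (cis t) = t" if "t \<in> {0<..<2 * pi}" for t
      using Arg2pi_unique[of 1 t "cis t"] that by (simp add: cis_conv_exp)
    show "Arg2pi ` cis ` {0<..<2 * pi} = {0<..<2 * pi}" using inv by (force simp: image_image)
    show "cis (Arg2pi z) = z" if "z \<in> cis ` {0<..<2 * pi}" for z using that inv by auto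
    show "Arg2pi (cis t) = t" if "t \<in> {0<..<2 * pi}" for t by (rule inv[OF that])
    have "z \<notin> \<real>\<^sub>\<ge>\<^sub>0" if "z \<in> A1" for z
    proof
      assume "z \<in> \<real>\<^sub>\<ge>\<^sub>0"
      then obtain r where "z = of_real r" "0 \<le> r" by (auto elim: nonneg_Reals_cases)
      then show False using that by (auto simp: A1_def)
    qed
    then show "continuous_on (cis ` {0<..<2 * pi}) Arg2pi"
      unfolding A1_cis[symmetric] by (intro continuous_at_imp_continuous_on ballI continuous_at_Arg2pi) auto
  qed (auto intro!: continuous_intros)
  have "contractible {0<..<2 * pi}" by (simp add: convex_imp_contractible)
  then have cA1: "contractible A1" unfolding A1_cis by (rule homeomorphic_contractible[OF _ homeomorphic_sym[THEN iffD1, OF cis_hom]])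
  moreover have "A1 homeomorphic A2"
    unfolding A2_def by (rule homeomorphicI[of uminus _ _ uminus]) (auto intro!: continuous_intros simp: image_image)
  ultimately have cA2: "contractible A2" by (rule homeomorphic_contractible)
  have A2_iff: "z \<in> A2 \<longleftrightarrow> norm z = 1 \<and> z \<noteq> -1" for z
  proof
    assume "norm z = 1 \<and> z \<noteq> -1"
    then have "- z \<noteq> 1" "norm (- z) = 1" using minus_minus[of z] by fastforce+
    then have "- z \<in> A1" by (simp add: A1_def)
    then show "z \<in> A2" unfolding A2_def by (rule rev_image_eqI) simp
  qed (auto simp: A2_def A1_def)
  have A2_eq: "A2 = sphere 0 1 - {-1}"
    by (rule Set.set_eqI) (simp only: A2_iff Diff_iff singleton_iff mem_sphere_0)
  have "A1 \<subseteq> sphere 0 1" "A2 \<subseteq> sphere 0 1" unfolding A1_def A2_eq by (rule Diff_subset)+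
  note A12 = this A2_eq
  define Q1 where "Q1 = {z::complex. norm z = 1 \<and> 0 < Im z}"
  define Q2 where "Q2 = uminus ` Q1"
  have Q1_cis: "Q1 = cis ` {0<..<pi}"
  proof (intro equalityI subsetI)
    fix z assume z: "z \<in> Q1"
    have zz: "z = cis (Arg2pi z)" using Arg2pi_eq[of z] z by (simp add: Q1_def cis_conv_exp)
    then have "0 < sin (Arg2pi z)" using z by (metis (mono_tags, lifting) Q1_def cis.sel(2) mem_Collect_eq)
    then have "Arg2pi z \<noteq> 0" "Arg2pi z < pi"
      using sin_le_zero[of "Arg2pi z"] Arg2pi[of z] by (auto simp: not_less[symmetric])
    then show "z \<in> cis ` {0<..<pi}" using zz Arg2pi[of z] by (intro image_eqI[of _ _ "Arg2pi z"]) auto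
  qed (auto simp: Q1_def sin_gt_zero)
  have pQ1: "path_connected Q1" unfolding Q1_cis
    by (rule path_connected_continuous_image) (auto intro!: continuous_intros convex_imp_path_connected)
  have pQ2: "path_connected Q2" unfolding Q2_def
    by (rule path_connected_continuous_image[OF _ pQ1]) (auto intro!: continuous_intros)
  have Qs: "A1 \<inter> A2 = Q1 \<union> Q2"
  proof (intro equalityI subsetI)
    fix z assume z: "z \<in> A1 \<inter> A2"
    have "Im z \<noteq> 0"
    proof
      assume "Im z = 0"
      then have "\<bar>Re z\<bar> = 1" using z A12(1) by (auto simp: cmod_def)
      then have "z = 1 \<or> z = -1" using \<open>Im z = 0\<close> by (auto simp: complex_eq_iff)
      then show False using z A12(3) by (auto simp: A1_def)
    qed
    moreover have "norm z = 1" using z A12(1) by auto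
    ultimately consider "0 < Im z" | "0 < Im (- z)" by fastforce
    then show "z \<in> Q1 \<union> Q2"
    proof cases
      case 2
      then have "- z \<in> Q1" using \<open>norm z = 1\<close> by (simp add: Q1_def)
      then show ?thesis unfolding Q2_def by (metis UnI2 add.inverse_inverse image_eqI)
    qed (use \<open>norm z = 1\<close> in \<open>simp add: Q1_def\<close>)
  qed (auto simp: A12(3) A1_def Q1_def Q2_def complex_eq_iff)
  have Qsub: "Q1 \<subseteq> sphere 0 1" "Q2 \<subseteq> sphere 0 1" by (auto simp: Q1_def Q2_def)
  have int: "k ` A1 \<inter> k ` A2 = k ` Q1 \<union> k ` Q2"
    using inj_on_image_Int[OF k_inj A12(1,2)] Qs by (simp add: image_Un)
  have nb: "\<exists>W. openin X W \<and> y \<in> W \<and> (D \<inter> W \<subseteq> k ` A1 \<or> (\<exists>i\<in>{()}. D \<inter> W \<subseteq> k ` A2))" if y: "y \<in> D" for y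
  proof -
    have "k 1 \<noteq> k (-1)" using inj_onD[OF k_inj, of 1 "-1"] by auto
    have o: "openin X (topspace X - {x})" if "x \<in> D" for x
      using closedin_Hausdorff_singleton[OF Haus] that DX by blast
    have k1: "k 1 \<in> D" "k (-1) \<in> D" using k_im by auto
    have i: "D \<inter> (topspace X - {k z}) \<subseteq> k ` (sphere 0 1 - {z})" for z using k_im by blast
    show ?thesis
    proof (cases "y = k 1")
      case True
      then show ?thesis using o[OF k1(2)] i[of "-1"] \<open>k 1 \<noteq> k (-1)\<close> y DX unfolding A12(3)
        by (intro exI[of _ "topspace X - {k (-1)}"]) auto
    next
      case False
      then show ?thesis using o[OF k1(1)] i[of 1] y DX unfolding A1_def
        by (intro exI[of _ "topspace X - {k 1}"]) auto
    qed
  qed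
  \<comment> \<open>One base point in each half, \<open>\<i>\<close> or \<open>- \<i>\<close>,
    decides whether the potentials agree on that half.\<close>
  have agree: "kills_cycles X D H" if H: "cocycle_on X D H" and p: "potential_on X (k ` A1) H p" "potential_on X (k ` A2) H q"
    and eq: "p (k \<i>) = q (k \<i>)" "p (k (-\<i>)) = q (k (-\<i>))" for H p q
  proof (rule glue_potentials[OF H p(1), of "{()}" "\<lambda>_. k ` A2" "\<lambda>_. q"])
    have iQ: "\<i> \<in> Q1" "- \<i> \<in> Q2" by (auto simp: Q1_def Q2_def)
    fix y assume y: "y \<in> k ` A1" "y \<in> k ` A2"
    have *: "p y = q y" if Q: "Q \<subseteq> sphere 0 1" "path_connected Q" "k ` Q \<subseteq> k ` A1 \<inter> k ` A2" "z \<in> Q" "p (k z) = q (k z)" "y \<in> k ` Q" for Q z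
    proof -
      have "p y + q y = p (k z) + q (k z)"
        by (rule potentials_differ_by_const[OF potential_on_mono[OF p(1)] potential_on_mono[OF p(2)] pconn[OF Q(1,2)] Q(6)])
          (use Q in auto)
      then show ?thesis using Q(5) by (simp add: bit_add_eq_0_iff)
    qed
    have "y \<in> k ` Q1 \<or> y \<in> k ` Q2" using y int by blast
    then show "p y = q y"
      using *[OF Qsub(1) pQ1 _ iQ(1) eq(1)] *[OF Qsub(2) pQ2 _ iQ(2) eq(2)] int by blast
  qed (use p nb in auto)
  have ex: "\<exists>p q. potential_on X (k ` A1) H p \<and> potential_on X (k ` A2) H q \<and> p (k \<i>) = q (k \<i>)" if H: "cocycle_on X D H" for H
  proof -
    have "k ` A1 \<subseteq> D" "k ` A2 \<subseteq> D" using A12 k_im by blast+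
    then obtain p q where pq: "potential_on X (k ` A1) H p" "potential_on X (k ` A2) H q"
      using potential_exists_contractible[OF cocycle_on_mono[OF H] contr[OF A12(1) cA1]]
        potential_exists_contractible[OF cocycle_on_mono[OF H] contr[OF A12(2) cA2]] by blast
    have "p (k \<i>) = q (k \<i>) + (q (k \<i>) + p (k \<i>))"
      by (simp only: add.assoc[symmetric] bit_add_self add_0_left)
    then show ?thesis using pq(1) potential_on_add_const[OF pq(2)] by blast
  qed
  obtain p q where pq: "potential_on X (k ` A1) F p" "potential_on X (k ` A2) F q" "p (k \<i>) = q (k \<i>)"
    using ex[OF F(1)] by blast
  obtain p' q' where pq': "potential_on X (k ` A1) F' p'" "potential_on X (k ` A2) F' q'" "p' (k \<i>) = q' (k \<i>)"
    using ex[OF F'(1)] by blast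
  have "p (k (-\<i>)) \<noteq> q (k (-\<i>))" "p' (k (-\<i>)) \<noteq> q' (k (-\<i>))"
    using agree[OF F(1) pq] agree[OF F'(1) pq'] F(2) F'(2) by blast+
  \<comment> \<open>Two differences that are both non-zero mod 2 cancel.\<close>
  then have "p (k (-\<i>)) + p' (k (-\<i>)) = q (k (-\<i>)) + q' (k (-\<i>))"
    by (cases "p (k (-\<i>))"; cases "q (k (-\<i>))"; cases "p' (k (-\<i>))"; cases "q' (k (-\<i>))") auto
  then show ?thesis
    by (intro agree[OF cocycle_on_add[OF F(1) F'(1)] potential_on_add[OF pq(1) pq'(1)] potential_on_add[OF pq(2) pq'(2)]])
      (use pq(3) pq'(3) in simp_all)
qed

text \<open>If \<open>V\<close> had two elements, the functionals dual to them would be nontrivial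
  on the circle, so their sum would kill its cycles; yet the sum is 1 on the first element.\<close>

lemma circle_diagram_nullity:
  assumes "C = {}"
  shows "homological_nullity X D \<le> 1"
proof -
  let ?D = "subtopology X D"
  have "2 ^ homological_nullity X D \<le> (2::nat)"
  proof (rule nullity_bound)
    fix V assume V: "finite V" "V \<subseteq> mod2_cycle_set 1 ?D \<inter> mod2_boundary_set 1 X"
      and ind: "\<And>J. J \<subseteq> V \<Longrightarrow> J \<noteq> {} \<Longrightarrow> \<Sum>J \<notin> mod2_boundary_set 1 ?D"
    have ind': "\<Sum>J \<notin> boundaries2 ?D" if "J \<subseteq> V" "J \<noteq> {}" for J
    proof -
      have "singular_chain 1 ?D (\<Sum>J)"
        using V(2) that(1) by (intro singular_chain_sum) (auto simp: mod2_cycle_set_def)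
      then show ?thesis using ind[OF that] unfolding mod2_boundary_set_eq by blast
    qed
    have ex: "\<exists>F. cocycle_on X D F \<and> (\<forall>z\<in>V. F z = f z)" for f
    proof -
      have "\<exists>F. additive_map F \<and> (\<forall>x\<in>boundaries2 ?D. F x = 0) \<and> (\<forall>z\<in>V. F z = f z)"
        using dual_functionals[OF add_subgroup_boundaries2 double_in_boundaries2 V(1), of "\<lambda>z. z"] ind' by simp
      then show ?thesis using kills_boundaries2 by blast
    qed
    have "z1 = z2" if z: "z1 \<in> V" "z2 \<in> V" for z1 z2
    proof (rule ccontr)
      assume ne: "z1 \<noteq> z2"
      obtain F1 where F1: "cocycle_on X D F1" "\<forall>z\<in>V. F1 z = (if z = z1 then 1 else 0)"
        using ex[of "\<lambda>z. if z = z1 then 1 else 0"] by blast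
      obtain F2 where F2: "cocycle_on X D F2" "\<forall>z\<in>V. F2 z = (if z = z2 then 1 else 0)"
        using ex[of "\<lambda>z. if z = z2 then 1 else 0"] by blast
      have cyc: "z1 \<in> mod2_cycle_set 1 ?D" "z2 \<in> mod2_cycle_set 1 ?D" using V(2) z by auto
      have v: "F1 z1 = 1" "F2 z2 = 1" "F2 z1 = 0" using F1(2) F2(2) z ne by simp_all
      have "\<not> kills_cycles X D F1" "\<not> kills_cycles X D F2"
        using cyc v zero_neq_one unfolding kills_cycles_def by metis+
      then have "kills_cycles X D (\<lambda>z. F1 z + F2 z)" using circle_diagram_cocycles[OF assms] F1(1) F2(1) by blast
      then have "F1 z1 + F2 z1 = 0" using cyc(1) unfolding kills_cycles_def by blast
      then show False using v by simp
    qed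
    then have "card V \<le> 1" using card_le_Suc0_iff_eq[OF V(1)] by auto
    then show "2 ^ card V \<le> (2::nat)" using power_increasing[of "card V" 1 "2::nat"] by simp
  qed
  then have "2 ^ homological_nullity X D \<le> (2::nat) ^ 1" by simp
  then show ?thesis by (simp only: power_increasing_iff one_less_numeral_iff semiring_norm)
qed

text \<open>For positive genus two dual cocycles of the surface would both be nontrivial on
  \<open>D\<close> by cellularity. Their sum would be trivial on \<open>D\<close> and hence on the
  surface, contrary to its value 1 on \<open>z 0\<close>.\<close>

lemma circle_diagram_genus:
  assumes "C = {}" "has_genus X g" "cellularly_embedded X L"
  shows "g = 0"
proof (rule ccontr)
  assume "g \<noteq> 0"
  then have g: "0 < 2 * g" "1 < 2 * g" by auto
  obtain c z where cz: "\<And>i. i < 2 * g \<Longrightarrow> cocycle_on X UNIV (c i)" "\<And>j. j < 2 * g \<Longrightarrow> z j \<in> mod2_cycle_set 1 X"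
    "\<And>i j. i < 2 * g \<Longrightarrow> j < 2 * g \<Longrightarrow> c i (z j) = (if i = j then 1 else 0 :: bit)"
    using genus_cocycles[OF assms(2)] by metis
  have nk: "\<not> kills_cycles X D F" if "cocycle_on X UNIV F" "F (z j) = 1" "j < 2 * g" for F j
  proof
    assume "kills_cycles X D F"
    then have "kills_cycles X UNIV F" by (rule cellular_kills_cycles[OF assms(3) that(1)])
    then have "F (z j) = 0" using cz(2)[OF that(3)] by (simp add: kills_cycles_def)
    then show False using that(2) by simp
  qed
  have c01: "cocycle_on X UNIV (c 0)" "cocycle_on X UNIV (c 1)" using cz(1) g by blast+
  have "\<not> kills_cycles X D (c 0)" "\<not> kills_cycles X D (c 1)"
    using nk[OF c01(1), of 0] nk[OF c01(2), of 1] cz(3) g by auto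
  then have "kills_cycles X D (\<lambda>z. c 0 z + c 1 z)"
    using circle_diagram_cocycles[OF assms(1)] cocycle_on_mono[OF c01(1)] cocycle_on_mono[OF c01(2)] by blast
  moreover have "c 0 (z 0) + c 1 (z 0) = 1" using cz(3) g by simp
  ultimately show False using nk[OF cocycle_on_add[OF c01], of 0] g by blast
qed

text \<open>Here a state and its dual are both the diagram itself, so a bound by 1 for each gives
  the total 2, and cellularity leaves only genus 0.\<close>

lemma state_bounds_no_crossing:
  assumes "C = {}" "has_genus X g"
  shows "card (state_cycles X (resolved s)) \<le> 1"
    "cellularly_embedded X L \<Longrightarrow> homological_nullity X (resolved s) \<le> 1 \<and> g = 0"
proof -
  have rD: "resolved s = D" by (simp add: resolved_def Y_def assms(1))
  have "connectedin X D" using conn by (simp add: connected_diagram_def D_def)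
  then have "connected_space (subtopology X D)" by (simp add: connectedin_def)
  then have ct: "connectedin (subtopology X D) (topspace (subtopology X D))"
    by (simp only: connectedin_topspace)
  have "K = topspace (subtopology X D)" if K: "K \<in> connected_components_of (subtopology X D)" for K
  proof
    show sub: "K \<subseteq> topspace (subtopology X D)" by (rule connected_components_of_subset[OF K])
    have "\<not> disjnt K (topspace (subtopology X D))"
      using sub nonempty_connected_components_of[OF K] unfolding disjnt_def by blast
    then show "topspace (subtopology X D) \<subseteq> K" by (rule connected_components_of_maximal[OF K ct])
  qed
  then have "connected_components_of (subtopology X D) \<subseteq> {topspace (subtopology X D)}" by blast
  then have "card (connected_components_of (subtopology X D)) \<le> card {topspace (subtopology X D)}" by (intro card_mono) auto
  then show "card (state_cycles X (resolved s)) \<le> 1" by (simp add: rD state_cycles_def)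
  show "homological_nullity X (resolved s) \<le> 1 \<and> g = 0" if "cellularly_embedded X L"
    using circle_diagram_nullity[OF assms(1)] circle_diagram_genus[OF assms that] by (simp add: rD)
qed

section \<open>The inequalities for diagrams with crossings\<close>

lemma state_cycles_bound:
  assumes "C \<noteq> {}"
  shows "card (state_cycles X (resolved s)) + card (state_cycles X (resolved (opposite_smoothing \<circ> s))) \<le> card C + 2"
proof -
  \<comment> \<open>With \<open>m = 0\<close> labels are functions on the edges only, and zero
    functions fill the remaining parameters.\<close>
  interpret cocycle_diagram X \<A> L \<Phi> 0 "\<lambda>_ _. 0" "\<lambda>_ _. 0" "\<lambda>_ _ _. 0"
    by unfold_locales (use assms in \<open>auto simp: bit_funs_def fun_eq_iff\<close>)
  let ?a = "card (state_cycles X (resolved s))" and ?b = "card (state_cycles X (resolved (opposite_smoothing \<circ> s)))"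
  have "(2::nat) ^ (?a + ?b) \<le> 2 ^ (card C + 2)"
    unfolding power_add[of 2 ?a]
    using mult_le_mono[OF state_cycles_count[of s] state_cycles_count[of "opposite_smoothing \<circ> s"]]
      labellings_product_le[of s] by (simp only: power_0 mult_1_left)
  then show ?thesis by (simp only: power_increasing_iff one_less_numeral_iff semiring_norm)
qed

text \<open>Both lower bounds carry the factor \<open>2 ^ (2 * g)\<close>, the upper bound carries
  it once; the surplus is the term \<open>2 * g\<close> in the conclusion.\<close>

lemma nullity_sum_bound:
  assumes ne: "C \<noteq> {}" and g: "has_genus X g" and cell: "cellularly_embedded X L"
  shows "homological_nullity X (resolved s) + homological_nullity X (resolved (opposite_smoothing \<circ> s)) + 2 * g \<le> card C + 2"
proof -
  obtain c z where cz: "\<And>i. i < 2 * g \<Longrightarrow> cocycle_on X UNIV (c i)" "\<And>j. j < 2 * g \<Longrightarrow> z j \<in> mod2_cycle_set 1 X"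
    "\<And>i j. i < 2 * g \<Longrightarrow> j < 2 * g \<Longrightarrow> c i (z j) = (if i = j then 1 else 0 :: bit)"
    using genus_cocycles[OF g] by metis
  have "\<exists>w. potential_on X Y (c i) w" if "i < 2 * g" for i
    using potential_on_Y[OF ne cocycle_on_mono[OF cz(1)[OF that]]] by blast
  then obtain w where w: "\<And>i. i < 2 * g \<Longrightarrow> potential_on X Y (c i) (w i)" by metis
  have "\<exists>v. potential_on X (U x) (c i) v" if "i < 2 * g" "x \<in> C" for i x
  proof -
    interpret coordinates X "U x" "ball 0 2" "\<phi> x" "\<psi> x" by (rule co[OF that(2)])
    have "\<psi> x ` ball 0 2 = U x" unfolding image_eq[OF subset_refl] using h_in by blast
    then have "contractible_space (subtopology X (U x))"
      using image_contractible[OF subset_refl] by (simp add: convex_imp_contractible)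
    then show ?thesis using potential_exists_contractible[OF cocycle_on_mono[OF cz(1)[OF that(1)]]] by blast
  qed
  then obtain v where v: "\<And>i x. i < 2 * g \<Longrightarrow> x \<in> C \<Longrightarrow> potential_on X (U x) (c i) (v i x)" by metis
  \<comment> \<open>By cellularity the combination kills the cycles of the surface too; its value on
    \<open>z j\<close> is the coefficient \<open>B j\<close>.\<close>
  have indep: "B = 0" if B: "B \<in> bit_funs {..<2 * g}" and k: "kills_cycles X D (\<lambda>z. \<Sum>i<2 * g. B i * c i z)" for B
  proof
    fix j
    define H where "H z = (\<Sum>i<2 * g. B i * c i z)" for z
    have "H (a + b) = H a + H b" for a b
      unfolding H_def sum.distrib[symmetric]
      by (rule sum.cong) (use cz(1) in \<open>auto simp: cocycle_on_def additive_map_def distrib_left\<close>)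
    moreover have "H (chain_boundary 2 e) = 0" if "singular_chain 2 (subtopology X UNIV) e" for e
      unfolding H_def by (rule sum.neutral) (use cz(1) that in \<open>auto simp: cocycle_on_def\<close>)
    ultimately have "cocycle_on X UNIV H" by (auto simp: cocycle_on_def additive_map_def)
    then have H: "kills_cycles X UNIV H" using cellular_kills_cycles[OF cell] k by (simp add: H_def[abs_def])
    show "B j = 0 j"
    proof (cases "j < 2 * g")
      case True
      have "H (z j) = (\<Sum>i<2 * g. if i = j then B j else 0)"
        unfolding H_def by (rule sum.cong) (use cz(3) True in auto)
      also have "\<dots> = B j" using True by (simp add: sum.delta)
      finally show ?thesis using H cz(2)[OF True] by (simp add: kills_cycles_def)
    qed (use B in \<open>simp add: bit_funs_def\<close>)
  qed
  interpret cocycle_diagram X \<A> L \<Phi> "2 * g" c w v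
    by unfold_locales (use ne cz(1) w v indep in auto)
  let ?a = "homological_nullity X (resolved s)" and ?b = "homological_nullity X (resolved (opposite_smoothing \<circ> s))"
  have "((2::nat) ^ ?a * 2 ^ (2 * g)) * (2 ^ ?b * 2 ^ (2 * g)) \<le> 2 ^ (2 * g) * 2 ^ (card C + 2)"
    using mult_le_mono[OF nullity_count[of s] nullity_count[of "opposite_smoothing \<circ> s"]] labellings_product_le[of s]
    by (rule order_trans)
  then have "(2::nat) ^ ((?a + 2 * g) + (?b + 2 * g)) \<le> 2 ^ (2 * g + (card C + 2))"
    by (simp only: power_add)
  then have "(?a + 2 * g) + (?b + 2 * g) \<le> 2 * g + (card C + 2)"
    by (simp only: power_increasing_iff one_less_numeral_iff semiring_norm)
  then show ?thesis by linarith
qed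

end

theorem lemma2p10:
  fixes X :: "'a topology" and \<A> :: "'a chart set" and g n :: nat
    and L :: "('a \<times> real) set" and \<Phi> :: "'a \<Rightarrow> 'a chart" and \<sigma> :: "'a \<Rightarrow> smoothing"
  assumes "closed_connected_oriented_surface X \<A>" and "has_genus X g"
    and "link_diagram X \<A> L" and "connected_diagram X L" and "card (crossings L) = n"
    and "crossing_charts X \<A> L \<Phi>"
    and "S = state L \<Phi> \<sigma>" and "S' = dual_state L \<Phi> \<sigma>"
  shows "card (state_cycles X S) + card (state_cycles X S') \<le> n + 2 \<and>
    (cellularly_embedded X L \<longrightarrow>
      int (homological_nullity X S) + int (homological_nullity X S') \<le> int n + 2 - 2 * int g)"
proof -
  interpret diagram X \<A> L \<Phi> by unfold_locales (use assms in auto)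
  have S: "S = resolved \<sigma>" "S' = resolved (opposite_smoothing \<circ> \<sigma>)"
    using assms(7,8) state_eq by (simp_all add: dual_state_def)
  have n: "card C = n" using assms(5) by (simp add: C_def)
  show ?thesis
  \<comment> \<open>Without crossings \<open>Y\<close> is the whole diagram and \<open>P\<close> is
    empty, so there are no edges with ends to count.\<close>
  proof (cases "C = {}")
    case True
    then show ?thesis
      using state_bounds_no_crossing[OF True assms(2), of \<sigma>] state_bounds_no_crossing[OF True assms(2), of "opposite_smoothing \<circ> \<sigma>"]
      unfolding S by auto
  next
    case False
    have "int (homological_nullity X S) + int (homological_nullity X S') \<le> int n + 2 - 2 * int g"
      if "cellularly_embedded X L"
      using nullity_sum_bound[OF False assms(2) that, of \<sigma>] unfolding S n by linarith
    then show ?thesis using state_cycles_bound[OF False, of \<sigma>] unfolding S n by blast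
  qed
qed

end
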